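(* Let $X$ be a smooth projective toric scheme of relative dimension $d$ over $\mathrm{Spec}(\mathbb{Z})$, let $D$ be an equivariant Cartier divisor on $X$ such that $\mathcal{O}(D)$ is generated by its global sections, and let $\overline{D}_\infty=(D,\|\cdot\|_{D,\infty})$ be $\mathcal{O}(D)$ endowed with its canonical metric. Then for every integer $l\ge 1$, $$\widehat{H}^0(X,l\overline{D}_\infty)=\bigl\{\pm\chi^m \,\bigl|\, m\in l\Delta_D\cap P\bigr\}\cup\{0\}.$$ In particular, $l\overline{D}_\infty$ is nef but it is not big.
   Context: Toric setting. $Q$ is a free $\mathbb{Z}$-module of rank $d$, $P$ its dual, $Q_{\mathbb{R}}=Q\otimes_{\mathbb{Z}}\mathbb{R}$, $P_{\mathbb{R}}=P\otimes_{\mathbb{Z}}\mathbb{R}$. $X$ is the toric scheme over $\mathrm{Spec}(\mathbb{Z})$ attached to a fan $\Sigma$ in $Q_{\mathbb{R}}$ (obtained by gluing the $\mathrm{Spec}\,\mathbb{Z}[P\cap\sigma^*]$, $\sigma\in\Sigma$, where $\sigma^*$ is the dual cone). It contains the torus $\mathbb{T}=\mathrm{Spec}\,\mathbb{Z}[P]$ as an open subset, and $\mathbb{T}$ acts on $X$. For $m\in P$, $\chi^m$ is the corresponding character of $\mathbb{T}$, seen as a rational function on $X$. An equivariant Cartier divisor $D$ is a $\mathbb{T}$-invariant one; it corresponds to a continuous function $\psi_D:Q_{\mathbb{R}}\to\mathbb{R}$ with $\psi_D(u)=\langle m_\sigma,u\rangle$ on each $\sigma\in\Sigma$ ($m_\sigma\in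 P$), $D$ having local equation $\chi^{-m_\sigma}$ on $\mathrm{Spec}\,\mathbb{Z}[P\cap\sigma^*]$. Put $\Delta_D=\{x\in P_{\mathbb{R}} : \langle x,u\rangle\ge\psi_D(u)\ \forall u\in Q_{\mathbb{R}}\}$. Then $H^0(X,\mathcal{O}(lD))=\bigoplus_{m\in l\Delta_D\cap P}\mathbb{Z}\chi^m$. Canonical metric. If $\mathcal{O}(D)$ is generated by its global sections, let $k_D=\#(\Delta_D\cap P)-1$ and $\phi_D:X\to\mathbb{P}^{k_D}$, $x\mapsto(\chi^m(x))_{m\in\Delta_D\cap P}$. Endow $\mathcal{O}(1)$ on $\mathbb{P}^{k_D}(\mathbb{C})$ with the metric $\|s(x)\|_\infty=|s(x)|/\sup_{0\le i\le k_D}|x_i|$; the canonical metric on $\mathcal{O}(D)=\phi_D^*\mathcal{O}(1)$ is $\|\cdot\|_{D,\infty}=\phi_D^*\|\cdot\|_\infty$. For a line bundle $\overline{D}=(D,\|\cdot\|_{\overline{D}})$ with continuous hermitian metric, $l\overline{D}$ is $\mathcal{O}(lD)$ with the $l$-th tensor power metric, $\|s\|_{\sup}=\sup_{x\in X(\mathbb{C})}\|s\|(x)$, and $\widehat{H}^0(X,l\overline{D})=\{s\in H^0(X,\mathcal{O}(lD)) : \|s\|_{\sup}\le 1\}$. Positivity notions for a line bundle $\overline{L}$ on $X$ with continuous hermitian metric. - $\overline{L}$ is nef if $L$ is relatively nef, the Chern current $c_1(\overline{L})$ is semi-positive on $X(\mathbb{C})$, and $h_{\overline{L}}(x)\ge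 0$ for all $x\in X(\overline{\mathbb{Q}})$. Here, if $x$ is defined over a number field $K$ with ring of integers $\mathcal{O}_K$, $\varepsilon_x:\mathrm{Spec}(\mathcal{O}_K)\to X$ is the corresponding morphism and $s$ is a nonzero element of $\varepsilon_x^*L$, then $h_{\overline{L}}(x)=\frac{1}{[K:\mathbb{Q}]}\bigl(\log\#(\varepsilon_x^*L/\mathcal{O}_K s)-\sum_{\sigma:K\to\mathbb{C}}\log\|s\|_{\overline{L},\sigma}(x)\bigr)$. - $\overline{L}$ is big ("gros") if the restriction of $L$ to the generic fibre of $X$ is big and there exist an integer $l\ge1$ and a nonzero global section $s$ of $L^{\otimes l}$ such that $\|s\|_{\overline{L}^{\otimes l}}(x)<1$ for all $x\in X(\mathbb{C})$. *)

theory Defs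
  imports
    "HOL-Analysis.Analysis"
    "HOL-Library.Poly_Mapping"
    "HOL-Computational_Algebra.Fraction_Field"
    "HOL-Computational_Algebra.Polynomial"
    "HOL-Combinatorics.Permutations"
begin

section \<open>Subrings of a field, localizations\<close>

definition is_subring :: "'k::field set \<Rightarrow> bool" where
  "is_subring A \<longleftrightarrow> 1 \<in> A \<and> (\<forall>a\<in>A. \<forall>b\<in>A. a - b \<in> A \<and> a * b \<in> A)"

definition is_ideal :: "'k::field set \<Rightarrow> 'k set \<Rightarrow> bool" where
  "is_ideal A J \<longleftrightarrow>
     J \<subseteq> A \<and> 0 \<in> J \<and> (\<forall>a\<in>J. \<forall>b\<in>J. a + b \<in> J) \<and> (\<forall>r\<in>A. \<forall>a\<in>J. r * a \<in> J)"

definition is_prime_ideal :: "'k::field set \<Rightarrow> 'k set \<Rightarrow> bool" where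
  "is_prime_ideal A p \<longleftrightarrow>
     is_ideal A p \<and> 1 \<notin> p \<and> (\<forall>a\<in>A. \<forall>b\<in>A. a * b \<in> p \<longrightarrow> a \<in> p \<or> b \<in> p)"

definition localize :: "'k::field set \<Rightarrow> 'k set \<Rightarrow> 'k set" where
  "localize A p = {a / b | a b. a \<in> A \<and> b \<in> A \<and> b \<notin> p}"

definition max_ideal :: "'k::field set \<Rightarrow> 'k set" where
  "max_ideal R = {r \<in> R. \<not> (\<exists>s\<in>R. r * s = 1)}"

definition ring_hom_on :: "'k::field set \<Rightarrow> ('k \<Rightarrow> 'l::field) \<Rightarrow> bool" where
  "ring_hom_on A h \<longleftrightarrow>
     h 1 = 1 \<and> (\<forall>a\<in>A. \<forall>b\<in>A. h (a + b) = h a + h b \<and> h (a * b) = h a * h b)"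

section \<open>Integral separated schemes inside their function field\<close>

text \<open>
  An integral separated scheme with function field \<open>K\<close> is identified with the set of the local
  rings of its points, as subrings of \<open>K\<close> (a scheme in the sense of Chevalley). By
  separatedness distinct points have distinct local rings; gluing integral affine schemes along
  common open subschemes, when the result is separated, is the union of the sets of local rings.
  A point \<open>y\<close> is a specialization of \<open>\<eta>\<close> iff \<open>y \<subseteq> \<eta>\<close> as local rings, and the stalk of the
  structure sheaf at a point is the point itself.
\<close>

definition spec_rings :: "'k::field set \<Rightarrow> 'k set set" where
  "spec_rings A = {localize A p | p. is_prime_ideal A p}"

definition affine_open :: "'k::field set set \<Rightarrow> 'k set \<Rightarrow> bool" where
  "affine_open X A \<longleftrightarrow>
     (\<exists>S. finite S \<and> A = is_subring hull S) \<and> spec_rings A \<subseteq> X"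

text \<open>
  Projectivity over the integers: \<open>X\<close> is isomorphic to an integral closed subscheme of
  projective \<open>N\<close>-space. The \<open>f j\<close> are the restrictions of the homogeneous coordinates, read in the
  function field after dividing by a common nonzero one; the charts of the closed subscheme
  are the spectra of the rings \<open>\<int>[f 0 / f i, \<dots>, f N / f i]\<close>.
\<close>

definition projective_over_Z :: "'k::field set set \<Rightarrow> bool" where
  "projective_over_Z X \<longleftrightarrow>
     (\<exists>N. \<exists>f :: nat \<Rightarrow> 'k. (\<exists>i\<le>N. f i \<noteq> 0) \<and>
        X = (\<Union>i\<in>{i. i \<le> N \<and> f i \<noteq> 0}. spec_rings (is_subring hull ((\<lambda>j. f j / f i) ` {..N}))))"

type_synonym intpoly = "(nat \<Rightarrow>\<^sub>0 nat) \<Rightarrow>\<^sub>0 int"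

definition peval :: "intpoly \<Rightarrow> (nat \<Rightarrow> 'k::field) \<Rightarrow> 'k" where
  "peval F t = (\<Sum>a\<in>Poly_Mapping.keys F. of_int (Poly_Mapping.lookup F a) *
     (\<Prod>j\<in>Poly_Mapping.keys a. t j ^ Poly_Mapping.lookup a j))"

definition pdiff :: "nat \<Rightarrow> intpoly \<Rightarrow> intpoly" where
  "pdiff i F = (\<Sum>a\<in>Poly_Mapping.keys F.
     Poly_Mapping.single (a - Poly_Mapping.single i 1) (int (Poly_Mapping.lookup a i) * Poly_Mapping.lookup F a))"

text \<open>
  Jacobian criterion: near each point, \<open>X\<close> is the spectrum of
  \<open>\<int>[T\<^sub>0, \<dots>, T\<^bsub>c+d-1\<^esub>] / (F\<^sub>0, \<dots>, F\<^bsub>c-1\<^esub>)\<close> with a \<open>c \<times> c\<close> Jacobian minor invertible at the point.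
  That the \<open>F i\<close> generate all relations locally at the point need not be required: the
  quotient by them is, locally there, a domain flat of relative dimension \<open>d\<close> over the integers
  which surjects onto the local ring, and the function field of \<open>X\<close> has transcendence degree
  \<open>d\<close> too. So \<open>d\<close> must be the relative dimension of \<open>X\<close>, as in the uses below.
\<close>

definition smooth_over_Z :: "nat \<Rightarrow> 'k::field set set \<Rightarrow> bool" where
  "smooth_over_Z d X \<longleftrightarrow>
     (\<forall>R\<in>X. \<exists>c. \<exists>t :: nat \<Rightarrow> 'k. \<exists>F :: nat \<Rightarrow> intpoly.
        (let B = is_subring hull (t ` {..<c + d}) in B \<subseteq> R \<and> R = localize B (max_ideal R \<inter> B)) \<and>
        (\<forall>i<c. (\<forall>a\<in>Poly_Mapping.keys (F i). Poly_Mapping.keys a \<subseteq> {..<c + d}) \<and> peval (F i) t = 0) \<and>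
        (\<Sum>\<pi> | \<pi> permutes {..<c}. of_int (sign \<pi>) * (\<Prod>i<c. peval (pdiff (\<pi> i) (F i)) t))
          \<in> R - max_ideal R)"

text \<open>
  A point with values in a field is a point \<open>R\<close> of \<open>X\<close> together with a homomorphism
  from the residue field of \<open>R\<close>; the latter is given on \<open>R\<close> and extended by 0.
\<close>

type_synonym 'k cpoint = "'k set \<times> ('k \<Rightarrow> complex)"

definition points_over :: "'k::field set set \<Rightarrow> complex set \<Rightarrow> 'k cpoint set" where
  "points_over X L = {(R, ev). R \<in> X \<and> ring_hom_on R ev \<and> ev ` R \<subseteq> L \<and>
      (\<forall>r\<in>R. ev r = 0 \<longleftrightarrow> r \<in> max_ideal R) \<and> (\<forall>r. r \<notin> R \<longrightarrow> ev r = 0)}"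

section \<open>Cartier divisors and hermitian metrics\<close>

text \<open>
  A Cartier divisor \<open>D\<close> is given by a local equation \<open>D R\<close> at each point \<open>R\<close> (well defined up to
  units of \<open>R\<close>). Sections of \<open>\<O>(D)\<close> are rational functions \<open>f\<close> with \<open>f * D R\<close> regular;
  \<open>1 / D R\<close> generates the stalk. The divisor \<open>l D\<close> has local equations \<open>(D R) ^ l\<close>.
\<close>

type_synonym 'k divisor = "'k set \<Rightarrow> 'k"

definition sections :: "'k::field set set \<Rightarrow> 'k divisor \<Rightarrow> 'k set" where
  "sections X D = {f. \<forall>R\<in>X. f * D R \<in> R}"

definition globally_generated :: "'k::field set set \<Rightarrow> 'k divisor \<Rightarrow> bool" where
  "globally_generated X D \<longleftrightarrow> (\<forall>R\<in>X. \<exists>s\<in>sections X D. s * D R \<in> R - max_ideal R)"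

text \<open>
  A metric on \<open>\<O>(D)\<close> is given by the norm \<open>\<mu> x\<close> at each complex point \<open>x = (R, ev)\<close> of the
  generator \<open>1 / D R\<close>.
\<close>

type_synonym 'k hdivisor = "'k divisor \<times> ('k cpoint \<Rightarrow> real)"

definition hnorm :: "'k::field hdivisor \<Rightarrow> 'k cpoint \<Rightarrow> 'k \<Rightarrow> real" where
  "hnorm L x s = cmod (snd x (s * fst L (fst x))) * snd L x"

definition tensor_power :: "nat \<Rightarrow> 'k::field hdivisor \<Rightarrow> 'k hdivisor" where
  "tensor_power l L = ((\<lambda>R. fst L R ^ l), (\<lambda>x. snd L x ^ l))"

definition sup_norm :: "'k::field set set \<Rightarrow> 'k hdivisor \<Rightarrow> 'k \<Rightarrow> ereal" where
  "sup_norm X L s = (SUP x\<in>points_over X UNIV. ereal (hnorm L x s))"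

definition small_sections :: "'k::field set set \<Rightarrow> 'k hdivisor \<Rightarrow> 'k set" where
  "small_sections X L = {s \<in> sections X (fst L). sup_norm X L s \<le> 1}"

section \<open>Relative nefness\<close>

text \<open>
  Dimension over a prime field \<open>k\<close> of a quotient \<open>V/W\<close>: the largest size of a family independent
  modulo \<open>W\<close>. Integer coefficients suffice; \<open>Z\<close> is the set of elements whose integers are those
  vanishing in \<open>k\<close>.
\<close>

definition prime_dim :: "'k::field set \<Rightarrow> 'k set \<Rightarrow> 'k set \<Rightarrow> nat" where
  "prime_dim V W Z = Sup {n. \<exists>v :: nat \<Rightarrow> 'k. (\<forall>i<n. v i \<in> V) \<and>
      (\<forall>c :: nat \<Rightarrow> int. (\<Sum>i<n. of_int (c i) * v i) \<in> W \<longrightarrow> (\<forall>i<n. of_int (c i) \<in> Z))}"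

definition residue_degree :: "'k::field set \<Rightarrow> nat" where
  "residue_degree R = prime_dim R (max_ideal R) (max_ideal R)"

definition quotient_length :: "'k::field set \<Rightarrow> 'k set \<Rightarrow> nat" where
  "quotient_length R I = Sup {n. \<exists>J :: nat \<Rightarrow> 'k set.
      (\<forall>i\<le>n. is_ideal R (J i) \<and> I \<subseteq> J i) \<and> (\<forall>i<n. J i \<subset> J (Suc i))}"

text \<open>The closure of the point \<open>\<eta>\<close> inside its fibre over the spectrum of the integers.\<close>

definition fibre_closure :: "'k::field set set \<Rightarrow> 'k set \<Rightarrow> 'k set set" where
  "fibre_closure X \<eta> = {y \<in> X. y \<subseteq> \<eta> \<and>
      (\<forall>n :: int. of_int n \<in> max_ideal y \<longleftrightarrow> of_int n \<in> max_ideal \<eta>)}"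

text \<open>\<open>\<eta>\<close> is the generic point of an integral curve in a fibre; all the other points are closed.\<close>

definition curve_in_fibre :: "'k::field set set \<Rightarrow> 'k set \<Rightarrow> bool" where
  "curve_in_fibre X \<eta> \<longleftrightarrow> \<eta> \<in> X \<and> fibre_closure X \<eta> \<noteq> {\<eta>} \<and>
     (\<forall>y\<in>fibre_closure X \<eta> - {\<eta>}. fibre_closure X y = {y})"

text \<open>
  The local ring of the curve \<open>C\<close> with generic point \<open>\<eta>\<close> at \<open>y\<close> is \<open>y / (y \<inter> max_ideal \<eta>)\<close>. The next
  number is the length of its quotient by the class of \<open>a\<close>.
\<close>

definition curve_length :: "'k::field set \<Rightarrow> 'k set \<Rightarrow> 'k \<Rightarrow> nat" where
  "curve_length \<eta> y a = quotient_length y {r * a + s | r s. r \<in> y \<and> s \<in> y \<inter> max_ideal \<eta>}"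

text \<open>
  \<open>n\<close> is the degree of the restriction of \<open>\<O>(D)\<close> to \<open>C\<close>, over the prime field: the degree of the
  divisor of a nonzero rational section of this restriction. The section is represented by a
  rational function \<open>t\<close> on \<open>X\<close>, and is \<open>t * D y = a y / b y\<close> in the trivialization at \<open>y\<close>; its order
  at \<open>y\<close> is the difference of two lengths. As \<open>C\<close> is proper when \<open>X\<close> is projective, the degree
  depends neither on \<open>t\<close> nor on the choice of the fractions.
\<close>

definition has_curve_degree :: "'k::field set set \<Rightarrow> 'k divisor \<Rightarrow> 'k set \<Rightarrow> int \<Rightarrow> bool" where
  "has_curve_degree X D \<eta> n \<longleftrightarrow>
     (let C = fibre_closure X \<eta> - {\<eta>} in
      \<exists>t a b. t * D \<eta> \<in> \<eta> - max_ideal \<eta> \<and>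
        (\<forall>y\<in>C. a y \<in> y - max_ideal \<eta> \<and> b y \<in> y - max_ideal \<eta> \<and> t * D y = a y / b y) \<and>
        (let e = (\<lambda>y. int (curve_length \<eta> y (a y)) - int (curve_length \<eta> y (b y)))
         in n = (\<Sum>y | y \<in> C \<and> e y \<noteq> 0. e y * int (residue_degree y))))"

definition relatively_nef :: "'k::field set set \<Rightarrow> 'k divisor \<Rightarrow> bool" where
  "relatively_nef X D \<longleftrightarrow>
     (\<forall>\<eta>. curve_in_fibre X \<eta> \<longrightarrow> (\<exists>n\<ge>0. has_curve_degree X D \<eta> n))"

section \<open>Heights\<close>

text \<open>Number fields are taken inside the complex numbers.\<close>

definition rat_scale :: "rat \<Rightarrow> complex \<Rightarrow> complex" where
  "rat_scale q z = of_rat q * z"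

definition number_field :: "complex set \<Rightarrow> bool" where
  "number_field K \<longleftrightarrow> is_subring K \<and> (\<forall>z\<in>K. inverse z \<in> K) \<and>
     (\<exists>B. finite B \<and> K = module.span rat_scale B)"

definition ring_of_integers :: "complex set \<Rightarrow> complex set" where
  "ring_of_integers K = {z \<in> K. algebraic_int z}"

definition embeddings :: "complex set \<Rightarrow> (complex \<Rightarrow> complex) set" where
  "embeddings K = {\<tau>. ring_hom_on K \<tau> \<and> (\<forall>z. z \<notin> K \<longrightarrow> \<tau> z = 0)}"

text \<open>
  \<open>R'\<close> is the image of the prime \<open>P\<close> of the ring of integers of \<open>K\<close> under the morphism
  \<open>\<epsilon>\<^sub>x\<close> extending the \<open>K\<close>-point \<open>x\<close>: the local ring of \<open>P\<close> dominates \<open>R'\<close> through \<open>x\<close>.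
  It exists and is unique if \<open>X\<close> is proper.
\<close>

definition is_reduction ::
    "'k::field set set \<Rightarrow> complex set \<Rightarrow> 'k cpoint \<Rightarrow> complex set \<Rightarrow> 'k set \<Rightarrow> bool" where
  "is_reduction X K x P R' \<longleftrightarrow>
     (let V = localize (ring_of_integers K) P in
      R' \<in> X \<and> R' \<subseteq> fst x \<and> snd x ` R' \<subseteq> V \<and>
      (\<forall>r\<in>R'. r \<in> max_ideal R' \<longleftrightarrow> snd x r \<in> max_ideal V))"

text \<open>
  The module \<open>\<epsilon>\<^sub>x\<^sup>*\<O>(D)\<close>, as a fractional ideal of \<open>K\<close>: the element \<open>a\<close> stands for
  \<open>a\<close> times the generator \<open>1 / D R\<close> at \<open>x = (R, ev)\<close>, and the generator at the
  reduction \<open>R'\<close> modulo \<open>P\<close> is \<open>1 / D R' = (D R / D R') * (1 / D R)\<close>.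
\<close>

definition pullback_module :: "'k::field set set \<Rightarrow> 'k divisor \<Rightarrow> complex set \<Rightarrow> 'k cpoint \<Rightarrow> complex set" where
  "pullback_module X D K x = {a \<in> K. \<forall>P R'.
      is_prime_ideal (ring_of_integers K) P \<and> is_reduction X K x P R' \<longrightarrow>
      a * snd x (D R' / D (fst x)) \<in> localize (ring_of_integers K) P}"

definition log_card :: "'a set \<Rightarrow> ereal" where
  "log_card S = (if finite S then ereal (ln (real (card S))) else \<infinity>)"

text \<open>
  The height of \<open>x\<close>, computed with the nonzero element \<open>a\<close> of \<open>\<epsilon>\<^sub>x\<^sup>*\<O>(D)\<close>. The norm of
  \<open>a\<close> at \<open>\<tau>\<close> is \<open>cmod (\<tau> a)\<close> times the norm of the generator at the complex point deduced from
  \<open>x\<close> by \<open>\<tau>\<close>.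
\<close>

definition height_via ::
    "'k::field set set \<Rightarrow> 'k hdivisor \<Rightarrow> complex set \<Rightarrow> 'k cpoint \<Rightarrow> complex \<Rightarrow> ereal" where
  "height_via X L K x a =
     ereal (1 / real (vector_space.dim rat_scale K)) *
     (log_card ((\<lambda>c. (+) c ` ((*) a ` ring_of_integers K)) ` pullback_module X (fst L) K x)
      - ereal (\<Sum>\<tau>\<in>embeddings K. ln (cmod (\<tau> a) * snd L (fst x, \<lambda>r. \<tau> (snd x r)))))"

definition heights_nonneg :: "'k::field set set \<Rightarrow> 'k hdivisor \<Rightarrow> bool" where
  "heights_nonneg X L \<longleftrightarrow>
     (\<forall>K x a. number_field K \<and> x \<in> points_over X K \<and>
        a \<in> pullback_module X (fst L) K x - {0} \<longrightarrow> 0 \<le> height_via X L K x a)"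

section \<open>Schemes with function field of rational functions on a torus\<close>

text \<open>
  The lattice \<open>P\<close> of characters is \<open>'n \<Rightarrow>\<^sub>0 int\<close>, of rank \<open>CARD('n)\<close>. The linear order on
  \<open>'n\<close> is there only because the library uses it to make the group ring an integral domain.
\<close>

type_synonym 'n ratfun = "(('n \<Rightarrow>\<^sub>0 int) \<Rightarrow>\<^sub>0 int) fract"

definition character :: "('n::{finite,linorder} \<Rightarrow>\<^sub>0 int) \<Rightarrow> 'n::{finite,linorder} ratfun" where
  "character m = Fract (Poly_Mapping.single m 1) 1"

subsection \<open>Semi-positivity of the Chern current\<close>

fun Ck :: "nat \<Rightarrow> ('a::real_normed_vector \<Rightarrow> real) \<Rightarrow> bool" where
  "Ck 0 f \<longleftrightarrow> continuous_on UNIV f"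
| "Ck (Suc k) f \<longleftrightarrow> (\<forall>x. f differentiable (at x)) \<and> (\<forall>v. Ck k (\<lambda>x. frechet_derivative f (at x) v))"

definition test_function :: "(complex^'n) set \<Rightarrow> (complex^'n \<Rightarrow> real) \<Rightarrow> bool" where
  "test_function V h \<longleftrightarrow> (\<forall>k. Ck k h) \<and> (\<forall>z. 0 \<le> h z) \<and>
     (\<exists>S. compact S \<and> S \<subseteq> V \<and> (\<forall>z. z \<notin> S \<longrightarrow> h z = 0))"

definition dir_deriv :: "complex^'n \<Rightarrow> (complex^'n \<Rightarrow> real) \<Rightarrow> complex^'n \<Rightarrow> real" where
  "dir_deriv v h z = frechet_derivative h (at z) v"

text \<open>
  Four times the Levi form \<open>\<Sum> (\<partial>\<^sup>2h / \<partial>z\<^sub>j \<partial>cnj z\<^sub>k) \<xi>\<^sub>j cnj \<xi>\<^sub>k\<close>, i.e. the Laplacian at 0 of \<open>w \<mapsto> h (z + w \<xi>)\<close>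
  for complex \<open>w\<close>.
\<close>

definition levi :: "complex^'n \<Rightarrow> (complex^'n \<Rightarrow> real) \<Rightarrow> complex^'n \<Rightarrow> real" where
  "levi \<xi> h z = dir_deriv \<xi> (dir_deriv \<xi> h) z + dir_deriv (\<i> *s \<xi>) (dir_deriv (\<i> *s \<xi>) h) z"

text \<open>
  The current \<open>dd\<^sup>cu\<close> is (semi-)positive on \<open>V\<close> iff its products with the forms
  \<open>h i\<alpha>\<^sub>2 \<and> cnj \<alpha>\<^sub>2 \<and> \<dots> \<and> i\<alpha>\<^sub>d \<and> cnj \<alpha>\<^sub>d\<close> have nonnegative integral, for constant forms
  \<open>\<alpha>\<^sub>j\<close> of type (1,0) and \<open>h \<ge> 0\<close> a test function. If \<open>\<xi>\<close> spans the common kernel of the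
  \<open>\<alpha>\<^sub>j\<close>, this is, up to a positive factor, the integral below.
\<close>

definition ddc_semipositive :: "(complex^'n) set \<Rightarrow> (complex^'n \<Rightarrow> real) \<Rightarrow> bool" where
  "ddc_semipositive V u \<longleftrightarrow>
     (\<forall>\<xi> h. test_function V h \<longrightarrow> 0 \<le> (\<integral>z. u z * levi \<xi> h z \<partial>lborel))"

definition holomorphic_fun_on :: "(complex^'n) set \<Rightarrow> (complex^'n \<Rightarrow> complex) \<Rightarrow> bool" where
  "holomorphic_fun_on V f \<longleftrightarrow>
     (\<forall>z\<in>V. \<exists>c :: complex^'n. (f has_derivative (\<lambda>v. \<Sum>i\<in>UNIV. c $ i * v $ i)) (at z))"

text \<open>
  A holomorphic chart of \<open>X(\<complex>)\<close>, with image in an affine open subset. When \<open>X(\<complex>)\<close> is a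
  complex manifold of dimension \<open>CARD('n)\<close>, an injective holomorphic map from an open
  subset of \<open>complex^'n\<close> is a biholomorphism onto an open subset.
\<close>

definition holomorphic_chart ::
    "'n::{finite,linorder} ratfun set set \<Rightarrow> (complex^'n::{finite,linorder}) set \<Rightarrow> (complex^'n::{finite,linorder} \<Rightarrow> 'n::{finite,linorder} ratfun cpoint) \<Rightarrow> bool" where
  "holomorphic_chart X V g \<longleftrightarrow> open V \<and> inj_on g V \<and> g ` V \<subseteq> points_over X UNIV \<and>
     (\<exists>A. affine_open X A \<and> (\<forall>z\<in>V. fst (g z) \<in> spec_rings A) \<and>
          (\<forall>f\<in>A. holomorphic_fun_on V (\<lambda>z. snd (g z) f)))"

text \<open>
  The Chern current is \<open>dd\<^sup>c(- log \<parallel>e\<parallel>\<^sup>2)\<close> where \<open>e\<close> is a local frame: a rational section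
  which generates the stalks at the points of the chart.
\<close>

definition chern_semipositive :: "'n::{finite,linorder} ratfun set set \<Rightarrow> 'n::{finite,linorder} ratfun hdivisor \<Rightarrow> bool" where
  "chern_semipositive X L \<longleftrightarrow>
     (\<forall>V g e. holomorphic_chart X V g \<and>
        (\<forall>z\<in>V. e * fst L (fst (g z)) \<in> fst (g z) - max_ideal (fst (g z))) \<longrightarrow>
        ddc_semipositive V (\<lambda>z. - ln ((hnorm L (g z) e)\<^sup>2)))"

subsection \<open>Nef and big\<close>

definition nef :: "'n::{finite,linorder} ratfun set set \<Rightarrow> 'n::{finite,linorder} ratfun hdivisor \<Rightarrow> bool" where
  "nef X L \<longleftrightarrow> relatively_nef X (fst L) \<and> chern_semipositive X L \<and> heights_nonneg X L"

definition generic_fibre :: "'k::field set set \<Rightarrow> 'k set set" where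
  "generic_fibre X = {R \<in> X. \<forall>n :: int. n \<noteq> 0 \<longrightarrow> of_int n \<notin> max_ideal R}"

text \<open>
  Bigness on the generic fibre, of dimension \<open>CARD('n)\<close>: the dimension over the rationals of the
  space of sections of the \<open>k\<close>-th power grows like the \<open>CARD('n)\<close>-th power of \<open>k\<close>.
\<close>

definition generically_big :: "'n::{finite,linorder} ratfun set set \<Rightarrow> 'n::{finite,linorder} ratfun divisor \<Rightarrow> bool" where
  "generically_big X D \<longleftrightarrow>
     limsup (\<lambda>k. ereal (real (prime_dim (sections (generic_fibre X) (\<lambda>R. D R ^ k)) {0} {0})
                       / real k ^ CARD('n))) > 0"

definition big :: "'n::{finite,linorder} ratfun set set \<Rightarrow> 'n::{finite,linorder} ratfun hdivisor \<Rightarrow> bool" where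
  "big X L \<longleftrightarrow> generically_big X (fst L) \<and>
     (\<exists>l\<ge>1. \<exists>s\<in>sections X (fst (tensor_power l L)). s \<noteq> 0 \<and>
        (\<forall>x\<in>points_over X UNIV. hnorm (tensor_power l L) x s < 1))"

section \<open>Toric schemes\<close>

text \<open>
  Both \<open>P\<^sub>\<real>\<close> and \<open>Q\<^sub>\<real>\<close> are \<open>real^'n\<close>, with the inner product as duality pairing; \<open>Q\<close> consists of
  the vectors with integral coordinates.
\<close>

definition lattice_vec :: "('n::finite \<Rightarrow>\<^sub>0 int) \<Rightarrow> real^'n" where
  "lattice_vec m = (\<chi> i. of_int (Poly_Mapping.lookup m i))"

definition rational_cone :: "(real^'n) set \<Rightarrow> bool" where
  "rational_cone \<sigma> \<longleftrightarrow>
     (\<exists>S. finite S \<and> (\<forall>v\<in>S. \<forall>i. v $ i \<in> \<int>) \<and> \<sigma> = convex_cone hull S)"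

definition fan :: "(real^'n) set set \<Rightarrow> bool" where
  "fan \<Sigma> \<longleftrightarrow> finite \<Sigma> \<and> \<Sigma> \<noteq> {} \<and>
     (\<forall>\<sigma>\<in>\<Sigma>. rational_cone \<sigma> \<and> \<sigma> \<inter> uminus ` \<sigma> = {0}) \<and>
     (\<forall>\<sigma>\<in>\<Sigma>. \<forall>\<tau>. \<tau> face_of \<sigma> \<and> \<tau> \<noteq> {} \<longrightarrow> \<tau> \<in> \<Sigma>) \<and>
     (\<forall>\<sigma>\<in>\<Sigma>. \<forall>\<tau>\<in>\<Sigma>. \<sigma> \<inter> \<tau> face_of \<sigma> \<and> \<sigma> \<inter> \<tau> face_of \<tau>)"

definition dual_cone :: "(real^'n) set \<Rightarrow> (real^'n) set" where
  "dual_cone \<sigma> = {x. \<forall>u\<in>\<sigma>. 0 \<le> x \<bullet> u}"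

text \<open>The ring \<open>\<int>[P \<inter> \<sigma>\<^sup>*]\<close>.\<close>

definition cone_ring :: "(real^'n::{finite,linorder}) set \<Rightarrow> 'n::{finite,linorder} ratfun set" where
  "cone_ring \<sigma> = {Fract p 1 | p. \<forall>m\<in>Poly_Mapping.keys p. lattice_vec m \<in> dual_cone \<sigma>}"

definition toric_scheme :: "(real^'n::{finite,linorder}) set set \<Rightarrow> 'n::{finite,linorder} ratfun set set" where
  "toric_scheme \<Sigma> = (\<Union>\<sigma>\<in>\<Sigma>. spec_rings (cone_ring \<sigma>))"

text \<open>Equivariant Cartier divisors are given by their functions \<open>\<psi>\<^sub>D\<close>.\<close>

definition support_function :: "(real^'n::finite) set set \<Rightarrow> (real^'n \<Rightarrow> real) \<Rightarrow> bool" where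
  "support_function \<Sigma> \<psi> \<longleftrightarrow> continuous_on UNIV \<psi> \<and>
     (\<forall>\<sigma>\<in>\<Sigma>. \<exists>m. \<forall>u\<in>\<sigma>. \<psi> u = lattice_vec m \<bullet> u)"

text \<open>Different admissible choices of \<open>m\<close> at \<open>R\<close> change the local equation by a unit of \<open>R\<close>.\<close>

definition toric_divisor ::
    "(real^'n::{finite,linorder}) set set \<Rightarrow> (real^'n::{finite,linorder} \<Rightarrow> real) \<Rightarrow> 'n::{finite,linorder} ratfun divisor" where
  "toric_divisor \<Sigma> \<psi> R = character (- (SOME m. \<exists>\<sigma>\<in>\<Sigma>.
      R \<in> spec_rings (cone_ring \<sigma>) \<and> (\<forall>u\<in>\<sigma>. \<psi> u = lattice_vec m \<bullet> u)))"

definition polytope_of :: "(real^'n \<Rightarrow> real) \<Rightarrow> (real^'n) set" where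
  "polytope_of \<psi> = {x. \<forall>u. \<psi> u \<le> x \<bullet> u}"

text \<open>
  The metric on \<open>\<O>(1)\<close> gives the linear form \<open>s\<close> norm \<open>\<bar>s(x)\<bar> / sup \<bar>x\<^sub>i\<bar>\<close>. In the trivialization of
  \<open>\<O>(D)\<close> by \<open>1 / D R\<close> the homogeneous coordinates of \<open>\<phi>\<^sub>D(x)\<close> are the values at \<open>x\<close> of
  \<open>\<chi>\<^sup>m * D R\<close>, so the pulled back metric gives \<open>1 / D R\<close> the following norm.
\<close>

definition canonical_metrized_divisor ::
    "(real^'n::{finite,linorder}) set set \<Rightarrow> (real^'n::{finite,linorder} \<Rightarrow> real) \<Rightarrow> 'n::{finite,linorder} ratfun hdivisor" where
  "canonical_metrized_divisor \<Sigma> \<psi> = (toric_divisor \<Sigma> \<psi>,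
     \<lambda>x. 1 / (SUP m\<in>{m. lattice_vec m \<in> polytope_of \<psi>}.
                cmod (snd x (character m * toric_divisor \<Sigma> \<psi> (fst x)))))"

end

theory Submission
  imports Defs "HOL-Complex_Analysis.Cauchy_Integral_Formula"
    "HOL-Computational_Algebra.Fundamental_Theorem_Algebra"
begin

text \<open>
  Projectivity makes the fan complete, since every monomial valuation has a centre on \<open>X\<close>; hence the
  sections of \<open>\<O>(l D)\<close> are the integral combinations of the \<open>\<chi>\<^sup>m\<close> with \<open>m \<in> l \<Delta>\<close>. On the compact torus
  the canonical norm of a section is its absolute value, and the mean of \<open>\<bar>\<Sum> a\<^sub>m \<chi>\<^sup>m\<bar>\<^sup>2\<close> is \<open>\<Sum> a\<^sub>m\<^sup>2\<close>.
  So a section of norm at most 1 is \<open>0\<close> or \<open>\<plusminus>\<chi>\<^sup>m\<close>, and no nonzero section has norm less than 1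
  everywhere. Conversely \<open>\<parallel>\<chi>\<^sup>m\<parallel> \<le> 1\<close>: by global generation \<open>\<Delta>\<close> is the convex hull of its lattice points,
  so a power of \<open>\<chi>\<^sup>m\<close> is a product of the characters that define the metric.

  For nefness, given a point, some \<open>\<chi>\<^sup>l\<^sup>m\<close> with \<open>m \<in> \<Delta>\<close> is a section that does not vanish there. It gives
  degrees of curves as sums of lengths, and heights as sums of nonnegative terms. That the height does
  not depend on the section used is the product formula; only one inequality is needed, and it follows
  from the fact that the norm of a nonzero algebraic integer is at least 1. The local potentials of the
  Chern current are maxima of logarithms of moduli of holomorphic functions.
\<close>

section \<open>Subrings, prime ideals and localizations\<close>

text \<open>A point is a local ring inside the function field. One local ring can belong to several
  charts, and the local equation of \<open>D\<close> at it is picked by choice. Passing between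
  charts, or from a point to a specialization, therefore rests on
  \<open>character_in_local_ring\<close>: separatedness in monomial form, which makes transition
  characters units.

  For heights, the section gives only a submodule \<open>c\<close> times the ring of integers in the
  pulled-back module, of unknown index. No factorization of ideals is used: with
  \<open>b = c / a\<close>, a bound on the product of the conjugates of \<open>b\<close> by the
  index is obtained by iteration. Constants disappear when exponential growth rates are compared, so
  crude size estimates are enough. The arithmetic input is that a product of conjugates is rational,
  by resultants, and integral, by stable modules.

  The potentials of the Chern current are merely continuous. Second differences of the test function
  are moved onto the potential by translating the integrals, and an error of order
  \<open>r ^ 3\<close> is harmless after division by \<open>r ^ 2\<close>.\<close>

lemma subring_one: "is_subring A \<Longrightarrow> 1 \<in> A"
  and subring_diff: "is_subring A \<Longrightarrow> a \<in> A \<Longrightarrow> b \<in> A \<Longrightarrow> a - b \<in> A"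
  and subring_mult: "is_subring A \<Longrightarrow> a \<in> A \<Longrightarrow> b \<in> A \<Longrightarrow> a * b \<in> A"
  unfolding is_subring_def by blast+

lemma subring_zero: "is_subring A \<Longrightarrow> 0 \<in> A"
  using subring_diff[of A 1 1] subring_one[of A] by simp

lemma subring_uminus: "is_subring A \<Longrightarrow> a \<in> A \<Longrightarrow> - a \<in> A"
  using subring_diff[of A 0 a] subring_zero[of A] by simp

lemma subring_add: "is_subring A \<Longrightarrow> a \<in> A \<Longrightarrow> b \<in> A \<Longrightarrow> a + b \<in> A"
  using subring_diff[of A a "- b"] subring_uminus[of A b] by simp

lemma subring_power: "is_subring A \<Longrightarrow> a \<in> A \<Longrightarrow> a ^ n \<in> A"
  by (induction n) (auto intro: subring_one subring_mult)

lemma subring_sum: "is_subring A \<Longrightarrow> (\<And>i. i \<in> I \<Longrightarrow> f i \<in> A) \<Longrightarrow> sum f I \<in> A"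
  by (induction I rule: infinite_finite_induct) (auto intro: subring_zero subring_add)

lemma subring_prod: "is_subring A \<Longrightarrow> (\<And>i. i \<in> I \<Longrightarrow> f i \<in> A) \<Longrightarrow> prod f I \<in> A"
  by (induction I rule: infinite_finite_induct) (auto intro: subring_one subring_mult)

lemma subring_of_nat: "is_subring A \<Longrightarrow> of_nat n \<in> A"
  by (induction n) (auto intro: subring_zero subring_one subring_add)

lemma subring_of_int: "is_subring A \<Longrightarrow> of_int n \<in> A"
  by (cases n) (auto intro: subring_of_nat subring_uminus simp del: of_nat_Suc)

lemma is_subring_hull: "is_subring (is_subring hull S)"
  unfolding hull_def is_subring_def by blast

lemma ideal_add: "is_ideal A J \<Longrightarrow> a \<in> J \<Longrightarrow> b \<in> J \<Longrightarrow> a + b \<in> J"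
  and ideal_mult: "is_ideal A J \<Longrightarrow> r \<in> A \<Longrightarrow> a \<in> J \<Longrightarrow> r * a \<in> J"
  and ideal_zero: "is_ideal A J \<Longrightarrow> 0 \<in> J"
  and ideal_subset: "is_ideal A J \<Longrightarrow> J \<subseteq> A"
  unfolding is_ideal_def by blast+

lemma ideal_sum: "is_ideal A J \<Longrightarrow> (\<And>i. i \<in> I \<Longrightarrow> f i \<in> J) \<Longrightarrow> sum f I \<in> J"
  by (induction I rule: infinite_finite_induct) (auto intro: ideal_zero ideal_add)

lemma prime_ideal_is_ideal: "is_prime_ideal A p \<Longrightarrow> is_ideal A p"
  and prime_ideal_one: "is_prime_ideal A p \<Longrightarrow> 1 \<notin> p"
  and prime_ideal_mult: "is_prime_ideal A p \<Longrightarrow> a \<in> A \<Longrightarrow> b \<in> A \<Longrightarrow> a \<notin> p \<Longrightarrow> b \<notin> p \<Longrightarrow> a * b \<notin> p"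
  and prime_ideal_zero: "is_prime_ideal A p \<Longrightarrow> 0 \<in> p"
  unfolding is_prime_ideal_def is_ideal_def by blast+

lemma localizeI: "a \<in> A \<Longrightarrow> b \<in> A \<Longrightarrow> b \<notin> p \<Longrightarrow> a / b \<in> localize A p"
  unfolding localize_def by blast

lemma localizeE:
  assumes "r \<in> localize A p"
  obtains a b where "r = a / b" "a \<in> A" "b \<in> A" "b \<notin> p"
  using assms unfolding localize_def by blast

lemma subset_localize:
  assumes "is_subring A" "is_prime_ideal A p"
  shows "A \<subseteq> localize A p"
proof
  fix a assume "a \<in> A"
  from localizeI[OF this subring_one[OF assms(1)] prime_ideal_one[OF assms(2)]]
  show "a \<in> localize A p" by simp
qed

lemma is_subring_localize:
  assumes A: "is_subring A" and p: "is_prime_ideal A p"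
  shows "is_subring (localize A p)"
  unfolding is_subring_def
proof (intro conjI ballI)
  show "1 \<in> localize A p"
    using subset_localize[OF A p] subring_one[OF A] by blast
next
  fix x y assume "x \<in> localize A p" "y \<in> localize A p"
  then obtain a b c d where xy: "x = a / b" "y = c / d" "a \<in> A" "b \<in> A" "c \<in> A" "d \<in> A"
    and np: "b \<notin> p" "d \<notin> p" by (metis localizeE)
  have nz: "b \<noteq> 0" "d \<noteq> 0" using np prime_ideal_zero[OF p] by auto
  have bd: "b * d \<in> A" "b * d \<notin> p"
    using A p xy np subring_mult prime_ideal_mult by blast+
  have "x - y = (a * d - c * b) / (b * d)" using nz xy by (simp add: field_simps)
  then show "x - y \<in> localize A p"
    using localizeI[OF _ bd] subring_diff[OF A] subring_mult[OF A] xy by simp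
  have "x * y = (a * c) / (b * d)" using xy by simp
  then show "x * y \<in> localize A p"
    using localizeI[OF _ bd] subring_mult[OF A] xy by simp
qed

lemma max_idealD: "r \<in> max_ideal R \<Longrightarrow> r \<in> R \<and> \<not> (\<exists>s\<in>R. r * s = 1)"
  unfolding max_ideal_def by blast

lemma unit_iff: "r \<in> R - max_ideal R \<longleftrightarrow> r \<in> R \<and> (\<exists>s\<in>R. r * s = 1)"
  unfolding max_ideal_def by blast

lemma unit_inverse:
  fixes R :: "'k::field set"
  shows "r \<in> R - max_ideal R \<longleftrightarrow> r \<noteq> 0 \<and> r \<in> R \<and> inverse r \<in> R"
  unfolding unit_iff
  by (metis inverse_unique mult_zero_left right_inverse zero_neq_one)

lemma unit_nonzero: "r \<in> R - max_ideal R \<Longrightarrow> r \<noteq> (0::'k::field)"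
  using unit_inverse by blast

lemma unit_mult:
  fixes R :: "'k::field set"
  assumes "is_subring R" "r \<in> R - max_ideal R" "s \<in> R - max_ideal R"
  shows "r * s \<in> R - max_ideal R"
  using assms subring_mult unfolding unit_inverse by (simp add: subring_mult mult.commute)

lemma unit_power:
  fixes R :: "'k::field set"
  assumes "is_subring R" "r \<in> R - max_ideal R"
  shows "r ^ n \<in> R - max_ideal R"
  using assms unfolding unit_inverse by (metis power_inverse power_not_zero subring_power)

lemma localize_unit_iff:
  assumes A: "is_subring A" and p: "is_prime_ideal A p" and a: "a \<in> A"
  shows "a \<in> max_ideal (localize A p) \<longleftrightarrow> a \<in> p"
proof
  assume "a \<in> max_ideal (localize A p)"
  show "a \<in> p"
  proof (rule ccontr)
    assume na: "a \<notin> p"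
    then have "a \<noteq> 0" using prime_ideal_zero[OF p] by auto
    then have "a * (1 / a) = 1" by simp
    moreover have "1 / a \<in> localize A p"
      using localizeI[OF subring_one[OF A] a na] .
    ultimately show False using \<open>a \<in> max_ideal _\<close> max_idealD by blast
  qed
next
  assume ap: "a \<in> p"
  have "\<not> (\<exists>s\<in>localize A p. a * s = 1)"
  proof
    assume "\<exists>s\<in>localize A p. a * s = 1"
    then obtain c d where cd: "a * (c / d) = 1" "c \<in> A" "d \<in> A" "d \<notin> p" by (metis localizeE)
    moreover have "d \<noteq> 0" using cd prime_ideal_zero[OF p] by auto
    ultimately have "d = c * a" by (simp add: field_simps)
    moreover have "c * a \<in> p" using ideal_mult[OF prime_ideal_is_ideal[OF p]] cd ap by blast
    ultimately show False using cd by simp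
  qed
  then show "a \<in> max_ideal (localize A p)"
    using subset_localize[OF A p] a unfolding max_ideal_def by blast
qed

lemma max_ideal_localize:
  assumes A: "is_subring A" and p: "is_prime_ideal A p" and ab: "a \<in> A" "b \<in> A" "b \<notin> p"
  shows "a / b \<in> max_ideal (localize A p) \<longleftrightarrow> a \<in> p"
proof -
  let ?R = "localize A p"
  have R: "is_subring ?R" by (rule is_subring_localize[OF A p])
  have b: "b \<in> ?R - max_ideal ?R"
    using localize_unit_iff[OF A p ab(2)] ab subset_localize[OF A p] by blast
  have bnz: "b \<noteq> 0" and ib: "inverse b \<in> ?R" using b unit_inverse by blast+
  have ib': "inverse b \<in> ?R - max_ideal ?R" using b bnz unfolding unit_inverse by simp
  have aR: "a \<in> ?R" using ab subset_localize[OF A p] by blast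
  have abR: "a / b \<in> ?R" using localizeI ab by blast
  have "a / b \<in> ?R - max_ideal ?R \<longleftrightarrow> a \<in> ?R - max_ideal ?R"
  proof
    assume "a / b \<in> ?R - max_ideal ?R"
    from unit_mult[OF R this b] bnz show "a \<in> ?R - max_ideal ?R" by simp
  next
    assume "a \<in> ?R - max_ideal ?R"
    from unit_mult[OF R this ib'] show "a / b \<in> ?R - max_ideal ?R" by (simp add: divide_inverse)
  qed
  then show ?thesis using aR abR localize_unit_iff[OF A p ab(1)] by blast
qed

text \<open>Zorn's lemma gives an ideal maximal among those that contain \<open>I\<close> and avoid
  1. For \<open>x\<close> outside it, the ideal generated by it and \<open>x\<close> contains 1;
  multiplying two such expressions of 1 shows that it is prime.\<close>

lemma exists_prime_ideal:
  assumes A: "is_subring A" and I: "is_ideal A I" "1 \<notin> I"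
  obtains p where "is_prime_ideal A p" "I \<subseteq> p"
proof -
  let ?F = "{J. is_ideal A J \<and> 1 \<notin> J \<and> I \<subseteq> J}"
  have "\<exists>M\<in>?F. \<forall>X\<in>?F. M \<subseteq> X \<longrightarrow> X = M"
  proof (rule subset_Zorn_nonempty)
    show "?F \<noteq> {}" using I by blast
    fix C assume C: "C \<noteq> {}" "subset.chain ?F C"
    have mem: "\<And>J. J \<in> C \<Longrightarrow> is_ideal A J \<and> 1 \<notin> J \<and> I \<subseteq> J"
      and ch: "\<And>J K. J \<in> C \<Longrightarrow> K \<in> C \<Longrightarrow> J \<subseteq> K \<or> K \<subseteq> J"
      using C unfolding subset.chain_def by blast+
    have "is_ideal A (\<Union>C)"
      unfolding is_ideal_def
    proof (intro conjI ballI)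
      show "\<Union>C \<subseteq> A" using mem ideal_subset by blast
      show "0 \<in> \<Union>C" using mem ideal_zero C by blast
      fix a b assume "a \<in> \<Union>C" "b \<in> \<Union>C"
      then obtain J K where "J \<in> C" "a \<in> J" "K \<in> C" "b \<in> K" by blast
      then show "a + b \<in> \<Union>C" using ch[of J K] mem ideal_add by blast
    next
      fix r a assume "r \<in> A" "a \<in> \<Union>C"
      then show "r * a \<in> \<Union>C" using mem ideal_mult by blast
    qed
    then show "\<Union>C \<in> ?F" using mem C by blast
  qed
  then obtain M where MF: "M \<in> ?F" and maxF: "\<forall>X\<in>?F. M \<subseteq> X \<longrightarrow> X = M" by (rule bexE)
  have M: "is_ideal A M" "1 \<notin> M" "I \<subseteq> M" using MF by simp_all
  have max: "X = M" if "is_ideal A X" "1 \<notin> X" "M \<subseteq> X" for X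
    using maxF that M(3) by (simp add: subset_trans)
  have "a \<in> M \<or> b \<in> M" if ab: "a \<in> A" "b \<in> A" "a * b \<in> M" for a b
  proof (rule ccontr)
    assume n: "\<not> (a \<in> M \<or> b \<in> M)"
    have key: "\<exists>r\<in>A. \<exists>m\<in>M. r * x + m = 1" if x: "x \<in> A" "x \<notin> M" for x
    proof -
      let ?X = "{r * x + m | r m. r \<in> A \<and> m \<in> M}"
      have XI: "is_ideal A ?X"
        unfolding is_ideal_def
      proof (intro conjI ballI)
        show "?X \<subseteq> A"
        proof
          fix y assume "y \<in> ?X"
          then obtain r m where "y = r * x + m" "r \<in> A" "m \<in> M" by blast
          then show "y \<in> A"
            using subring_add[OF A subring_mult[OF A, of r x], of m] ideal_subset[OF M(1)] x by blast
        qed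
        show "0 \<in> ?X" using subring_zero[OF A] ideal_zero[OF M(1)] by force
        fix u v assume "u \<in> ?X" "v \<in> ?X"
        then obtain r m s n where uv: "u = r * x + m" "v = s * x + n" "r \<in> A" "s \<in> A" "m \<in> M" "n \<in> M"
          by blast
        from uv have "u + v = (r + s) * x + (m + n)" by (simp add: algebra_simps)
        with subring_add[OF A uv(3,4)] ideal_add[OF M(1) uv(5,6)] show "u + v \<in> ?X" by blast
      next
        fix t u assume t: "t \<in> A" "u \<in> ?X"
        then obtain r m where u: "u = r * x + m" "r \<in> A" "m \<in> M" by blast
        from u have "t * u = (t * r) * x + t * m" by (simp add: algebra_simps)
        with subring_mult[OF A t(1) u(2)] ideal_mult[OF M(1) t(1) u(3)] show "t * u \<in> ?X" by blast
      qed
      have MX: "M \<subseteq> ?X" using subring_zero[OF A] by force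
      have xX: "x \<in> ?X" using subring_one[OF A] ideal_zero[OF M(1)] by force
      have "1 \<in> ?X"
      proof (rule ccontr)
        assume "1 \<notin> ?X"
        from max[OF XI this MX] xX have "x \<in> M" by (rule subst)
        then show False using x(2) by simp
      qed
      then show ?thesis by force
    qed
    obtain r m where r: "r \<in> A" "m \<in> M" "r * a + m = 1" using key n ab by blast
    obtain s k where s: "s \<in> A" "k \<in> M" "s * b + k = 1" using key n ab by blast
    have "1 = (r * a + m) * (s * b + k)" using r s by simp
    also have "\<dots> = (r * s) * (a * b) + ((r * a) * k + (s * b + k) * m)" by (simp add: algebra_simps)
    also have "\<dots> \<in> M"
    proof (intro ideal_add[OF M(1)])
      show "(r * s) * (a * b) \<in> M" using ideal_mult[OF M(1) _ ab(3)] subring_mult[OF A r(1) s(1)] .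
      show "(r * a) * k \<in> M" using ideal_mult[OF M(1) _ s(2)] subring_mult[OF A r(1) ab(1)] .
      show "(s * b + k) * m \<in> M" using r(2) s(3) by simp
    qed
    finally show False using M by blast
  qed
  then have "is_prime_ideal A M" using M unfolding is_prime_ideal_def by blast
  then show ?thesis using that M by blast
qed

text \<open>If \<open>f\<close> were outside \<open>A\<close>, its ideal of denominators would be
  proper and lie in a prime, at which \<open>f\<close> could not be regular. This is what turns
  regularity at all points of a chart into membership in its ring.\<close>

lemma Inter_localize:
  assumes A: "is_subring A" and f: "\<And>p. is_prime_ideal A p \<Longrightarrow> f \<in> localize A p"
  shows "f \<in> A"
proof (rule ccontr)
  assume nf: "f \<notin> A"
  let ?I = "{b \<in> A. b * f \<in> A}"
  have "is_ideal A ?I"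
    unfolding is_ideal_def
    using subring_zero[OF A] subring_add[OF A] subring_mult[OF A]
    by (auto simp: distrib_right mult.assoc)
  moreover have "1 \<notin> ?I" using nf by simp
  ultimately obtain p where p: "is_prime_ideal A p" "?I \<subseteq> p" using exists_prime_ideal[OF A] by blast
  obtain a b where ab: "f = a / b" "a \<in> A" "b \<in> A" "b \<notin> p" using f[OF p(1)] localizeE by blast
  have "b \<noteq> 0" using ab prime_ideal_zero[OF p(1)] by auto
  then have "b \<in> ?I" using ab by simp
  then show False using p ab by blast
qed

lemma ring_hom_onD:
  assumes "ring_hom_on A h"
  shows "h 1 = 1" "a \<in> A \<Longrightarrow> b \<in> A \<Longrightarrow> h (a + b) = h a + h b" "a \<in> A \<Longrightarrow> b \<in> A \<Longrightarrow> h (a * b) = h a * h b"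
  using assms unfolding ring_hom_on_def by blast+

lemma ring_hom_on_zero:
  fixes h :: "'k::field \<Rightarrow> 'l::field"
  assumes "ring_hom_on A h" "is_subring A" shows "h 0 = 0"
proof -
  have "h 0 + 0 = h 0 + h 0"
    using ring_hom_onD(2)[OF assms(1), of 0 0] subring_zero[OF assms(2)] by simp
  then show ?thesis by (simp only: add_left_cancel)
qed

lemma ring_hom_on_uminus:
  assumes "ring_hom_on A h" "is_subring A" "a \<in> A" shows "h (- a) = - h a"
proof -
  have "h a + h (- a) = 0"
    using ring_hom_onD(2)[OF assms(1), of a "- a"] subring_uminus[OF assms(2,3)] assms(3)
      ring_hom_on_zero[OF assms(1,2)] by simp
  then show ?thesis by (simp add: add_eq_0_iff)
qed

lemma ring_hom_on_power:
  assumes "ring_hom_on A h" "is_subring A" "a \<in> A" shows "h (a ^ n) = h a ^ n"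
proof (induction n)
  case (Suc n)
  then show ?case using ring_hom_onD(3)[OF assms(1,3) subring_power[OF assms(2,3)]] by simp
qed (simp add: ring_hom_onD(1)[OF assms(1)])

lemma ring_hom_on_sum:
  assumes "ring_hom_on A h" "is_subring A" "\<And>i. i \<in> I \<Longrightarrow> f i \<in> A"
  shows "h (sum f I) = (\<Sum>i\<in>I. h (f i))"
  using assms(3)
proof (induction I rule: infinite_finite_induct)
  case (insert x F)
  then show ?case
    using ring_hom_onD(2)[OF assms(1), of "f x" "sum f F"] subring_sum[OF assms(2), of F f] by simp
qed (simp_all add: ring_hom_on_zero[OF assms(1,2)])

lemma ring_hom_on_prod:
  assumes "ring_hom_on A h" "is_subring A" "\<And>i. i \<in> I \<Longrightarrow> f i \<in> A"
  shows "h (prod f I) = (\<Prod>i\<in>I. h (f i))"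
  using assms(3)
proof (induction I rule: infinite_finite_induct)
  case (insert x F)
  then show ?case
    using ring_hom_onD(3)[OF assms(1), of "f x" "prod f F"] subring_prod[OF assms(2), of F f] by simp
qed (simp_all add: ring_hom_onD(1)[OF assms(1)])

lemma ring_hom_on_of_int:
  assumes "ring_hom_on A h" "is_subring A" shows "h (of_int n) = of_int n"
proof -
  have *: "h (of_nat k) = of_nat k" for k
  proof (induction k)
    case (Suc k)
    then show ?case
      using ring_hom_onD(1,2)[OF assms(1)] subring_one[OF assms(2)] subring_of_nat[OF assms(2), of k]
      by (simp add: add.commute)
  qed (simp add: ring_hom_on_zero[OF assms])
  show ?thesis
    by (cases n) (use assms in \<open>simp_all add: * ring_hom_on_uminus subring_of_nat del: of_nat_Suc\<close>)
qed

section \<open>Lattice points and rational cones\<close>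

lemma lattice_vec_nth [simp]: "lattice_vec m $ i = of_int (Poly_Mapping.lookup m i)"
  by (simp add: lattice_vec_def)

lemma lattice_vec_zero [simp]: "lattice_vec 0 = 0"
  and lattice_vec_add: "lattice_vec (m + n) = lattice_vec m + lattice_vec n"
  and lattice_vec_diff: "lattice_vec (m - n) = lattice_vec m - lattice_vec n"
  and lattice_vec_uminus: "lattice_vec (- m) = - lattice_vec m"
  by (simp_all add: vec_eq_iff lookup_add lookup_minus)

lemma lattice_vec_sum: "lattice_vec (\<Sum>i\<in>I. f i) = (\<Sum>i\<in>I. lattice_vec (f i))"
  by (induction I rule: infinite_finite_induct) (simp_all add: lattice_vec_add)

lemma lattice_vec_inject: "lattice_vec m = lattice_vec n \<longleftrightarrow> m = n"
  by (auto simp: vec_eq_iff intro!: poly_mapping_eqI)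

lemma exists_lookup_eq: "\<exists>m :: 'n::finite \<Rightarrow>\<^sub>0 int. \<forall>i. Poly_Mapping.lookup m i = f i"
proof
  show "\<forall>i. Poly_Mapping.lookup (Poly_Mapping.Abs_poly_mapping f) i = f i"
    by (subst lookup_Abs_poly_mapping) auto
qed

lemma keys_multE:
  assumes "k \<in> Poly_Mapping.keys (p * q)"
  obtains a b where "k = a + b" "a \<in> Poly_Mapping.keys p" "b \<in> Poly_Mapping.keys q"
  using assms keys_mult[of p q] by blast

text \<open>Round \<open>N x\<close> down coordinatewise for large \<open>N\<close>.\<close>

lemma exists_positive_lattice_vec:
  fixes W :: "(real^'n::finite) set"
  assumes W: "finite W" and x: "\<And>w. w \<in> W \<Longrightarrow> 0 < x \<bullet> w"
  obtains m :: "'n \<Rightarrow>\<^sub>0 int" where "\<And>w. w \<in> W \<Longrightarrow> 0 < lattice_vec m \<bullet> w"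
proof -
  \<comment> \<open>Rounding down changes the pairing of \<open>N x\<close> with \<open>w\<close> by
    at most the sum of the absolute coordinates of \<open>w\<close>, so every \<open>N\<close> above
    all these ratios keeps the pairings positive.\<close>
  define B where "B w = (\<Sum>i\<in>UNIV. \<bar>w $ i\<bar>) / (x \<bullet> w)" for w
  obtain N :: nat where N: "\<And>w. w \<in> W \<Longrightarrow> B w < real N"
  proof -
    have "finite (B ` W)" using W by simp
    then obtain b where "\<forall>y\<in>B ` W. y \<le> b" using bdd_above_finite[of "B ` W"] unfolding bdd_above_def by blast
    moreover obtain N :: nat where "b < real N" using reals_Archimedean2 by blast
    ultimately show ?thesis by (meson image_eqI le_less_trans that)
  qed
  obtain m :: "'n \<Rightarrow>\<^sub>0 int" where m: "\<And>i. Poly_Mapping.lookup m i = \<lfloor>real N * x $ i\<rfloor>"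
    using exists_lookup_eq[of "\<lambda>i. \<lfloor>real N * x $ i\<rfloor>"] by auto
  have "0 < lattice_vec m \<bullet> w" if w: "w \<in> W" for w
  proof -
    have "real N * (x \<bullet> w) - lattice_vec m \<bullet> w = (\<Sum>i\<in>UNIV. (real N * x $ i - of_int \<lfloor>real N * x $ i\<rfloor>) * w $ i)"
      by (simp add: inner_vec_def m sum_distrib_left sum_subtractf left_diff_distrib mult.assoc)
    also have "\<dots> \<le> (\<Sum>i\<in>UNIV. \<bar>w $ i\<bar>)"
    proof (rule sum_mono)
      fix i
      have "\<bar>(real N * x $ i - of_int \<lfloor>real N * x $ i\<rfloor>) * w $ i\<bar> \<le> 1 * \<bar>w $ i\<bar>"
        unfolding abs_mult by (intro mult_right_mono) linarith+
      then show "(real N * x $ i - of_int \<lfloor>real N * x $ i\<rfloor>) * w $ i \<le> \<bar>w $ i\<bar>" by linarith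
    qed
    also have "\<dots> < real N * (x \<bullet> w)"
      using N[OF w] x[OF w] by (simp add: B_def divide_less_eq)
    finally show ?thesis by simp
  qed
  then show ?thesis using that by blast
qed

lemma dual_cone_hull: "x \<in> dual_cone (convex_cone hull S) \<longleftrightarrow> (\<forall>v\<in>S. 0 \<le> x \<bullet> v)"
proof
  assume "\<forall>v\<in>S. 0 \<le> x \<bullet> v"
  then have "convex_cone hull S \<subseteq> {u. 0 \<le> x \<bullet> u}"
    by (intro hull_minimal) (auto simp: convex_cone_iff inner_add_right intro: exI[of _ 0])
  then show "x \<in> dual_cone (convex_cone hull S)" unfolding dual_cone_def by blast
qed (auto simp: dual_cone_def hull_inc)

lemma dual_cone_add: "x \<in> dual_cone \<sigma> \<Longrightarrow> y \<in> dual_cone \<sigma> \<Longrightarrow> x + y \<in> dual_cone \<sigma>"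
  by (simp add: dual_cone_def inner_add_left)

lemma dual_cone_zero [simp]: "0 \<in> dual_cone \<sigma>"
  by (simp add: dual_cone_def)

lemma dual_cone_sum: "(\<And>i. i \<in> I \<Longrightarrow> f i \<in> dual_cone \<sigma>) \<Longrightarrow> sum f I \<in> dual_cone \<sigma>"
  by (induction I rule: infinite_finite_induct) (auto intro: dual_cone_add)

text \<open>A convex combination of nonzero generators equal to 0 would exhibit a nonzero vector of
  the cone whose opposite is also in it. So the polytope of these generators misses 0, and a
  hyperplane separating it from 0 is positive on all of them.\<close>

lemma strictly_convex_cone_positive:
  fixes S :: "(real^'n::finite) set"
  assumes S: "finite S" and strict: "convex_cone hull S \<inter> uminus ` (convex_cone hull S) = {0}"
  obtains x where "\<And>v. v \<in> S - {0} \<Longrightarrow> 0 < x \<bullet> v"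
proof (cases "S - {0} = {}")
  case True then show ?thesis using that by blast
next
  case False
  let ?T = "S - {0}"
  let ?\<sigma> = "convex_cone hull S"
  have "0 \<notin> convex hull ?T"
  proof
    assume "0 \<in> convex hull ?T"
    then obtain c where c: "\<And>v. v \<in> ?T \<Longrightarrow> 0 \<le> c v" "sum c ?T = 1" "(\<Sum>v\<in>?T. c v *\<^sub>R v) = 0"
      using S by (auto simp: convex_hull_finite)
    have "\<exists>v\<in>?T. c v \<noteq> 0" using c(2) by (metis sum.neutral zero_neq_one)
    then obtain v where v: "v \<in> ?T" "c v \<noteq> 0" by blast
    have mem: "c w *\<^sub>R w \<in> ?\<sigma>" if "w \<in> ?T" for w
      using c(1)[OF that] that convex_cone_hull_mul hull_inc by (metis DiffD1)
    have "sum (\<lambda>w. c w *\<^sub>R w) J \<in> ?\<sigma>" if "J \<subseteq> ?T" for J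
      using that
      by (induction J rule: infinite_finite_induct)
        (auto intro: convex_cone_hull_contains_0 convex_cone_hull_add mem)
    from this[of "?T - {v}"] have "(\<Sum>w\<in>?T - {v}. c w *\<^sub>R w) \<in> ?\<sigma>" by blast
    moreover have "c v *\<^sub>R v + (\<Sum>w\<in>?T - {v}. c w *\<^sub>R w) = 0"
      using c(3) sum.remove[of ?T v "\<lambda>w. c w *\<^sub>R w"] v S by simp
    then have "c v *\<^sub>R v = - (\<Sum>w\<in>?T - {v}. c w *\<^sub>R w)" by (simp add: eq_neg_iff_add_eq_0)
    ultimately have "c v *\<^sub>R v \<in> ?\<sigma> \<inter> uminus ` ?\<sigma>" using mem[OF v(1)] by blast
    then show False using strict v by simp
  qed
  moreover have "closed (convex hull ?T)"
    using S by (simp add: finite_imp_compact compact_convex_hull compact_imp_closed)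
  ultimately obtain a b where "0 < b" "\<And>x. x \<in> convex hull ?T \<Longrightarrow> b < a \<bullet> x"
    using separating_hyperplane_closed_0[of "convex hull ?T"] convex_convex_hull by blast
  then have "0 < a \<bullet> v" if "v \<in> ?T" for v
    using that hull_inc[of v ?T convex] by (meson order.strict_trans)
  then show ?thesis using that by blast
qed

text \<open>
  Strict convexity makes the dual cone full-dimensional, so that a separating hyperplane can be
  moved to one given by a lattice point.
\<close>

lemma lattice_bidual:
  fixes \<sigma> :: "(real^'n::finite) set"
  assumes rat: "rational_cone \<sigma>" and strict: "\<sigma> \<inter> uminus ` \<sigma> = {0}"
    and u: "\<And>m. lattice_vec m \<in> dual_cone \<sigma> \<Longrightarrow> 0 \<le> lattice_vec m \<bullet> u"
  shows "u \<in> \<sigma>"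
proof (rule ccontr)
  assume nu: "u \<notin> \<sigma>"
  obtain S where S: "finite S" and \<sigma>: "\<sigma> = convex_cone hull S"
    using rat unfolding rational_cone_def by blast
  have "convex \<sigma>" "closed \<sigma>" unfolding \<sigma> using S closed_convex_cone_hull convex_convex_cone_hull by blast+
  then obtain a b where ab: "a \<bullet> u < b" "\<And>x. x \<in> \<sigma> \<Longrightarrow> b < a \<bullet> x"
    using separating_hyperplane_closed_point[of \<sigma> u] nu by blast
  have b: "b < 0" using ab(2)[of 0] convex_cone_hull_contains_0[of S] \<sigma> by simp
  have a: "0 \<le> a \<bullet> v" if v: "v \<in> S" for v
  proof (rule ccontr)
    assume n: "\<not> 0 \<le> a \<bullet> v"
    have "(b / (a \<bullet> v)) *\<^sub>R v \<in> \<sigma>"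
      unfolding \<sigma> using n b v by (intro convex_cone_hull_mul hull_inc divide_nonpos_nonpos) auto
    from ab(2)[OF this] n show False by simp
  qed
  obtain x where x: "\<And>v. v \<in> S - {0} \<Longrightarrow> 0 < x \<bullet> v"
    using strictly_convex_cone_positive[OF S] strict \<sigma> by blast
  \<comment> \<open>Adding \<epsilon> times \<open>x\<close> makes \<open>a\<close> strictly
    positive on the nonzero generators; at \<open>u\<close> it costs at most half of the negative
    value \<open>a \<bullet> u\<close>.\<close>
  define \<epsilon> where "\<epsilon> = (- (a \<bullet> u)) / (2 * (1 + \<bar>x \<bullet> u\<bar>))"
  have au: "a \<bullet> u < 0" using ab b by linarith
  then have \<epsilon>: "0 < \<epsilon>" unfolding \<epsilon>_def by (intro divide_pos_pos) auto
  have "(a + \<epsilon> *\<^sub>R x) \<bullet> u < 0"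
  proof -
    have "\<epsilon> * (x \<bullet> u) \<le> \<epsilon> * (1 + \<bar>x \<bullet> u\<bar>)" using \<epsilon> by (intro mult_left_mono) linarith+
    also have "\<dots> = (- (a \<bullet> u)) / 2" unfolding \<epsilon>_def by (simp add: field_simps)
    finally show ?thesis using au by (simp add: inner_add_left)
  qed
  moreover have "0 < (a + \<epsilon> *\<^sub>R x) \<bullet> v" if "v \<in> S - {0}" for v
    using a[of v] x[OF that] that \<epsilon> by (simp add: inner_add_left add_nonneg_pos)
  \<comment> \<open>With \<open>- u\<close> among the vectors, the same rounding preserves
    negativity at \<open>u\<close>.\<close>
  ultimately have "\<And>w. w \<in> insert (- u) (S - {0}) \<Longrightarrow> 0 < (a + \<epsilon> *\<^sub>R x) \<bullet> w" by auto
  then obtain m where m: "\<And>w. w \<in> insert (- u) (S - {0}) \<Longrightarrow> 0 < lattice_vec m \<bullet> w"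
    using exists_positive_lattice_vec[of "insert (- u) (S - {0})"] S by blast
  have "0 \<le> lattice_vec m \<bullet> v" if "v \<in> S" for v
    using m[of v] that by (cases "v = 0") auto
  then have "lattice_vec m \<in> dual_cone \<sigma>" unfolding \<sigma> dual_cone_hull by blast
  then show False using u[of m] m[of "- u"] by simp
qed

section \<open>Monomial valuations\<close>

text \<open>The order of a Laurent polynomial for the weight \<open>u\<close>. It is meaningful only
  for \<open>p \<noteq> 0\<close>, the minimum over the empty set being unspecified.\<close>

definition minpair :: "real^'n::finite \<Rightarrow> (('n \<Rightarrow>\<^sub>0 int) \<Rightarrow>\<^sub>0 int) \<Rightarrow> real" where
  "minpair u p = Min ((\<lambda>m. lattice_vec m \<bullet> u) ` Poly_Mapping.keys p)"

lemma minpair_le: "m \<in> Poly_Mapping.keys p \<Longrightarrow> minpair u p \<le> lattice_vec m \<bullet> u"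
  unfolding minpair_def by (rule Min_le) auto

lemma minpair_attained:
  assumes "p \<noteq> 0" obtains m where "m \<in> Poly_Mapping.keys p" "minpair u p = lattice_vec m \<bullet> u"
proof -
  have "minpair u p \<in> (\<lambda>m. lattice_vec m \<bullet> u) ` Poly_Mapping.keys p"
    unfolding minpair_def by (rule Min_in) (use assms in auto)
  then show ?thesis using that by (elim imageE) simp
qed

lemma minpair_add:
  assumes "p + q \<noteq> 0" "p \<noteq> 0 \<Longrightarrow> c \<le> minpair u p" "q \<noteq> 0 \<Longrightarrow> c \<le> minpair u q"
  shows "c \<le> minpair u (p + q)"
proof -
  obtain m where m: "m \<in> Poly_Mapping.keys (p + q)" "minpair u (p + q) = lattice_vec m \<bullet> u"
    by (rule minpair_attained[OF assms(1)])
  then have "m \<in> Poly_Mapping.keys p \<or> m \<in> Poly_Mapping.keys q"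
    using Poly_Mapping.keys_add[of p q] by blast
  then show ?thesis
  proof
    assume m': "m \<in> Poly_Mapping.keys p"
    then have "p \<noteq> 0" by auto
    then show ?thesis using assms(2) minpair_le[OF m', of u] m by linarith
  next
    assume m': "m \<in> Poly_Mapping.keys q"
    then have "q \<noteq> 0" by auto
    then show ?thesis using assms(3) minpair_le[OF m', of u] m by linarith
  qed
qed

text \<open>The product of the initial forms does not vanish, as \<open>\<int>[P]\<close> is a domain.\<close>

lemma minpair_mult:
  fixes p q :: "('n::{finite,linorder} \<Rightarrow>\<^sub>0 int) \<Rightarrow>\<^sub>0 int"
  assumes "p \<noteq> 0" "q \<noteq> 0"
  shows "minpair u (p * q) = minpair u p + minpair u q"
proof -
  define ini where "ini f = (\<Sum>m\<in>{m\<in>Poly_Mapping.keys f. lattice_vec m \<bullet> u = minpair u f}.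
      Poly_Mapping.single m (Poly_Mapping.lookup f m))" for f :: "('n \<Rightarrow>\<^sub>0 int) \<Rightarrow>\<^sub>0 int"
  have look: "Poly_Mapping.lookup (ini f) k =
      (if k \<in> Poly_Mapping.keys f \<and> lattice_vec k \<bullet> u = minpair u f then Poly_Mapping.lookup f k else 0)" for f k
    unfolding ini_def lookup_sum lookup_single when_def by (subst sum.delta) auto
  have ini0: "ini f \<noteq> 0" if fnz: "f \<noteq> 0" for f
  proof -
    obtain m where "m \<in> Poly_Mapping.keys f" "minpair u f = lattice_vec m \<bullet> u"
      by (rule minpair_attained[OF fnz])
    then have "Poly_Mapping.lookup (ini f) m \<noteq> 0" using look[of f m] by (simp add: in_keys_iff)
    then show ?thesis by auto
  qed
  have kini: "lattice_vec k \<bullet> u = minpair u f" if "k \<in> Poly_Mapping.keys (ini f)" for f k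
    using that look[of f k] by (auto simp: in_keys_iff split: if_splits)
  have krest: "lattice_vec k \<bullet> u > minpair u f" if "k \<in> Poly_Mapping.keys (f - ini f)" for f k
  proof -
    have "k \<in> Poly_Mapping.keys f \<and> lattice_vec k \<bullet> u \<noteq> minpair u f"
      using that look[of f k] by (auto simp: in_keys_iff lookup_minus split: if_splits)
    then show ?thesis using minpair_le[of k f u] by linarith
  qed
  define g where "g = ini p * (q - ini q) + (p - ini p) * q"
  have pq: "p * q = ini p * ini q + g" unfolding g_def by (simp add: algebra_simps)
  let ?c = "minpair u p + minpair u q"
  have g: "lattice_vec k \<bullet> u > ?c" if k: "k \<in> Poly_Mapping.keys g" for k
  proof -
    have "k \<in> Poly_Mapping.keys (ini p * (q - ini q)) \<or> k \<in> Poly_Mapping.keys ((p - ini p) * q)"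
      using k Poly_Mapping.keys_add[of "ini p * (q - ini q)" "(p - ini p) * q"] unfolding g_def by blast
    then show ?thesis
    proof
      assume "k \<in> Poly_Mapping.keys (ini p * (q - ini q))"
      then obtain a b where "k = a + b" "a \<in> Poly_Mapping.keys (ini p)" "b \<in> Poly_Mapping.keys (q - ini q)"
        by (rule keys_multE)
      then show ?thesis using kini[of a p] krest[of b q] by (simp add: lattice_vec_add inner_add_left)
    next
      assume "k \<in> Poly_Mapping.keys ((p - ini p) * q)"
      then obtain a b where "k = a + b" "a \<in> Poly_Mapping.keys (p - ini p)" "b \<in> Poly_Mapping.keys q"
        by (rule keys_multE)
      then show ?thesis using krest[of a p] minpair_le[of b q u] by (simp add: lattice_vec_add inner_add_left)
    qed
  qed
  have ii: "lattice_vec k \<bullet> u = ?c" if k: "k \<in> Poly_Mapping.keys (ini p * ini q)" for k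
  proof -
    obtain a b where "k = a + b" "a \<in> Poly_Mapping.keys (ini p)" "b \<in> Poly_Mapping.keys (ini q)"
      using k by (rule keys_multE)
    then show ?thesis using kini[of a p] kini[of b q] by (simp add: lattice_vec_add inner_add_left)
  qed
  \<comment> \<open>A monomial of this product has weight exactly \<open>?c\<close>, while those of
    \<open>g\<close> have larger weight; so it is not cancelled in \<open>p * q\<close>.\<close>
  have "ini p * ini q \<noteq> 0" using ini0 assms by simp
  then obtain k where k: "k \<in> Poly_Mapping.keys (ini p * ini q)" by (metis ex_in_conv keys_eq_empty)
  have "k \<notin> Poly_Mapping.keys g" using g[of k] ii[OF k] by auto
  then have kpq: "k \<in> Poly_Mapping.keys (p * q)"
    using k unfolding pq by (simp add: in_keys_iff lookup_add)
  have "p * q \<noteq> 0" using assms by simp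
  then obtain n where n: "n \<in> Poly_Mapping.keys (p * q)" "minpair u (p * q) = lattice_vec n \<bullet> u"
    by (rule minpair_attained)
  have "n \<in> Poly_Mapping.keys (ini p * ini q) \<or> n \<in> Poly_Mapping.keys g"
    using n(1) Poly_Mapping.keys_add[of "ini p * ini q" g] unfolding pq by blast
  then have "?c \<le> minpair u (p * q)" using g[of n] ii[of n] n by auto
  moreover have "minpair u (p * q) \<le> ?c" using minpair_le[OF kpq, of u] ii[OF k] by simp
  ultimately show ?thesis by simp
qed

text \<open>Independent of the fraction by \<open>minpair_mult\<close>. The value at 0 is
  unspecified, which is why 0 is treated apart in \<open>val_ring\<close> and
  \<open>val_centre\<close>.\<close>

definition val :: "real^'n::{finite,linorder} \<Rightarrow> 'n ratfun \<Rightarrow> real" where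
  "val u q = (THE c. \<exists>a b. a \<noteq> 0 \<and> b \<noteq> 0 \<and> q = Fract a b \<and> c = minpair u a - minpair u b)"

lemma val_Fract:
  assumes "a \<noteq> 0" "b \<noteq> 0"
  shows "val u (Fract a b) = minpair u a - minpair u b"
  unfolding val_def
proof (rule the_equality)
  fix c assume "\<exists>a' b'. a' \<noteq> 0 \<and> b' \<noteq> 0 \<and> Fract a b = Fract a' b' \<and> c = minpair u a' - minpair u b'"
  then obtain a' b' where *: "a' \<noteq> 0" "b' \<noteq> 0" "Fract a b = Fract a' b'" "c = minpair u a' - minpair u b'"
    by blast
  then have "a * b' = a' * b" using assms by (simp add: eq_fract)
  then have "minpair u a + minpair u b' = minpair u a' + minpair u b"
    using minpair_mult[of a b' u] minpair_mult[of a' b u] * assms by simp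
  then show "c = minpair u a - minpair u b" using * by simp
qed (use assms in blast)

lemma ratfun_cases:
  fixes q :: "'n::{finite,linorder} ratfun"
  assumes "q \<noteq> 0" obtains a b where "q = Fract a b" "a \<noteq> 0" "b \<noteq> 0"
  using assms by (cases q rule: Fract_cases_nonzero) auto

lemma Fract_nonzero: "b \<noteq> 0 \<Longrightarrow> Fract a b \<noteq> 0 \<longleftrightarrow> a \<noteq> 0"
  by (simp add: Zero_fract_def eq_fract)

lemma val_mult: "x \<noteq> 0 \<Longrightarrow> y \<noteq> 0 \<Longrightarrow> val u (x * y) = val u x + val u y"
  by (elim ratfun_cases) (simp add: val_Fract minpair_mult)

lemma val_add:
  assumes "x + y \<noteq> 0" "x \<noteq> 0 \<Longrightarrow> c \<le> val u x" "y \<noteq> 0 \<Longrightarrow> c \<le> val u y"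
  shows "c \<le> val u (x + y)"
proof (cases "x = 0 \<or> y = 0")
  case True then show ?thesis using assms by auto
next
  case False
  then obtain a b a' b' where xy: "x = Fract a b" "y = Fract a' b'" "a \<noteq> 0" "b \<noteq> 0" "a' \<noteq> 0" "b' \<noteq> 0"
    using ratfun_cases[of x] ratfun_cases[of y] by (metis (no_types))
  have s: "x + y = Fract (a * b' + a' * b) (b * b')" using xy by simp
  then have nz: "a * b' + a' * b \<noteq> 0" using assms(1) Fract_nonzero xy by (metis mult_eq_0_iff)
  have "c + minpair u (b * b') \<le> minpair u (a * b' + a' * b)"
  proof (rule minpair_add[OF nz])
    show "c + minpair u (b * b') \<le> minpair u (a * b')"
      using assms(2) False xy by (simp add: minpair_mult val_Fract)
    show "c + minpair u (b * b') \<le> minpair u (a' * b)"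
      using assms(3) False xy by (simp add: minpair_mult val_Fract)
  qed
  then show ?thesis unfolding s using nz xy by (simp add: val_Fract)
qed

lemma minpair_single: "c \<noteq> 0 \<Longrightarrow> minpair u (Poly_Mapping.single m c) = lattice_vec m \<bullet> u"
  by (simp add: minpair_def)

lemma val_one [simp]: "val u 1 = 0"
  by (simp add: One_fract_def val_Fract)

lemma val_uminus: "x \<noteq> 0 \<Longrightarrow> val u (- x) = val u x"
proof -
  assume x: "x \<noteq> 0"
  have "val u (-1 * -1) = val u (-1) + val u (-1)" by (rule val_mult) auto
  then have "val u (-1) = 0" by simp
  then show ?thesis using val_mult[of "-1" x u] x by simp
qed

lemma val_inverse: "x \<noteq> 0 \<Longrightarrow> val u (inverse x) = - val u x"
  using val_mult[of x "inverse x" u] by simp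

definition val_ring :: "real^'n::{finite,linorder} \<Rightarrow> 'n ratfun set" where
  "val_ring u = {q. q \<noteq> 0 \<longrightarrow> 0 \<le> val u q}"

lemma is_subring_val_ring: "is_subring (val_ring u)"
  unfolding is_subring_def
proof (intro conjI ballI)
  show "1 \<in> val_ring u" by (simp add: val_ring_def)
  fix a b assume ab: "a \<in> val_ring u" "b \<in> val_ring u"
  show "a - b \<in> val_ring u"
    unfolding val_ring_def using ab val_add[of a "- b" 0 u] by (auto simp: val_ring_def val_uminus)
  show "a * b \<in> val_ring u" using ab by (auto simp: val_ring_def val_mult)
qed

text \<open>The trace on \<open>A\<close> of the maximal ideal of the valuation ring. When
  \<open>A\<close> lies in that ring, it is the point of the spectrum of \<open>A\<close> at which
  the valuation is centred.\<close>

definition val_centre :: "real^'n::{finite,linorder} \<Rightarrow> 'n ratfun set \<Rightarrow> 'n ratfun set" where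
  "val_centre u A = {r \<in> A. r \<noteq> 0 \<longrightarrow> 0 < val u r}"

lemma prime_val_centre:
  assumes A: "is_subring A" "A \<subseteq> val_ring u"
  shows "is_prime_ideal A (val_centre u A)"
  unfolding is_prime_ideal_def is_ideal_def
proof (intro conjI ballI impI)
  show "val_centre u A \<subseteq> A" "0 \<in> val_centre u A" "1 \<notin> val_centre u A"
    using subring_zero[OF A(1)] by (auto simp: val_centre_def)
next
  fix a b assume ab: "a \<in> val_centre u A" "b \<in> val_centre u A"
  show "a + b \<in> val_centre u A"
  proof (cases "a = 0 \<or> b = 0")
    case True then show ?thesis using ab by auto
  next
    case False
    then have "0 < min (val u a) (val u b)" using ab by (simp add: val_centre_def)
    moreover have "min (val u a) (val u b) \<le> val u (a + b)" if "a + b \<noteq> 0"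
      by (rule val_add[OF that]) auto
    ultimately show ?thesis using ab subring_add[OF A(1)] unfolding val_centre_def by fastforce
  qed
next
  fix r a assume "r \<in> A" "a \<in> val_centre u A"
  then show "r * a \<in> val_centre u A"
    using A subring_mult[OF A(1)] by (auto simp: val_centre_def val_mult val_ring_def intro!: add_nonneg_pos)
next
  fix a b assume "a \<in> A" "b \<in> A" "a * b \<in> val_centre u A"
  then show "a \<in> val_centre u A \<or> b \<in> val_centre u A"
    using A(2) by (auto simp: val_centre_def val_mult val_ring_def split: if_splits)
qed

lemma localize_val_centre:
  assumes A: "A \<subseteq> val_ring u"
  shows "localize A (val_centre u A) \<subseteq> val_ring u"
proof
  fix x assume "x \<in> localize A (val_centre u A)"
  then obtain a b where x: "x = a / b" "a \<in> A" "b \<in> A" "b \<notin> val_centre u A" by (metis localizeE)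
  then have b: "b \<noteq> 0" "val u b \<le> 0" by (auto simp: val_centre_def)
  moreover have "0 \<le> val u a" if "a \<noteq> 0" using A x that unfolding val_ring_def by blast
  ultimately show "x \<in> val_ring u"
    unfolding val_ring_def x divide_inverse by (auto simp: val_mult val_inverse)
qed

section \<open>Characters and cone rings\<close>

lemma character_nonzero [simp]: "character m \<noteq> 0"
  by (metis Fract_nonzero character_def one_neq_zero single_zero inj_single poly_mapping_eqI lookup_single_eq lookup_zero)

lemma character_zero [simp]: "character 0 = 1"
  by (simp add: character_def One_fract_def)

lemma character_add: "character (m + n) = character m * character n"
  by (simp add: character_def mult_single)

lemma character_uminus: "character (- m) = inverse (character m)"
proof -
  have "character m * character (- m) = 1" using character_add[of m "- m"] by simp
  then show ?thesis by (rule inverse_unique[symmetric])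
qed

lemma character_diff: "character (m - n) = character m / character n"
  using character_add[of m "- n"] by (simp add: character_uminus divide_inverse)

lemma character_sum: "character (\<Sum>i\<in>I. f i) = (\<Prod>i\<in>I. character (f i))"
  by (induction I rule: infinite_finite_induct) (simp_all add: character_add)

fun nmul :: "nat \<Rightarrow> 'a::monoid_add \<Rightarrow> 'a" where
  "nmul 0 m = 0" | "nmul (Suc k) m = m + nmul k m"

lemma character_nmul: "character (nmul k m) = character m ^ k"
  by (induction k) (simp_all add: character_add)

lemma lattice_vec_nmul: "lattice_vec (nmul k m) = real k *\<^sub>R lattice_vec m"
  by (induction k) (simp_all add: lattice_vec_add scaleR_add_left)

lemma val_character [simp]: "val u (character m) = lattice_vec m \<bullet> u"
proof -
  have "Poly_Mapping.single m (1::int) \<noteq> 0" by (metis keys_eq_empty keys_frag_of insert_not_empty)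
  then have "val u (character m) = minpair u (Poly_Mapping.single m 1) - minpair u 1"
    unfolding character_def by (intro val_Fract) auto
  also have "minpair u 1 = 0" by (simp add: minpair_def)
  finally show ?thesis by (simp add: minpair_single)
qed

lemma Fract_expand:
  "Fract p 1 = (\<Sum>m\<in>Poly_Mapping.keys p. of_int (Poly_Mapping.lookup p m) * character m)"
proof -
  have of_int: "of_int c * character m = Fract (Poly_Mapping.single m c) 1" for c and m :: "'a \<Rightarrow>\<^sub>0 int"
  proof -
    have nat: "of_nat k * character m = Fract (Poly_Mapping.single m (int k)) 1" for k
      by (simp add: of_nat_fract character_def mult_single flip: single_of_nat)
    show ?thesis
    proof (cases c)
      case (nonneg k) then show ?thesis using nat by simp
    next
      case (neg k)
      then show ?thesis using nat[of "Suc k"] by (simp add: single_uminus del: of_nat_Suc)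
    qed
  qed
  have sum: "Fract (\<Sum>m\<in>I. f m) 1 = (\<Sum>m\<in>I. Fract (f m) 1)" for I and f :: "_ \<Rightarrow> ('a \<Rightarrow>\<^sub>0 int) \<Rightarrow>\<^sub>0 int"
  proof (induction I rule: infinite_finite_induct)
    case (insert x F)
    have "Fract (f x + sum f F) 1 = Fract (f x) 1 + Fract (sum f F) 1" by simp
    then show ?case unfolding sum.insert[OF insert(1,2)] insert(3) .
  qed (simp_all add: Zero_fract_def)
  have "p = (\<Sum>m\<in>Poly_Mapping.keys p. Poly_Mapping.single m (Poly_Mapping.lookup p m))"
    by (rule poly_mapping_eqI) (auto simp: lookup_sum lookup_single when_def in_keys_iff sum.delta')
  then have "Fract p 1 = Fract (\<Sum>m\<in>Poly_Mapping.keys p. Poly_Mapping.single m (Poly_Mapping.lookup p m)) 1"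
    by simp
  then show ?thesis unfolding sum of_int .
qed

lemma character_in_cone_ring: "character m \<in> cone_ring \<sigma> \<longleftrightarrow> lattice_vec m \<in> dual_cone \<sigma>"
proof
  assume "character m \<in> cone_ring \<sigma>"
  then obtain p where p: "character m = Fract p 1" "\<forall>m\<in>Poly_Mapping.keys p. lattice_vec m \<in> dual_cone \<sigma>"
    unfolding cone_ring_def by blast
  then have "p = Poly_Mapping.single m 1" by (simp add: character_def eq_fract)
  then show "lattice_vec m \<in> dual_cone \<sigma>" using p by simp
next
  assume "lattice_vec m \<in> dual_cone \<sigma>"
  then show "character m \<in> cone_ring \<sigma>"
    unfolding cone_ring_def character_def by (intro CollectI exI[of _ "Poly_Mapping.single m 1"]) simp
qed

lemma is_subring_cone_ring: "is_subring (cone_ring \<sigma>)"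
  unfolding is_subring_def
proof (intro conjI ballI)
  show "1 \<in> cone_ring \<sigma>" using character_in_cone_ring[of 0 \<sigma>] by simp
  fix a b assume "a \<in> cone_ring \<sigma>" "b \<in> cone_ring \<sigma>"
  then obtain p q where ab: "a = Fract p 1" "b = Fract q 1"
    and p: "\<forall>m\<in>Poly_Mapping.keys p. lattice_vec m \<in> dual_cone \<sigma>"
    and q: "\<forall>m\<in>Poly_Mapping.keys q. lattice_vec m \<in> dual_cone \<sigma>"
    unfolding cone_ring_def by blast
  have "\<forall>m\<in>Poly_Mapping.keys (p - q). lattice_vec m \<in> dual_cone \<sigma>"
    using p q keys_diff[of p q] by blast
  moreover have "\<forall>m\<in>Poly_Mapping.keys (p * q). lattice_vec m \<in> dual_cone \<sigma>"
    using p q by (auto elim!: keys_multE simp: lattice_vec_add intro!: dual_cone_add)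
  moreover have "a - b = Fract (p - q) 1" "a * b = Fract (p * q) 1" using ab by simp_all
  ultimately show "a - b \<in> cone_ring \<sigma>" "a * b \<in> cone_ring \<sigma>"
    unfolding cone_ring_def by blast+
qed

lemma cone_ring_subset_val_ring:
  assumes "u \<in> \<sigma>" shows "cone_ring \<sigma> \<subseteq> val_ring u"
proof
  fix x assume "x \<in> cone_ring \<sigma>"
  then obtain p where p: "x = Fract p 1" "\<forall>m\<in>Poly_Mapping.keys p. lattice_vec m \<in> dual_cone \<sigma>"
    unfolding cone_ring_def by blast
  have "0 \<le> minpair u p" if pnz: "p \<noteq> 0"
  proof -
    obtain m where "m \<in> Poly_Mapping.keys p" "minpair u p = lattice_vec m \<bullet> u"
      by (rule minpair_attained[OF pnz])
    then show ?thesis using p(2) assms unfolding dual_cone_def by auto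
  qed
  moreover have "minpair u 1 = 0" by (simp add: minpair_def)
  ultimately show "x \<in> val_ring u"
    unfolding val_ring_def p(1) by (auto simp: Fract_nonzero val_Fract)
qed

section \<open>Local rings of toric schemes\<close>

lemma keys_single_mult:
  fixes p :: "('n::{finite,linorder} \<Rightarrow>\<^sub>0 int) \<Rightarrow>\<^sub>0 int"
  assumes "k \<in> Poly_Mapping.keys p"
  shows "m + k \<in> Poly_Mapping.keys (Poly_Mapping.single m 1 * p)"
proof -
  have "Poly_Mapping.single (- m) 1 * Poly_Mapping.single m (1::int) = 1"
    by (simp add: mult_single)
  then have "Poly_Mapping.single (- m) 1 * (Poly_Mapping.single m 1 * p) = p"
    by (simp only: mult.assoc[symmetric] mult_1)
  then have "k \<in> Poly_Mapping.keys (Poly_Mapping.single (- m) 1 * (Poly_Mapping.single m 1 * p))"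
    using assms by (simp only:)
  then obtain a k' where "k = a + k'" "a \<in> Poly_Mapping.keys (Poly_Mapping.single (- m) (1::int))"
    "k' \<in> Poly_Mapping.keys (Poly_Mapping.single m 1 * p)"
    by (rule keys_multE)
  then show ?thesis by simp
qed

lemma character_mult_Fract: "character m * Fract p 1 = Fract (Poly_Mapping.single m 1 * p) 1"
  by (simp add: character_def)

lemma Fract_1_inject: "Fract p 1 = Fract q 1 \<longleftrightarrow> p = q"
  by (simp add: eq_fract)

text \<open>An ideal containing every character that occurs in an element contains the element, an
  integral combination of them. Thus a denominator outside \<open>p\<close> always supplies a
  monomial outside \<open>p\<close>.\<close>

lemma cone_ring_not_in_prime:
  assumes p: "is_prime_ideal (cone_ring \<sigma>) p" and b: "Fract q 1 \<in> cone_ring \<sigma>" "Fract q 1 \<notin> p"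
  obtains k where "k \<in> Poly_Mapping.keys q" "lattice_vec k \<in> dual_cone \<sigma>" "character k \<notin> p"
proof -
  have q: "\<forall>m\<in>Poly_Mapping.keys q. lattice_vec m \<in> dual_cone \<sigma>"
    using b(1) unfolding cone_ring_def by (auto simp: Fract_1_inject)
  have "\<exists>k\<in>Poly_Mapping.keys q. character k \<notin> p"
  proof (rule ccontr)
    assume "\<not> ?thesis"
    then have "of_int (Poly_Mapping.lookup q m) * character m \<in> p" if "m \<in> Poly_Mapping.keys q" for m
      using ideal_mult[OF prime_ideal_is_ideal[OF p] subring_of_int[OF is_subring_cone_ring]] that by blast
    then have "Fract q 1 \<in> p"
      unfolding Fract_expand by (rule ideal_sum[OF prime_ideal_is_ideal[OF p]])
    then show False using b by simp
  qed
  then show ?thesis using q that by blast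
qed

text \<open>Separatedness in monomial form: a point of the chart of \<sigma> at which the ring of
  \<tau> is regular behaves like a point of the chart of the intersection. Some \<open>f\<close> in
  the dual cone of \<sigma>, with \<open>character f\<close> invertible at the point, is positive on
  all generators of \<sigma> outside \<tau>. A large multiple of \<open>f\<close> then corrects the
  negative values of \<open>k\<close>, and dividing by the corresponding power of
  \<open>character f\<close> is allowed.\<close>

lemma character_in_local_ring:
  fixes \<sigma> :: "(real^'n::{finite,linorder}) set"
  assumes \<sigma>: "rational_cone \<sigma>" and R: "R \<in> spec_rings (cone_ring \<sigma>)"
    and \<tau>: "rational_cone \<tau>" "\<tau> \<inter> uminus ` \<tau> = {0}" and sub: "cone_ring \<tau> \<subseteq> R"
    and k: "\<And>u. u \<in> \<sigma> \<inter> \<tau> \<Longrightarrow> lattice_vec k \<bullet> u = 0"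
  shows "character k \<in> R"
proof -
  let ?A = "cone_ring \<sigma>"
  obtain p where p: "is_prime_ideal ?A p" and Rp: "R = localize ?A p"
    using R unfolding spec_rings_def by blast
  obtain S where S: "finite S" and \<sigma>S: "\<sigma> = convex_cone hull S"
    using \<sigma> unfolding rational_cone_def by blast
  define F where "F = {f. lattice_vec f \<in> dual_cone \<sigma> \<and> character f \<notin> p}"
  have Fnn: "0 \<le> lattice_vec f \<bullet> v" if "f \<in> F" "v \<in> S" for f v
    using that hull_inc[of v S] unfolding F_def dual_cone_def \<sigma>S by blast
  \<comment> \<open>If all of \<open>F\<close> vanished at \<open>v\<close>, write
    \<open>character m\<close>, for \<open>m\<close> in the dual cone of \<tau>, as a fraction and
    take a monomial \<open>l\<close> of its denominator outside \<open>p\<close>. Then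
    \<open>m + l\<close> is nonnegative at \<open>v\<close> and \<open>l\<close> is 0 there, so
    \<open>m\<close> is nonnegative at \<open>v\<close>, and biduality puts \<open>v\<close> in
    \<tau>.\<close>
  have pos: "\<exists>f\<in>F. 0 < lattice_vec f \<bullet> v" if v: "v \<in> S" "v \<notin> \<tau>" for v
  proof (rule ccontr)
    assume n: "\<not> ?thesis"
    have z: "lattice_vec f \<bullet> v = 0" if "f \<in> F" for f
      using n Fnn[OF that v(1)] that by force
    have "v \<in> \<tau>"
    proof (rule lattice_bidual[OF \<tau>])
      fix m :: "'n \<Rightarrow>\<^sub>0 int" assume m: "lattice_vec m \<in> dual_cone \<tau>"
      then have "character m \<in> localize ?A p" using sub Rp character_in_cone_ring by blast
      then obtain a b where ab: "character m = a / b" "a \<in> ?A" "b \<in> ?A" "b \<notin> p" by (metis localizeE)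
      have b0: "b \<noteq> 0" using ab prime_ideal_zero[OF p] by auto
      obtain q where q: "b = Fract q 1" using ab(3) unfolding cone_ring_def by blast
      obtain l where l: "l \<in> Poly_Mapping.keys q" "lattice_vec l \<in> dual_cone \<sigma>" "character l \<notin> p"
        using cone_ring_not_in_prime[OF p] ab(3,4) unfolding q by blast
      have "a = character m * b" using ab(1) b0 by simp
      then have "Fract (Poly_Mapping.single m 1 * q) 1 \<in> ?A" using ab(2) q character_mult_Fract by metis
      then have "lattice_vec (m + l) \<in> dual_cone \<sigma>"
        using keys_single_mult[OF l(1), of m] unfolding cone_ring_def by (auto simp: Fract_1_inject)
      then have "0 \<le> lattice_vec (m + l) \<bullet> v"
        using v(1) hull_inc[of v S] unfolding dual_cone_def \<sigma>S by blast
      moreover have "lattice_vec l \<bullet> v = 0" using z[of l] l unfolding F_def by blast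
      ultimately show "0 \<le> lattice_vec m \<bullet> v" by (simp add: lattice_vec_add inner_add_left)
    qed
    then show False using v by blast
  qed
  then obtain g where g: "\<And>v. v \<in> S \<Longrightarrow> v \<notin> \<tau> \<Longrightarrow> g v \<in> F \<and> 0 < lattice_vec (g v) \<bullet> v" by metis
  define T where "T = S - \<tau>"
  have T: "finite T" "T \<subseteq> S" using S T_def by auto
  define f where "f = (\<Sum>v\<in>T. g v)"
  have gF: "g v \<in> F" if "v \<in> T" for v using g that unfolding T_def by blast
  have fd: "lattice_vec f \<in> dual_cone \<sigma>"
    unfolding f_def lattice_vec_sum using gF by (intro dual_cone_sum) (auto simp: F_def)
  have cf: "character f \<in> ?A" using fd character_in_cone_ring by blast
  have notp: "(\<Prod>v\<in>J. character (g v)) \<notin> p \<and> (\<Prod>v\<in>J. character (g v)) \<in> ?A" if "J \<subseteq> T" for J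
    using finite_subset[OF that T(1)] that
  proof (induction J rule: finite_induct)
    case empty
    then show ?case using prime_ideal_one[OF p] subring_one[OF is_subring_cone_ring] by simp
  next
    case (insert v J)
    have "character (g v) \<in> ?A" "character (g v) \<notin> p"
      using gF[of v] insert.prems unfolding F_def character_in_cone_ring by auto
    moreover have "(\<Prod>v\<in>J. character (g v)) \<notin> p" "(\<Prod>v\<in>J. character (g v)) \<in> ?A"
      using insert.IH insert.prems by blast+
    ultimately show ?case
      unfolding prod.insert[OF insert.hyps]
      using prime_ideal_mult[OF p] subring_mult[OF is_subring_cone_ring, of _ \<sigma>] by blast
  qed
  have fp: "character f \<notin> p" unfolding f_def character_sum using notp[of T] by simp
  have fpos: "0 < lattice_vec f \<bullet> v" if v: "v \<in> T" for v
  proof -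
    have "0 < (\<Sum>w\<in>T. lattice_vec (g w) \<bullet> v)"
    proof (rule sum_pos2[OF T(1) v])
      show "0 < lattice_vec (g v) \<bullet> v" using g v unfolding T_def by blast
    qed (use Fnn gF v T in blast)
    then show ?thesis by (simp add: f_def lattice_vec_sum inner_sum_left)
  qed
  have "\<exists>N::nat. \<forall>v\<in>T. 0 \<le> lattice_vec k \<bullet> v + real N * (lattice_vec f \<bullet> v)"
  proof -
    have "\<exists>b. \<forall>y\<in>(\<lambda>v. - (lattice_vec k \<bullet> v) / (lattice_vec f \<bullet> v)) ` T. y \<le> b"
      using bdd_above_finite[OF finite_imageI[OF T(1)], of "\<lambda>v. - (lattice_vec k \<bullet> v) / (lattice_vec f \<bullet> v)"]
      unfolding bdd_above_def .
    then obtain b where b: "\<And>v. v \<in> T \<Longrightarrow> - (lattice_vec k \<bullet> v) / (lattice_vec f \<bullet> v) \<le> b" by auto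
    obtain N :: nat where "b < real N" using reals_Archimedean2 by blast
    then have "- (lattice_vec k \<bullet> v) / (lattice_vec f \<bullet> v) \<le> real N" if "v \<in> T" for v
      using b[OF that] by linarith
    then have "- (lattice_vec k \<bullet> v) \<le> real N * (lattice_vec f \<bullet> v)" if "v \<in> T" for v
      using that by (simp only: pos_divide_le_eq[OF fpos[OF that], symmetric])
    then have "0 \<le> lattice_vec k \<bullet> v + real N * (lattice_vec f \<bullet> v)" if "v \<in> T" for v
      using that by fastforce
    then show ?thesis by blast
  qed
  then obtain N :: nat where N: "\<And>v. v \<in> T \<Longrightarrow> 0 \<le> lattice_vec k \<bullet> v + real N * (lattice_vec f \<bullet> v)"
    by blast
  \<comment> \<open>Generators in \<tau> lie in the intersection, where \<open>k\<close> vanishes;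
    at the others \<open>N\<close> was chosen so that \<open>f\<close> outweighs
    \<open>k\<close>.\<close>
  have "lattice_vec (k + nmul N f) \<in> dual_cone \<sigma>"
    unfolding \<sigma>S dual_cone_hull
  proof
    fix v assume v: "v \<in> S"
    show "0 \<le> lattice_vec (k + nmul N f) \<bullet> v"
    proof (cases "v \<in> \<tau>")
      case True
      then have "lattice_vec k \<bullet> v = 0" using k[of v] v hull_inc[of v S] \<sigma>S by blast
      moreover have "0 \<le> lattice_vec f \<bullet> v" using fd v unfolding \<sigma>S dual_cone_hull by blast
      ultimately show ?thesis by (simp add: lattice_vec_add lattice_vec_nmul inner_add_left)
    next
      case False
      then show ?thesis using N[of v] v T_def
        by (simp add: lattice_vec_add lattice_vec_nmul inner_add_left)
    qed
  qed
  then have num: "character (k + nmul N f) \<in> ?A" using character_in_cone_ring by blast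
  have "character f ^ N \<notin> p \<and> character f ^ N \<in> ?A"
  proof (induction N)
    case 0 then show ?case using prime_ideal_one[OF p] subring_one[OF is_subring_cone_ring] by simp
  next
    case (Suc N)
    then show ?case
      unfolding power_Suc
      using fp cf prime_ideal_mult[OF p] subring_mult[OF is_subring_cone_ring, of _ \<sigma>] by blast
  qed
  then have "character (k + nmul N f) / character f ^ N \<in> R"
    unfolding Rp using localizeI[OF num] by blast
  moreover have "character (k + nmul N f) / character f ^ N = character k"
    by (simp add: character_add character_nmul)
  ultimately show ?thesis by simp
qed

section \<open>Completeness of the fan, global sections, and vertices of the polytope\<close>

locale projective_toric =
  fixes \<Sigma> :: "(real^'n::{finite,linorder}) set set"
    and \<psi> :: "real^'n::{finite,linorder} \<Rightarrow> real"
  assumes fan: "fan \<Sigma>"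
    and projective: "projective_over_Z (toric_scheme \<Sigma>)"
    and support: "support_function \<Sigma> \<psi>"
    and generated: "globally_generated (toric_scheme \<Sigma>) (toric_divisor \<Sigma> \<psi>)"
begin

abbreviation "X \<equiv> toric_scheme \<Sigma>"
abbreviation "D \<equiv> toric_divisor \<Sigma> \<psi>"
abbreviation "lattice_points \<equiv> {m. lattice_vec m \<in> polytope_of \<psi>}"

lemma cone: assumes "\<sigma> \<in> \<Sigma>" shows "rational_cone \<sigma>" "\<sigma> \<inter> uminus ` \<sigma> = {0}"
  using fan assms unfolding fan_def by blast+

lemma point_cases:
  assumes "R \<in> X"
  obtains \<sigma> where "\<sigma> \<in> \<Sigma>" "R \<in> spec_rings (cone_ring \<sigma>)"
  using assms unfolding toric_scheme_def by blast

lemma spec_cone_ring: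
  assumes "R \<in> spec_rings (cone_ring \<sigma>)"
  shows "is_subring R" "cone_ring \<sigma> \<subseteq> R"
  using assms is_subring_localize[OF is_subring_cone_ring] subset_localize[OF is_subring_cone_ring]
  unfolding spec_rings_def by blast+

lemma point_subring: "R \<in> X \<Longrightarrow> is_subring R"
  by (elim point_cases) (rule spec_cone_ring(1))

text \<open>The centre on \<open>X\<close> of the monomial valuation at \<open>u\<close>, which exists by properness, lies in a cone containing \<open>u\<close>.\<close>

lemma fan_complete: obtains \<sigma> where "\<sigma> \<in> \<Sigma>" "u \<in> \<sigma>"
proof -
  obtain N and f :: "nat \<Rightarrow> 'n ratfun" where nz: "\<exists>i\<le>N. f i \<noteq> 0"
    and X: "X = (\<Union>i\<in>{i. i \<le> N \<and> f i \<noteq> 0}. spec_rings (is_subring hull ((\<lambda>j. f j / f i) ` {..N})))"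
    using projective unfolding projective_over_Z_def by blast
  let ?I = "{i. i \<le> N \<and> f i \<noteq> 0}"
  \<comment> \<open>Dividing by a coordinate of least value puts all ratios into the valuation ring:
    the valuative criterion for projective space.\<close>
  define i where "i = arg_min_on (\<lambda>i. val u (f i)) ?I"
  have I: "finite ?I" "?I \<noteq> {}" using nz by auto
  have i: "i \<in> ?I" unfolding i_def by (rule arg_min_if_finite(1)[OF I])
  have min: "val u (f i) \<le> val u (f j)" if "j \<in> ?I" for j
    using arg_min_if_finite(2)[OF I, of "\<lambda>i. val u (f i)"] that unfolding i_def by force
  define B where "B = is_subring hull ((\<lambda>j. f j / f i) ` {..N})"
  have B: "is_subring B" unfolding B_def by (rule is_subring_hull)
  have Bv: "B \<subseteq> val_ring u"
    unfolding B_def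
  proof (rule hull_minimal)
    have "f j / f i \<in> val_ring u" if j: "j \<le> N" for j
    proof (cases "f j = 0")
      case False
      then have "val u (f i) \<le> val u (f j)" using min[of j] j by simp
      then show ?thesis
        using i False by (simp add: val_ring_def divide_inverse val_mult val_inverse)
    qed (simp add: val_ring_def)
    then show "(\<lambda>j. f j / f i) ` {..N} \<subseteq> val_ring u" by blast
  qed (rule is_subring_val_ring)
  have "localize B (val_centre u B) \<in> spec_rings B"
    using prime_val_centre[OF B Bv] unfolding spec_rings_def by blast
  then have "localize B (val_centre u B) \<in> X" unfolding X B_def using i by blast
  then obtain \<sigma> where \<sigma>: "\<sigma> \<in> \<Sigma>" "localize B (val_centre u B) \<in> spec_rings (cone_ring \<sigma>)"
    by (rule point_cases)
  then have sub: "cone_ring \<sigma> \<subseteq> val_ring u"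
    using spec_cone_ring(2) localize_val_centre[OF Bv] by blast
  have "u \<in> \<sigma>"
  proof (rule lattice_bidual[OF cone[OF \<sigma>(1)]])
    fix m :: "'n \<Rightarrow>\<^sub>0 int" assume "lattice_vec m \<in> dual_cone \<sigma>"
    then have "character m \<in> val_ring u" using sub character_in_cone_ring by blast
    then show "0 \<le> lattice_vec m \<bullet> u" by (simp add: val_ring_def)
  qed
  then show ?thesis using \<sigma> that by blast
qed

lemma linear_on_cone: assumes "\<sigma> \<in> \<Sigma>" obtains m where "\<And>u. u \<in> \<sigma> \<Longrightarrow> \<psi> u = lattice_vec m \<bullet> u"
  using support assms unfolding support_function_def by blast

text \<open>The cone recovered from \<open>SOME\<close> need not be the one through which
  \<open>R\<close> is being studied, so comparisons of local equations go through
  \<open>unit_transition\<close>.\<close>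

lemma divisor_cases:
  assumes "R \<in> X"
  obtains \<sigma> m where "\<sigma> \<in> \<Sigma>" "R \<in> spec_rings (cone_ring \<sigma>)"
    "\<And>u. u \<in> \<sigma> \<Longrightarrow> \<psi> u = lattice_vec m \<bullet> u" "D R = character (- m)"
proof -
  let ?P = "\<lambda>m. \<exists>\<sigma>\<in>\<Sigma>. R \<in> spec_rings (cone_ring \<sigma>) \<and> (\<forall>u\<in>\<sigma>. \<psi> u = lattice_vec m \<bullet> u)"
  obtain \<sigma> where \<sigma>: "\<sigma> \<in> \<Sigma>" "R \<in> spec_rings (cone_ring \<sigma>)" using assms by (rule point_cases)
  obtain m where "\<And>u. u \<in> \<sigma> \<Longrightarrow> \<psi> u = lattice_vec m \<bullet> u" using linear_on_cone[OF \<sigma>(1)] by blast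
  then have "?P m" using \<sigma> by blast
  then have "?P (SOME m. ?P m)" by (rule someI)
  moreover have "D R = character (- (SOME m. ?P m))" by (simp add: toric_divisor_def)
  ultimately show ?thesis using that by blast
qed

lemma divisor_nonzero: "R \<in> X \<Longrightarrow> D R \<noteq> 0"
  by (elim divisor_cases) simp

text \<open>The linear forms of \<open>m\<close> and \<open>n\<close> both equal \<psi> on the
  common part of the cones, so \<open>character_in_local_ring\<close> applies to
  \<open>m - n\<close> and to its opposite.\<close>

lemma unit_transition:
  assumes "\<sigma> \<in> \<Sigma>" "R \<in> spec_rings (cone_ring \<sigma>)" "\<And>u. u \<in> \<sigma> \<Longrightarrow> \<psi> u = lattice_vec m \<bullet> u"
    and "\<tau> \<in> \<Sigma>" "cone_ring \<tau> \<subseteq> R" "\<And>u. u \<in> \<tau> \<Longrightarrow> \<psi> u = lattice_vec n \<bullet> u"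
  shows "character (m - n) \<in> R - max_ideal R"
proof -
  have z: "lattice_vec (m - n) \<bullet> u = 0" if "u \<in> \<sigma> \<inter> \<tau>" for u
    using assms(3)[of u] assms(6)[of u] that by (simp add: lattice_vec_diff inner_diff_left)
  have "character (m - n) \<in> R"
    by (rule character_in_local_ring[OF cone(1)[OF assms(1)] assms(2) cone[OF assms(4)] assms(5) z])
  moreover have "character (- (m - n)) \<in> R"
    by (rule character_in_local_ring[OF cone(1)[OF assms(1)] assms(2) cone[OF assms(4)] assms(5)])
      (use z in \<open>simp only: lattice_vec_uminus inner_minus_left neg_equal_0_iff_equal\<close>)
  ultimately show ?thesis unfolding unit_inverse character_uminus by simp
qed

text \<open>Here \<open>R'\<close> is a specialization of \<open>R\<close>, and an equation at
  \<open>R'\<close> must remain one at \<open>R\<close>. This compares a curve with its closed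
  points, and a rational point with its reductions.\<close>

lemma divisor_quotient_unit:
  assumes "R \<in> X" "R' \<in> X" "R' \<subseteq> R"
  shows "D R' / D R \<in> R - max_ideal R"
proof -
  obtain \<sigma> m where 1: "\<sigma> \<in> \<Sigma>" "R \<in> spec_rings (cone_ring \<sigma>)"
    "\<And>u. u \<in> \<sigma> \<Longrightarrow> \<psi> u = lattice_vec m \<bullet> u" "D R = character (- m)"
    using divisor_cases[OF assms(1)] by blast
  obtain \<tau> n where 2: "\<tau> \<in> \<Sigma>" "R' \<in> spec_rings (cone_ring \<tau>)"
    "\<And>u. u \<in> \<tau> \<Longrightarrow> \<psi> u = lattice_vec n \<bullet> u" "D R' = character (- n)"
    using divisor_cases[OF assms(2)] by blast
  have "cone_ring \<tau> \<subseteq> R" using spec_cone_ring(2)[OF 2(2)] assms(3) by blast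
  from unit_transition[OF 1(1-3) 2(1) this 2(3)]
  show ?thesis by (simp add: character_diff character_uminus 1(4) 2(4) divide_inverse mult.commute)
qed

lemma character_section:
  assumes R: "R \<in> X" and m: "\<And>u. real l * \<psi> u \<le> lattice_vec m \<bullet> u"
  shows "character m * D R ^ l \<in> R"
proof -
  obtain \<sigma> n where 1: "\<sigma> \<in> \<Sigma>" "R \<in> spec_rings (cone_ring \<sigma>)"
    "\<And>u. u \<in> \<sigma> \<Longrightarrow> \<psi> u = lattice_vec n \<bullet> u" "D R = character (- n)"
    using divisor_cases[OF R] by blast
  have "character m * D R ^ l = character (m - nmul l n)"
    unfolding 1(4) by (simp add: character_diff character_nmul character_uminus power_inverse divide_inverse)
  moreover have "lattice_vec (m - nmul l n) \<in> dual_cone \<sigma>"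
    unfolding dual_cone_def lattice_vec_diff lattice_vec_nmul
  proof safe
    fix u assume "u \<in> \<sigma>"
    then show "0 \<le> (lattice_vec m - real l *\<^sub>R lattice_vec n) \<bullet> u"
      using m[of u] 1(3)[of u] by (simp add: inner_diff_left)
  qed
  ultimately show ?thesis using spec_cone_ring(2)[OF 1(2)] character_in_cone_ring by auto
qed

text \<open>At each point of the chart the chosen equation differs from
  \<open>character (- n)\<close> by a unit, so the product is regular everywhere on the chart and
  \<open>Inter_localize\<close> applies.\<close>

lemma sections_on_cone:
  assumes s: "s \<in> sections X (\<lambda>R. D R ^ l)" and \<tau>: "\<tau> \<in> \<Sigma>"
    and n: "\<And>u. u \<in> \<tau> \<Longrightarrow> \<psi> u = lattice_vec n \<bullet> u"
  shows "s * character (- nmul l n) \<in> cone_ring \<tau>"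
proof (rule Inter_localize[OF is_subring_cone_ring])
  fix p assume p: "is_prime_ideal (cone_ring \<tau>) p"
  define R where "R = localize (cone_ring \<tau>) p"
  have R\<tau>: "R \<in> spec_rings (cone_ring \<tau>)" using p unfolding R_def spec_rings_def by blast
  then have R: "R \<in> X" using \<tau> unfolding toric_scheme_def by blast
  obtain \<sigma> m where 1: "\<sigma> \<in> \<Sigma>" "R \<in> spec_rings (cone_ring \<sigma>)"
    "\<And>u. u \<in> \<sigma> \<Longrightarrow> \<psi> u = lattice_vec m \<bullet> u" "D R = character (- m)"
    using divisor_cases[OF R] by blast
  have "character (m - n) \<in> R"
    using unit_transition[OF 1(1-3) \<tau> spec_cone_ring(2)[OF R\<tau>] n] by blast
  then have "(s * D R ^ l) * character (m - n) ^ l \<in> R"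
    using s R subring_mult[OF point_subring[OF R]] subring_power[OF point_subring[OF R]]
    unfolding sections_def by blast
  also have "(s * D R ^ l) * character (m - n) ^ l = s * character (- nmul l n)"
    unfolding 1(4) by (simp add: character_diff character_nmul character_uminus field_simps)
  finally show "s * character (- nmul l n) \<in> localize (cone_ring \<tau>) p" unfolding R_def .
qed

text \<open>Each \<open>u\<close> lies in some cone, whose chart yields the inequality at
  \<open>u\<close>. The polynomial obtained depends a priori on \<open>u\<close>, but it is
  determined by \<open>s\<close>, so one \<open>q\<close> serves for all \<open>u\<close>.\<close>

lemma sections_cases:
  assumes s: "s \<in> sections X (\<lambda>R. D R ^ l)"
  obtains q where "s = Fract q 1" "\<And>k u. k \<in> Poly_Mapping.keys q \<Longrightarrow> real l * \<psi> u \<le> lattice_vec k \<bullet> u"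
proof -
  have *: "\<exists>q. s = Fract q 1 \<and> (\<forall>k\<in>Poly_Mapping.keys q. real l * \<psi> u \<le> lattice_vec k \<bullet> u)" for u
  proof -
    obtain \<sigma> where \<sigma>: "\<sigma> \<in> \<Sigma>" "u \<in> \<sigma>" by (rule fan_complete)
    obtain n where n: "\<And>u. u \<in> \<sigma> \<Longrightarrow> \<psi> u = lattice_vec n \<bullet> u" using linear_on_cone[OF \<sigma>(1)] by blast
    obtain q where q: "s * character (- nmul l n) = Fract q 1"
      "\<forall>m\<in>Poly_Mapping.keys q. lattice_vec m \<in> dual_cone \<sigma>"
      using sections_on_cone[OF s \<sigma>(1) n] unfolding cone_ring_def by blast
    have "s = character (nmul l n) * (s * character (- nmul l n))" by (simp add: character_uminus)
    also have "\<dots> = Fract (Poly_Mapping.single (nmul l n) 1 * q) 1" unfolding q(1) character_mult_Fract ..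
    finally have "s = Fract (Poly_Mapping.single (nmul l n) 1 * q) 1" .
    moreover have "real l * \<psi> u \<le> lattice_vec k \<bullet> u"
      if k: "k \<in> Poly_Mapping.keys (Poly_Mapping.single (nmul l n) 1 * q)" for k
    proof -
      obtain a j where "k = a + j" "a \<in> Poly_Mapping.keys (Poly_Mapping.single (nmul l n) (1::int))"
        "j \<in> Poly_Mapping.keys q" using k by (rule keys_multE)
      then have "k = nmul l n + j" "j \<in> Poly_Mapping.keys q" by simp_all
      then show ?thesis
        using q(2) \<sigma>(2) n[OF \<sigma>(2)] unfolding dual_cone_def
        by (auto simp: lattice_vec_add lattice_vec_nmul inner_add_left)
    qed
    ultimately show ?thesis by blast
  qed
  obtain q where q: "s = Fract q 1" using * by blast
  have "real l * \<psi> u \<le> lattice_vec k \<bullet> u" if "k \<in> Poly_Mapping.keys q" for k u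
    using *[of u] that q by (auto simp: Fract_1_inject)
  then show ?thesis using that q by blast
qed

text \<open>Global generation at the generic point of the closed orbit of \<open>\<sigma>\<close>, where no character with
  nonzero restriction to \<open>\<sigma>\<close> is invertible.\<close>

lemma exists_vertex:
  assumes \<sigma>: "\<sigma> \<in> \<Sigma>"
  obtains m where "m \<in> lattice_points" "\<And>u. u \<in> \<sigma> \<Longrightarrow> \<psi> u = lattice_vec m \<bullet> u"
proof -
  obtain S where S: "finite S" and \<sigma>S: "\<sigma> = convex_cone hull S"
    using cone(1)[OF \<sigma>] unfolding rational_cone_def by blast
  obtain n where n: "\<And>u. u \<in> \<sigma> \<Longrightarrow> \<psi> u = lattice_vec n \<bullet> u" using linear_on_cone[OF \<sigma>] by blast
  \<comment> \<open>The sum of the generators is an interior point of the cone: an element of the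
    dual cone vanishing at \<open>u0\<close> vanishes on all of \<sigma>.\<close>
  define u0 where "u0 = (\<Sum>v\<in>S. v)"
  have "sum (\<lambda>v. v) J \<in> \<sigma>" if "J \<subseteq> S" for J
    using that unfolding \<sigma>S
    by (induction J rule: infinite_finite_induct)
      (auto intro: convex_cone_hull_contains_0 convex_cone_hull_add hull_inc)
  then have u0: "u0 \<in> \<sigma>" unfolding u0_def by blast
  let ?A = "cone_ring \<sigma>"
  define p where "p = val_centre u0 ?A"
  have p: "is_prime_ideal ?A p"
    unfolding p_def by (rule prime_val_centre[OF is_subring_cone_ring cone_ring_subset_val_ring[OF u0]])
  define R where "R = localize ?A p"
  have R\<sigma>: "R \<in> spec_rings ?A" using p unfolding R_def spec_rings_def by blast
  then have R: "R \<in> X" using \<sigma> unfolding toric_scheme_def by blast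
  obtain s where s: "s \<in> sections X D" "s * D R \<in> R - max_ideal R"
    using generated R unfolding globally_generated_def by blast
  have s1: "s \<in> sections X (\<lambda>R. D R ^ 1)" using s by simp
  obtain \<tau> m where 1: "\<tau> \<in> \<Sigma>" "R \<in> spec_rings (cone_ring \<tau>)"
    "\<And>u. u \<in> \<tau> \<Longrightarrow> \<psi> u = lattice_vec m \<bullet> u" "D R = character (- m)"
    using divisor_cases[OF R] by blast
  have "character (m - n) \<in> R - max_ideal R"
    by (rule unit_transition[OF 1(1-3) \<sigma> spec_cone_ring(2)[OF R\<sigma>] n])
  then have "(s * D R) * character (m - n) \<in> R - max_ideal R"
    using unit_mult[OF point_subring[OF R] s(2)] by blast
  also have "(s * D R) * character (m - n) = s * character (- nmul 1 n)"
    unfolding 1(4) by (simp add: character_diff character_uminus field_simps)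
  finally have unit: "s * character (- nmul 1 n) \<in> R - max_ideal R" .
  have inA: "s * character (- nmul 1 n) \<in> ?A" by (rule sections_on_cone[OF s1 \<sigma> n])
  have notp: "s * character (- nmul 1 n) \<notin> p"
    using localize_unit_iff[OF is_subring_cone_ring p inA] unit unfolding R_def by blast
  obtain q where q: "s = Fract q 1" "\<And>k u. k \<in> Poly_Mapping.keys q \<Longrightarrow> real 1 * \<psi> u \<le> lattice_vec k \<bullet> u"
    using sections_cases[OF s1] by blast
  define q' where "q' = Poly_Mapping.single (- n) 1 * q"
  have q': "s * character (- nmul 1 n) = Fract q' 1"
    unfolding q(1) q'_def using character_mult_Fract[of "- n" q] by (simp add: mult.commute)
  have "Fract q' 1 \<noteq> 0" using unit_nonzero[OF unit] unfolding q' .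
  then have "q' \<noteq> 0" by (simp add: Fract_nonzero)
  \<comment> \<open>The local expression of \<open>s\<close> is a unit, so its value at
    \<open>u0\<close> is not positive. A monomial \<open>k\<close> of least weight is nonnegative on
    every generator and hence zero on \<sigma>; translated back by \<open>n\<close> it becomes the
    required vertex \<open>j\<close>.\<close>
  then obtain k where k: "k \<in> Poly_Mapping.keys q'" "minpair u0 q' = lattice_vec k \<bullet> u0"
    by (rule minpair_attained)
  have "val u0 (Fract q' 1) \<le> 0"
    using notp inA unit_nonzero[OF unit] unfolding q' p_def val_centre_def by auto
  then have k0: "lattice_vec k \<bullet> u0 \<le> 0"
    using \<open>q' \<noteq> 0\<close> k(2) by (simp add: val_Fract minpair_def[of _ 1])
  have kd: "lattice_vec k \<in> dual_cone \<sigma>"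
    using inA k(1) unfolding q' cone_ring_def by (auto simp: Fract_1_inject)
  have kS: "0 \<le> lattice_vec k \<bullet> v" if "v \<in> S" for v
    using kd that unfolding \<sigma>S dual_cone_hull by blast
  have "(\<Sum>v\<in>S. lattice_vec k \<bullet> v) = 0"
    using k0 sum_nonneg[of S "\<lambda>v. lattice_vec k \<bullet> v"] kS unfolding u0_def inner_sum_right by force
  then have "\<forall>v\<in>S. lattice_vec k \<bullet> v = 0" using sum_nonneg_eq_0_iff[OF S] kS by blast
  then have "- lattice_vec k \<in> dual_cone \<sigma>" unfolding \<sigma>S dual_cone_hull by simp
  then have kz: "lattice_vec k \<bullet> u = 0" if "u \<in> \<sigma>" for u
    using kd that unfolding dual_cone_def by fastforce
  obtain a j where "k = a + j" "a \<in> Poly_Mapping.keys (Poly_Mapping.single (- n) (1::int))"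
    "j \<in> Poly_Mapping.keys q" using k(1) unfolding q'_def by (rule keys_multE)
  then have j: "k = - n + j" "j \<in> Poly_Mapping.keys q" by simp_all
  show ?thesis
  proof (rule that[of j])
    show "j \<in> lattice_points" using q(2)[OF j(2)] by (simp add: polytope_of_def)
    show "\<psi> u = lattice_vec j \<bullet> u" if "u \<in> \<sigma>" for u
      using kz[OF that] n[OF that] j(1) by (simp add: lattice_vec_diff inner_diff_left)
  qed
qed

text \<open>So \<psi> is the minimum of the linear forms given by the lattice points of its
  polytope, which is what the separation argument for the convex hull needs.\<close>

lemma exists_minimizer:
  obtains m where "m \<in> lattice_points" "\<psi> u = lattice_vec m \<bullet> u"
proof -
  obtain \<sigma> where \<sigma>: "\<sigma> \<in> \<Sigma>" "u \<in> \<sigma>" by (rule fan_complete)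
  show ?thesis using exists_vertex[OF \<sigma>(1)] \<sigma>(2) that by metis
qed

lemma exists_generator:
  assumes "R \<in> X"
  obtains m where "m \<in> lattice_points" "character m * D R \<in> R - max_ideal R"
proof -
  obtain \<sigma> n where 1: "\<sigma> \<in> \<Sigma>" "R \<in> spec_rings (cone_ring \<sigma>)"
    "\<And>u. u \<in> \<sigma> \<Longrightarrow> \<psi> u = lattice_vec n \<bullet> u" "D R = character (- n)"
    using divisor_cases[OF assms] by blast
  obtain m where m: "m \<in> lattice_points" "\<And>u. u \<in> \<sigma> \<Longrightarrow> \<psi> u = lattice_vec m \<bullet> u"
    using exists_vertex[OF 1(1)] by blast
  have "character (m - n) \<in> R - max_ideal R"
    by (rule unit_transition[OF 1(1,2) m(2) 1(1) spec_cone_ring(2)[OF 1(2)] 1(3)])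
  then have "character m * D R \<in> R - max_ideal R"
    unfolding 1(4) by (simp add: character_diff character_uminus divide_inverse)
  then show ?thesis using that m by blast
qed

text \<open>Testing against the coordinate vectors and their opposites bounds every coordinate on
  both sides.\<close>

lemma finite_lattice_points: "finite lattice_points"
proof -
  let ?a = "\<lambda>i. \<lfloor>\<psi> (axis i 1)\<rfloor>" and ?b = "\<lambda>i. \<lceil>- \<psi> (- axis i 1)\<rceil>"
  have "Poly_Mapping.lookup ` lattice_points \<subseteq> PiE UNIV (\<lambda>i. {?a i..?b i})"
  proof safe
    fix m :: "'n \<Rightarrow>\<^sub>0 int" and i assume m: "lattice_vec m \<in> polytope_of \<psi>"
    have "\<psi> (axis i 1) \<le> real_of_int (Poly_Mapping.lookup m i)"
      "\<psi> (- axis i 1) \<le> - real_of_int (Poly_Mapping.lookup m i)"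
      using m unfolding polytope_of_def by (auto simp: inner_axis dest: spec[of _ "axis i 1"] spec[of _ "- axis i 1"])
    then show "Poly_Mapping.lookup m i \<in> {?a i..?b i}"
      by (simp add: floor_le_iff le_ceiling_iff)
  qed simp
  then have "finite (Poly_Mapping.lookup ` lattice_points)"
    by (rule finite_subset) (intro finite_PiE; simp)
  moreover have "inj_on Poly_Mapping.lookup lattice_points"
    by (rule inj_onI) (rule poly_mapping_eq_iff[THEN iffD2])
  ultimately show ?thesis by (rule finite_imageD)
qed

lemma lattice_points_nonempty: "lattice_points \<noteq> {}"
  using exists_minimizer[of 0 "lattice_points \<noteq> {}"] by blast

end

section \<open>Complex points of the torus\<close>

text \<open>Negative exponents occur, so this is multiplicative in \<open>m\<close> only if no
  coordinate of \<open>z\<close> vanishes; hence the recurring hypothesis on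
  \<open>z\<close>.\<close>

definition mon :: "('n::{finite,linorder} \<Rightarrow> complex) \<Rightarrow> ('n \<Rightarrow>\<^sub>0 int) \<Rightarrow> complex" where
  "mon z m = (\<Prod>i\<in>UNIV. z i powi Poly_Mapping.lookup m i)"

definition laurent_eval :: "('n::{finite,linorder} \<Rightarrow> complex) \<Rightarrow> (('n \<Rightarrow>\<^sub>0 int) \<Rightarrow>\<^sub>0 int) \<Rightarrow> complex" where
  "laurent_eval z p = (\<Sum>m\<in>Poly_Mapping.keys p. of_int (Poly_Mapping.lookup p m) * mon z m)"

lemma mon_zero [simp]: "mon z 0 = 1"
  by (simp add: mon_def)

lemma mon_add: "\<forall>i. z i \<noteq> 0 \<Longrightarrow> mon z (m + n) = mon z m * mon z n"
  by (simp add: mon_def lookup_add power_int_add prod.distrib)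

lemma mon_diff: "\<forall>i. z i \<noteq> 0 \<Longrightarrow> mon z (m - n) = mon z m * mon z (- n)"
  using mon_add[of z m "- n"] by simp

lemma laurent_eval_superset:
  assumes "finite S" "Poly_Mapping.keys p \<subseteq> S"
  shows "laurent_eval z p = (\<Sum>m\<in>S. of_int (Poly_Mapping.lookup p m) * mon z m)"
  unfolding laurent_eval_def by (rule sum.mono_neutral_left) (use assms in \<open>auto simp: in_keys_iff\<close>)

lemma laurent_eval_diff: "laurent_eval z (p - q) = laurent_eval z p - laurent_eval z q"
proof -
  let ?S = "Poly_Mapping.keys p \<union> Poly_Mapping.keys q"
  have "Poly_Mapping.keys (p - q) \<subseteq> ?S" by (rule keys_diff)
  then show ?thesis
    by (subst (1 2 3) laurent_eval_superset[of ?S])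
      (auto simp: lookup_minus left_diff_distrib sum_subtractf)
qed

lemma laurent_eval_zero [simp]: "laurent_eval z 0 = 0"
  by (simp add: laurent_eval_def)

lemma laurent_eval_add: "laurent_eval z (p + q) = laurent_eval z p + laurent_eval z q"
  using laurent_eval_diff[of z p "0 - q"] laurent_eval_diff[of z 0 q] by simp

lemma laurent_eval_single [simp]: "laurent_eval z (Poly_Mapping.single m 1) = mon z m"
  by (simp add: laurent_eval_def)

lemma laurent_eval_one [simp]: "laurent_eval z 1 = 1"
  by (simp add: laurent_eval_def)

lemma laurent_eval_mult:
  assumes z: "\<forall>i. z i \<noteq> 0"
  shows "laurent_eval z (p * q) = laurent_eval z p * laurent_eval z q"
proof (induction p rule: frag_induction[OF subset_UNIV])
  case (2 m)
  show ?case
  proof (induction q rule: frag_induction[OF subset_UNIV])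
    case (2 n)
    then show ?case by (simp add: mult_single mon_add[OF z])
  next
    case (3 a b)
    then show ?case by (simp only: right_diff_distrib laurent_eval_diff)
  qed simp
next
  case (3 a b)
  then show ?case by (simp only: left_diff_distrib laurent_eval_diff)
qed simp

text \<open>For \<open>z\<close> in the torus, the local ring of the integral torus at the image of
  the complex point \<open>z\<close>.\<close>

definition torus_local_ring :: "('n::{finite,linorder} \<Rightarrow> complex) \<Rightarrow> 'n ratfun set" where
  "torus_local_ring z = {Fract a b | a b. laurent_eval z b \<noteq> 0}"

definition torus_eval :: "('n::{finite,linorder} \<Rightarrow> complex) \<Rightarrow> 'n ratfun \<Rightarrow> complex" where
  "torus_eval z r = (THE w. \<exists>a b. r = Fract a b \<and> laurent_eval z b \<noteq> 0 \<and> w = laurent_eval z a / laurent_eval z b)"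

lemma torus_eval_Fract:
  assumes z: "\<forall>i. z i \<noteq> 0" and b: "laurent_eval z b \<noteq> 0"
  shows "torus_eval z (Fract a b) = laurent_eval z a / laurent_eval z b"
  unfolding torus_eval_def
proof (rule the_equality)
  fix w assume "\<exists>a' b'. Fract a b = Fract a' b' \<and> laurent_eval z b' \<noteq> 0 \<and> w = laurent_eval z a' / laurent_eval z b'"
  then obtain a' b' where *: "Fract a b = Fract a' b'" "laurent_eval z b' \<noteq> 0" "w = laurent_eval z a' / laurent_eval z b'"
    by blast
  have "b \<noteq> 0" "b' \<noteq> 0" using b * by auto
  then have "a * b' = a' * b" using * by (simp add: eq_fract)
  then have "laurent_eval z a * laurent_eval z b' = laurent_eval z a' * laurent_eval z b"
    by (simp only: laurent_eval_mult[OF z, symmetric])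
  then show "w = laurent_eval z a / laurent_eval z b"
    unfolding *(3) using *(2) b by (simp only: frac_eq_eq simp_thms)
qed (use b in blast)

lemma torus_local_ringE:
  assumes "r \<in> torus_local_ring z"
  obtains a b where "r = Fract a b" "laurent_eval z b \<noteq> 0" "b \<noteq> 0"
proof -
  obtain a b where "r = Fract a b" "laurent_eval z b \<noteq> 0"
    using assms unfolding torus_local_ring_def by blast
  moreover from this have "b \<noteq> 0" by auto
  ultimately show ?thesis by (rule that)
qed

lemma torus_eval_hom:
  assumes z: "\<forall>i. z i \<noteq> 0" and r: "r \<in> torus_local_ring z" and s: "s \<in> torus_local_ring z"
  shows "torus_eval z (r + s) = torus_eval z r + torus_eval z s"
    and "torus_eval z (r * s) = torus_eval z r * torus_eval z s"
    and "r * s \<in> torus_local_ring z"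
proof -
  obtain a b where r: "r = Fract a b" "laurent_eval z b \<noteq> 0" "b \<noteq> 0" using r by (rule torus_local_ringE)
  obtain c d where s: "s = Fract c d" "laurent_eval z d \<noteq> 0" "d \<noteq> 0" using s by (rule torus_local_ringE)
  have bd: "laurent_eval z (b * d) \<noteq> 0" using r s by (simp add: laurent_eval_mult[OF z])
  have rs: "r + s = Fract (a * d + c * b) (b * d)" "r * s = Fract (a * c) (b * d)"
    using r s by simp_all
  show "torus_eval z (r + s) = torus_eval z r + torus_eval z s"
    unfolding rs torus_eval_Fract[OF z bd] unfolding r(1) s(1) torus_eval_Fract[OF z r(2)] torus_eval_Fract[OF z s(2)]
    using r(2) s(2) by (simp add: laurent_eval_mult[OF z] laurent_eval_add field_simps)
  show "torus_eval z (r * s) = torus_eval z r * torus_eval z s"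
    unfolding rs torus_eval_Fract[OF z bd] unfolding r(1) s(1) torus_eval_Fract[OF z r(2)] torus_eval_Fract[OF z s(2)]
    by (simp add: laurent_eval_mult[OF z])
  show "r * s \<in> torus_local_ring z" unfolding torus_local_ring_def using rs bd by blast
qed

lemma Fract_in_torus_local_ring: "Fract p 1 \<in> torus_local_ring z"
  unfolding torus_local_ring_def by (intro CollectI exI[of _ p] exI[of _ 1]) simp

lemma torus_eval_laurent: "\<forall>i. z i \<noteq> 0 \<Longrightarrow> torus_eval z (Fract p 1) = laurent_eval z p"
  by (simp add: torus_eval_Fract)

lemma torus_eval_character: "\<forall>i. z i \<noteq> 0 \<Longrightarrow> torus_eval z (character m) = mon z m"
  by (simp add: character_def torus_eval_laurent)

lemma torus_eval_power:
  assumes "\<forall>i. z i \<noteq> 0" "r \<in> torus_local_ring z"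
  shows "torus_eval z (r ^ k) = torus_eval z r ^ k \<and> r ^ k \<in> torus_local_ring z"
proof (induction k)
  case 0
  show ?case using torus_eval_laurent[of z 1] Fract_in_torus_local_ring[of 1 z] assms(1)
    by (simp add: One_fract_def)
next
  case (Suc k)
  then show ?case using torus_eval_hom[OF assms] by simp
qed

text \<open>The prime ideal is the kernel of evaluation at \<open>z\<close> on the ring of the
  chart, so elements outside it have nonzero values and evaluation extends to the
  localization.\<close>

lemma torus_point:
  fixes z :: "'n::{finite,linorder} \<Rightarrow> complex" and \<sigma> :: "(real^'n::{finite,linorder}) set"
  assumes z: "\<forall>i. z i \<noteq> 0"
  obtains R where "R \<in> spec_rings (cone_ring \<sigma>)" "R \<subseteq> torus_local_ring z"
    "ring_hom_on R (torus_eval z)" "\<forall>r\<in>R. torus_eval z r = 0 \<longleftrightarrow> r \<in> max_ideal R"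
proof -
  let ?A = "cone_ring \<sigma>"
  have A: "is_subring ?A" by (rule is_subring_cone_ring)
  have AT: "?A \<subseteq> torus_local_ring z" unfolding cone_ring_def using Fract_in_torus_local_ring by blast
  define p where "p = {a \<in> ?A. torus_eval z a = 0}"
  have one: "torus_eval z 1 = 1" using torus_eval_character[OF z, of 0] by simp
  have zero: "torus_eval z 0 = 0" using torus_eval_laurent[OF z, of 0] by (simp add: Zero_fract_def)
  have p: "is_prime_ideal ?A p"
    unfolding is_prime_ideal_def is_ideal_def p_def
    using subring_zero[OF A] subring_add[OF A] subring_mult[OF A] AT torus_eval_hom[OF z] one zero
    by (auto simp: subset_iff)
  have nz: "laurent_eval z c \<noteq> 0" if "Fract c 1 \<in> ?A" "Fract c 1 \<notin> p" for c
    using that torus_eval_laurent[OF z] unfolding p_def by auto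
  have RT: "localize ?A p \<subseteq> torus_local_ring z"
    and ev: "\<And>a b. a \<in> ?A \<Longrightarrow> b \<in> ?A \<Longrightarrow> b \<notin> p \<Longrightarrow> torus_eval z (a / b) = torus_eval z a / torus_eval z b"
  proof -
    have *: "a / b \<in> torus_local_ring z \<and> torus_eval z (a / b) = torus_eval z a / torus_eval z b"
      if ab: "a \<in> ?A" "b \<in> ?A" "b \<notin> p" for a b
    proof -
      obtain c d where cd: "a = Fract c 1" "b = Fract d 1" using ab unfolding cone_ring_def by blast
      have d: "laurent_eval z d \<noteq> 0" using nz ab cd by blast
      have "a / b = Fract c d" using cd by simp
      then show ?thesis
        using d cd torus_eval_Fract[OF z d] torus_eval_laurent[OF z] unfolding torus_local_ring_def by auto
    qed
    show "localize ?A p \<subseteq> torus_local_ring z" unfolding localize_def using * by blast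
    show "\<And>a b. a \<in> ?A \<Longrightarrow> b \<in> ?A \<Longrightarrow> b \<notin> p \<Longrightarrow> torus_eval z (a / b) = torus_eval z a / torus_eval z b"
      using * by blast
  qed
  show ?thesis
  proof (rule that[of "localize ?A p"])
    show "localize ?A p \<in> spec_rings ?A" using p unfolding spec_rings_def by blast
    show "localize ?A p \<subseteq> torus_local_ring z" by (rule RT)
    show "ring_hom_on (localize ?A p) (torus_eval z)"
      unfolding ring_hom_on_def using one RT torus_eval_hom[OF z] by (simp add: subset_iff)
    show "\<forall>r\<in>localize ?A p. torus_eval z r = 0 \<longleftrightarrow> r \<in> max_ideal (localize ?A p)"
    proof
      fix r assume "r \<in> localize ?A p"
      then obtain a b where ab: "r = a / b" "a \<in> ?A" "b \<in> ?A" "b \<notin> p" by (rule localizeE)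
      then have "torus_eval z r = 0 \<longleftrightarrow> a \<in> p" using ev[OF ab(2-4)] unfolding p_def by simp
      then show "torus_eval z r = 0 \<longleftrightarrow> r \<in> max_ideal (localize ?A p)"
        using max_ideal_localize[OF A p ab(2-4)] ab(1) by simp
    qed
  qed
qed

text \<open>The mean of \<open>\<bar>p\<bar>\<^sup>2\<close> over the points of order dividing a large integer is the sum of the squares of the
  coefficients.\<close>

lemma laurent_eval_square_ge:
  fixes q :: "('n::{finite,linorder} \<Rightarrow>\<^sub>0 int) \<Rightarrow>\<^sub>0 int"
  obtains z where "\<forall>i. cmod (z i) = 1"
    "(\<Sum>m\<in>Poly_Mapping.keys q. (of_int (Poly_Mapping.lookup q m))\<^sup>2) \<le> (cmod (laurent_eval z q))\<^sup>2"
proof -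
  let ?K = "Poly_Mapping.keys q" and ?c = "\<lambda>m. Poly_Mapping.lookup q m"
  define B where "B = (\<Sum>m\<in>?K. \<Sum>i\<in>UNIV. \<bar>Poly_Mapping.lookup m i\<bar>)"
  have entry: "\<bar>Poly_Mapping.lookup m i\<bar> \<le> B" if "m \<in> ?K" for m i
  proof -
    have "\<bar>Poly_Mapping.lookup m i\<bar> \<le> (\<Sum>i\<in>UNIV. \<bar>Poly_Mapping.lookup m i\<bar>)"
      by (rule member_le_sum) auto
    also have "\<dots> \<le> B"
      unfolding B_def
      by (rule member_le_sum[where f = "\<lambda>m. \<Sum>i\<in>UNIV. \<bar>Poly_Mapping.lookup m i\<bar>"]) (use that in \<open>auto intro: sum_nonneg\<close>)
    finally show ?thesis .
  qed
  \<comment> \<open>Coordinates of two exponents differ by at most \<open>2 * B\<close>, so distinct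
    exponents remain distinct modulo \<open>N\<close>.\<close>
  define N where "N = nat (2 * B + 1)"
  have B0: "0 \<le> B" unfolding B_def by (intro sum_nonneg) auto
  have N: "0 < N" "int N = 2 * B + 1" using B0 unfolding N_def by auto
  define z where "z g i = cis (2 * pi * real (g i) / real N)" for g :: "'n \<Rightarrow> nat" and i
  have znz: "\<forall>i. z g i \<noteq> 0" for g unfolding z_def by simp
  have cnj_mon: "cnj (mon (z g) m) = mon (z g) (- m)" for g m
    unfolding mon_def z_def by (simp add: cis_power_int cis_cnj)
  define G where "G = PiE (UNIV :: 'n set) (\<lambda>_. {..<N})"
  have G: "finite G" "card G = N ^ CARD('n)"
    unfolding G_def by (auto simp: finite_PiE card_PiE)
  have orth: "(\<Sum>g\<in>G. mon (z g) (m - m')) = (if m = m' then of_nat (card G) else 0)"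
    if m: "m \<in> ?K" "m' \<in> ?K" for m m'
  proof (cases "m = m'")
    case False
    then obtain i where i: "Poly_Mapping.lookup m i \<noteq> Poly_Mapping.lookup m' i"
      using poly_mapping_eqI[of m m'] by blast
    define d where "d = Poly_Mapping.lookup (m - m') i"
    have d: "d \<noteq> 0" "\<bar>d\<bar> < int N"
      using i entry[OF m(1), of i] entry[OF m(2), of i] N(2) unfolding d_def lookup_minus by linarith+
    \<comment> \<open>Since \<open>d\<close> is nonzero and smaller than \<open>N\<close> in
      absolute value, \<open>w\<close> is an \<open>N\<close>-th root of unity other than 1. Its
      geometric sum vanishes and kills the whole product over the coordinates.\<close>
    define w where "w = cis (2 * pi * of_int d / real N)"
    have w1: "w \<noteq> 1"
    proof
      assume "w = 1"
      then obtain n :: int where "2 * pi * of_int d / real N = of_int (2 * n) * pi"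
        unfolding w_def cis_conv_exp exp_eq_1 by auto
      then have "real_of_int d = of_int (n * int N)" using N(1) by (simp add: field_simps)
      then have dn: "d = n * int N" by linarith
      then have "n \<noteq> 0" using d by auto
      then have "1 * int N \<le> \<bar>n\<bar> * int N" by (intro mult_right_mono) linarith+
      then show False using d dn by (simp add: abs_mult)
    qed
    have "w ^ N = 1"
      unfolding w_def Complex.DeMoivre using N(1) by simp
    then have geo: "(\<Sum>k<N. w ^ k) = 0" using w1 by (simp add: geometric_sum)
    have "(\<Sum>g\<in>G. mon (z g) (m - m')) =
        (\<Prod>j\<in>UNIV. \<Sum>k\<in>{..<N}. cis (2 * pi * real k / real N) powi Poly_Mapping.lookup (m - m') j)"
      unfolding G_def mon_def z_def by (rule prod_sum_PiE[symmetric]) auto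
    also have "(\<Sum>k\<in>{..<N}. cis (2 * pi * real k / real N) powi Poly_Mapping.lookup (m - m') i) = (\<Sum>k<N. w ^ k)"
      unfolding w_def d_def Complex.DeMoivre cis_power_int by (intro sum.cong arg_cong[of _ _ cis]) auto
    then have "(\<Prod>j\<in>UNIV. \<Sum>k\<in>{..<N}. cis (2 * pi * real k / real N) powi Poly_Mapping.lookup (m - m') j) = 0"
      using geo by (intro prod_zero bexI[of _ i]) auto
    finally show ?thesis using False by simp
  qed (simp add: mon_def)
  have "complex_of_real (\<Sum>g\<in>G. (cmod (laurent_eval (z g) q))\<^sup>2) =
      (\<Sum>g\<in>G. laurent_eval (z g) q * cnj (laurent_eval (z g) q))"
    unfolding of_real_sum by (intro sum.cong refl) (rule complex_norm_square)
  also have "\<dots> = (\<Sum>g\<in>G. \<Sum>m\<in>?K. \<Sum>m'\<in>?K. of_int (?c m * ?c m') * mon (z g) (m - m'))"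
    unfolding laurent_eval_def cnj_sum sum_product complex_cnj_mult cnj_mon complex_cnj_of_int
    by (intro sum.cong refl) (simp add: mon_diff[OF znz] mult_ac)
  also have "\<dots> = (\<Sum>m\<in>?K. \<Sum>m'\<in>?K. of_int (?c m * ?c m') * (\<Sum>g\<in>G. mon (z g) (m - m')))"
    unfolding sum_distrib_left by (subst sum.swap) (rule sum.cong[OF refl], rule sum.swap)
  also have "\<dots> = (\<Sum>m\<in>?K. \<Sum>m'\<in>?K. if m = m' then of_int (?c m * ?c m') * of_nat (card G) else 0)"
    by (intro sum.cong refl) (simp add: orth)
  also have "\<dots> = (\<Sum>m\<in>?K. of_int ((?c m)\<^sup>2) * of_nat (card G))"
    by (intro sum.cong refl) (simp add: power2_eq_square)
  also have "\<dots> = complex_of_real (real (card G) * (\<Sum>m\<in>?K. (of_int (?c m))\<^sup>2))"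
    by (simp add: sum_distrib_left mult.commute)
  finally have tot: "(\<Sum>g\<in>G. (cmod (laurent_eval (z g) q))\<^sup>2) = real (card G) * (\<Sum>m\<in>?K. (of_int (?c m))\<^sup>2)"
    by (rule of_real_eq_iff[THEN iffD1])
  have "\<exists>g\<in>G. (\<Sum>m\<in>?K. (of_int (?c m))\<^sup>2) \<le> (cmod (laurent_eval (z g) q))\<^sup>2"
  proof (rule ccontr)
    assume "\<not> ?thesis"
    then have "(\<Sum>g\<in>G. (cmod (laurent_eval (z g) q))\<^sup>2) < (\<Sum>g\<in>G. \<Sum>m\<in>?K. (of_int (?c m))\<^sup>2)"
      using G N(1) by (intro sum_strict_mono) (auto simp: not_le card_gt_0_iff[symmetric])
    then show False using tot by simp
  qed
  then obtain g where "(\<Sum>m\<in>?K. (of_int (?c m))\<^sup>2) \<le> (cmod (laurent_eval (z g) q))\<^sup>2" by blast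
  moreover have "\<forall>i. cmod (z g i) = 1" unfolding z_def by simp
  ultimately show ?thesis using that by blast
qed

section \<open>Small sections\<close>

context projective_toric
begin

abbreviation "Dbar \<equiv> canonical_metrized_divisor \<Sigma> \<psi>"

definition coord_max :: "'n ratfun cpoint \<Rightarrow> real" where
  "coord_max x = Max ((\<lambda>m. cmod (snd x (character m * D (fst x)))) ` lattice_points)"

lemma coord_max_ge: "m \<in> lattice_points \<Longrightarrow> cmod (snd x (character m * D (fst x))) \<le> coord_max x"
  unfolding coord_max_def by (rule Max_ge) (use finite_lattice_points in auto)

lemma coord_max_attained:
  obtains m where "m \<in> lattice_points" "coord_max x = cmod (snd x (character m * D (fst x)))"
proof -
  have "coord_max x \<in> (\<lambda>m. cmod (snd x (character m * D (fst x)))) ` lattice_points"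
    unfolding coord_max_def by (rule Max_in) (use finite_lattice_points lattice_points_nonempty in auto)
  then show ?thesis using that by blast
qed

lemma canonical_metric: "Dbar = (D, \<lambda>x. 1 / coord_max x)"
  unfolding canonical_metrized_divisor_def coord_max_def
  by (subst cSup_eq_Max) (use finite_lattice_points lattice_points_nonempty in auto)

lemma fst_tensor_power: "fst (tensor_power l Dbar) = (\<lambda>R. D R ^ l)"
  by (simp add: tensor_power_def canonical_metric)

lemma snd_tensor_power: "snd (tensor_power l Dbar) = (\<lambda>x. (1 / coord_max x) ^ l)"
  by (simp add: tensor_power_def canonical_metric)

lemma tensor_power_power: "tensor_power k (tensor_power l Dbar) = tensor_power (l * k) Dbar"
  by (simp add: tensor_power_def power_mult)

lemma hnorm_canonical:
  "hnorm (tensor_power l Dbar) x s = cmod (snd x (s * D (fst x) ^ l)) / coord_max x ^ l"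
  by (simp add: hnorm_def fst_tensor_power snd_tensor_power power_divide)

lemma points_overD:
  assumes "x \<in> points_over X L"
  shows "fst x \<in> X" "ring_hom_on (fst x) (snd x)" "is_subring (fst x)"
    "\<And>r. r \<in> fst x \<Longrightarrow> snd x r = 0 \<longleftrightarrow> r \<in> max_ideal (fst x)"
    "\<And>r. r \<in> fst x \<Longrightarrow> snd x r \<in> L"
  using assms point_subring unfolding points_over_def by auto

lemma lattice_point_section:
  assumes "R \<in> X" "m \<in> lattice_points" shows "character m * D R \<in> R"
  using character_section[of R 1 m] assms by (simp add: polytope_of_def)

lemma coord_max_pos: assumes x: "x \<in> points_over X L" shows "0 < coord_max x"
proof -
  obtain m where m: "m \<in> lattice_points" "character m * D (fst x) \<in> fst x - max_ideal (fst x)"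
    using exists_generator[OF points_overD(1)[OF x]] by blast
  then have "0 < cmod (snd x (character m * D (fst x)))" using points_overD(4)[OF x] by simp
  then show ?thesis using coord_max_ge[OF m(1)] by (rule less_le_trans)
qed

text \<open>All characters have modulus 1 at \<open>z\<close>; hence so do the local equation of
  \<open>D\<close> and all the homogeneous coordinates, and \<open>coord_max\<close> is 1.\<close>

lemma exists_torus_point:
  fixes z :: "'n \<Rightarrow> complex"
  assumes z: "\<forall>i. cmod (z i) = 1"
  obtains x where "x \<in> points_over X UNIV"
    "\<forall>l q. Fract q 1 \<in> sections X (\<lambda>R. D R ^ l) \<longrightarrow>
       hnorm (tensor_power l Dbar) x (Fract q 1) = cmod (laurent_eval z q)"
proof -
  have z0: "\<forall>i. z i \<noteq> 0" using z by (metis norm_zero zero_neq_one)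
  obtain \<sigma> where \<sigma>: "\<sigma> \<in> \<Sigma>" using fan_complete by blast
  obtain R where R: "R \<in> spec_rings (cone_ring \<sigma>)" "R \<subseteq> torus_local_ring z"
    "ring_hom_on R (torus_eval z)" "\<forall>r\<in>R. torus_eval z r = 0 \<longleftrightarrow> r \<in> max_ideal R"
    by (rule torus_point[OF z0, of \<sigma>])
  have RX: "R \<in> X" using R(1) \<sigma> unfolding toric_scheme_def by blast
  have RS: "is_subring R" by (rule point_subring[OF RX])
  \<comment> \<open>The value 0 outside \<open>R\<close> is the normalization required by
    \<open>points_over\<close>.\<close>
  define x where "x = (R, \<lambda>r. if r \<in> R then torus_eval z r else 0)"
  have x: "x \<in> points_over X UNIV"
    unfolding points_over_def x_def using RX R(3,4)
    by (auto simp: ring_hom_on_def subring_one[OF RS] subring_add[OF RS] subring_mult[OF RS])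
  have mon1: "cmod (mon z m) = 1" for m
    unfolding mon_def by (simp add: prod_norm[symmetric] norm_power_int z)
  obtain n where n: "D R = character (- n)" using divisor_cases[OF RX] by blast
  have DT: "D R \<in> torus_local_ring z" unfolding n character_def by (rule Fract_in_torus_local_ring)
  have D1: "cmod (torus_eval z (D R)) = 1" unfolding n torus_eval_character[OF z0] mon1 ..
  have ev: "cmod (snd x (s * D R ^ l)) = cmod (torus_eval z s)"
    if "s * D R ^ l \<in> R" "s \<in> torus_local_ring z" for s l
    using that torus_eval_power[OF z0 DT, of l] torus_eval_hom(2)[OF z0, of s "D R ^ l"] D1
    by (simp add: x_def norm_mult norm_power)
  have chT: "character m \<in> torus_local_ring z" for m
    unfolding character_def by (rule Fract_in_torus_local_ring)
  have "cmod (snd x (character m * D (fst x))) = 1" if "m \<in> lattice_points" for m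
    using ev[of "character m" 1] lattice_point_section[OF RX that] chT[of m]
    by (simp add: torus_eval_character[OF z0] mon1 x_def[THEN arg_cong[of _ _ fst]])
  then have cm: "coord_max x = 1" by (metis coord_max_attained)
  show ?thesis
  proof (rule that[OF x], intro allI impI)
    fix l q assume "Fract q 1 \<in> sections X (\<lambda>R. D R ^ l)"
    then have "Fract q 1 * D R ^ l \<in> R" using RX unfolding sections_def by blast
    then show "hnorm (tensor_power l Dbar) x (Fract q 1) = cmod (laurent_eval z q)"
      using ev[of "Fract q 1" l] Fract_in_torus_local_ring[of q z]
      by (simp add: hnorm_canonical cm torus_eval_laurent[OF z0] x_def[THEN arg_cong[of _ _ fst]])
  qed
qed

lemma not_big: "\<not> big X (tensor_power l Dbar)"
proof
  assume "big X (tensor_power l Dbar)"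
  then obtain k s where s: "s \<in> sections X (\<lambda>R. D R ^ (l * k))" "s \<noteq> 0"
    and small: "\<And>x. x \<in> points_over X UNIV \<Longrightarrow> hnorm (tensor_power (l * k) Dbar) x s < 1"
    unfolding big_def tensor_power_power fst_tensor_power by blast
  obtain q where q: "s = Fract q 1" using sections_cases[OF s(1)] by blast
  obtain z where z: "\<forall>i. cmod (z i) = 1"
    "(\<Sum>m\<in>Poly_Mapping.keys q. (of_int (Poly_Mapping.lookup q m))\<^sup>2) \<le> (cmod (laurent_eval z q))\<^sup>2"
    using laurent_eval_square_ge[of q] by blast
  obtain x where x0: "x \<in> points_over X UNIV"
    "\<forall>l q. Fract q 1 \<in> sections X (\<lambda>R. D R ^ l) \<longrightarrow>
      hnorm (tensor_power l Dbar) x (Fract q 1) = cmod (laurent_eval z q)"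
    by (rule exists_torus_point[OF z(1)])
  then have x: "x \<in> points_over X UNIV"
    "hnorm (tensor_power (l * k) Dbar) x (Fract q 1) = cmod (laurent_eval z q)"
    using s(1) unfolding q by blast+
  have "q \<noteq> 0" using s(2) q by (auto simp: Zero_fract_def)
  then obtain m where m: "m \<in> Poly_Mapping.keys q" by (metis ex_in_conv keys_eq_empty)
  have "1 \<le> (real_of_int (Poly_Mapping.lookup q m))\<^sup>2"
  proof -
    have "1 \<le> (Poly_Mapping.lookup q m)\<^sup>2" using m by (simp add: in_keys_iff int_one_le_iff_zero_less)
    then show ?thesis by (metis of_int_1_le_iff of_int_power)
  qed
  also have "\<dots> \<le> (\<Sum>m\<in>Poly_Mapping.keys q. (of_int (Poly_Mapping.lookup q m))\<^sup>2)"
    by (rule member_le_sum[OF m]) auto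
  finally have "1 \<le> (cmod (laurent_eval z q))\<^sup>2" using z(2) by linarith
  moreover have "(cmod (laurent_eval z q))\<^sup>2 < 1"
    using small[OF x(1)] x(2) q by (simp add: power_less_one_iff abs_square_less_1)
  ultimately show False by simp
qed

text \<open>A point outside the hull is separated from it by some \<open>u\<close>; but \<psi> at
  \<open>u\<close> is attained at a lattice point, so the separated point violates the inequality
  that defines the polytope at \<open>u\<close>.\<close>

lemma polytope_subset_convex_hull:
  assumes a: "a \<in> polytope_of \<psi>"
  shows "a \<in> convex hull (lattice_vec ` lattice_points)"
proof (rule ccontr)
  let ?C = "convex hull (lattice_vec ` lattice_points)"
  assume "a \<notin> ?C"
  moreover have "closed ?C"
    using finite_lattice_points by (simp add: finite_imp_compact compact_convex_hull compact_imp_closed)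
  ultimately obtain u b where u: "u \<bullet> a < b" "\<And>y. y \<in> ?C \<Longrightarrow> b < u \<bullet> y"
    using separating_hyperplane_closed_point[of ?C a] convex_convex_hull by blast
  obtain m where m: "m \<in> lattice_points" "\<psi> u = lattice_vec m \<bullet> u" by (rule exists_minimizer)
  have "b < u \<bullet> lattice_vec m" by (rule u(2)) (use m in \<open>blast intro: hull_inc\<close>)
  moreover have "\<psi> u \<le> a \<bullet> u" using a unfolding polytope_of_def by blast
  ultimately show False using u(1) m(2) by (simp add: inner_commute)
qed

text \<open>Dirichlet approximation turns a real convex combination into a rational one, because the error is
  an integral vector.\<close>

lemma rational_combination:
  assumes l: "1 \<le> l" and m: "\<And>u. real l * \<psi> u \<le> lattice_vec m \<bullet> u"
  obtains q c where "0 < q" "sum c lattice_points = q"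
    "character m ^ q = (\<Prod>k\<in>lattice_points. character k ^ (l * c k))"
proof -
  have "(1 / real l) *\<^sub>R lattice_vec m \<in> polytope_of \<psi>"
    unfolding polytope_of_def using m l by (simp add: field_simps)
  then have "(1 / real l) *\<^sub>R lattice_vec m \<in> convex hull (lattice_vec ` lattice_points)"
    by (rule polytope_subset_convex_hull)
  then obtain w where w: "\<And>v. v \<in> lattice_vec ` lattice_points \<Longrightarrow> 0 \<le> w v" "sum w (lattice_vec ` lattice_points) = 1"
    "(\<Sum>v\<in>lattice_vec ` lattice_points. w v *\<^sub>R v) = (1 / real l) *\<^sub>R lattice_vec m"
    using finite_lattice_points by (auto simp: convex_hull_finite)
  have inj: "inj_on lattice_vec lattice_points" by (simp add: inj_on_def lattice_vec_inject)
  define r where "r k = w (lattice_vec k)" for k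
  have r: "\<And>k. k \<in> lattice_points \<Longrightarrow> 0 \<le> r k" "sum r lattice_points = 1"
    "(\<Sum>k\<in>lattice_points. r k *\<^sub>R lattice_vec k) = (1 / real l) *\<^sub>R lattice_vec m"
    using w by (auto simp: r_def sum.reindex[OF inj] o_def)
  obtain h where h: "bij_betw h {0..<card lattice_points} lattice_points"
    using ex_bij_betw_nat_finite[OF finite_lattice_points] by blast
  define g where "g = the_inv_into {0..<card lattice_points} h"
  have g: "g k < card lattice_points" "h (g k) = k" if "k \<in> lattice_points" for k
    using h that f_the_inv_into_f_bij_betw[OF h] the_inv_into_into[of h "{0..<card lattice_points}" k "{0..<card lattice_points}"]
    unfolding g_def bij_betw_def by auto
  \<comment> \<open>Bounds the total effect of errors of size \<open>1 / N\<close> in the weights,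
    both in their sum (the term 1) and in each coordinate of the combination scaled by
    \<open>l\<close> (the other terms).\<close>
  define M where "M = (\<Sum>k\<in>lattice_points. 1 + (\<Sum>i\<in>UNIV. real l * \<bar>of_int (Poly_Mapping.lookup k i)\<bar>))"
  have M0: "0 \<le> M" unfolding M_def by (intro sum_nonneg add_nonneg_nonneg) auto
  obtain N :: nat where N: "M + 1 < real N" using reals_Archimedean2 by blast
  then have N0: "0 < N" using M0 by (cases N) auto
  obtain q p where q: "0 < q" and p: "\<And>i. i < card lattice_points \<Longrightarrow> \<bar>of_int q * r (h i) - of_int (p i)\<bar> < 1 / N"
    using Dirichlet_approx_simult[OF N0, of "card lattice_points" "\<lambda>i. r (h i)"] by blast
  have app: "\<bar>of_int q * r k - of_int (p (g k))\<bar> < 1 / N" if "k \<in> lattice_points" for k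
    using p[of "g k"] g[OF that] by simp
  \<comment> \<open>The integer \<open>p (g k)\<close> is within distance less than 1 of a
    nonnegative number, so it exceeds -1; the weights can be taken in the natural numbers.\<close>
  have nn: "0 \<le> p (g k)" if "k \<in> lattice_points" for k
  proof -
    have "1 / real N \<le> 1" using N0 by simp
    moreover have "0 \<le> of_int q * r k" using q r(1)[OF that] by simp
    ultimately show ?thesis using app[OF that] by linarith
  qed
  define c where "c k = nat (p (g k))" for k
  have c: "\<bar>of_int q * r k - real (c k)\<bar> \<le> 1 / N" if "k \<in> lattice_points" for k
    using app[OF that] nn[OF that] unfolding c_def by simp
  have small: "\<bar>\<Sum>k\<in>lattice_points. (of_int q * r k - real (c k)) * t k\<bar> < 1"
    if t: "\<And>k. k \<in> lattice_points \<Longrightarrow> \<bar>t k\<bar> \<le> 1 + (\<Sum>i\<in>UNIV. real l * \<bar>of_int (Poly_Mapping.lookup k i)\<bar>)" for t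
  proof -
    have "\<bar>\<Sum>k\<in>lattice_points. (of_int q * r k - real (c k)) * t k\<bar> \<le>
        (\<Sum>k\<in>lattice_points. 1 / N * (1 + (\<Sum>i\<in>UNIV. real l * \<bar>of_int (Poly_Mapping.lookup k i)\<bar>)))"
      by (rule order_trans[OF sum_abs], rule sum_mono, unfold abs_mult) (intro mult_mono c t; simp)
    also have "\<dots> = M / N" unfolding M_def sum_distrib_left[symmetric] by simp
    also have "\<dots> < 1" using N M0 by (simp add: divide_less_eq)
    finally show ?thesis .
  qed
  have "\<bar>\<Sum>k\<in>lattice_points. (of_int q * r k - real (c k)) * 1\<bar> < 1"
    by (rule small) (simp add: sum_nonneg)
  then have "\<bar>real_of_int (q - int (sum c lattice_points))\<bar> < 1"
    using r(2) by (simp add: sum_subtractf sum_distrib_left[symmetric])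
  then have sq: "int (sum c lattice_points) = q" by linarith
  have vec: "q * Poly_Mapping.lookup m i = (\<Sum>k\<in>lattice_points. int (l * c k) * Poly_Mapping.lookup k i)" for i
  proof -
    have "\<bar>\<Sum>k\<in>lattice_points. (of_int q * r k - real (c k)) * (real l * of_int (Poly_Mapping.lookup k i))\<bar> < 1"
    proof (rule small)
      fix k
      have "\<bar>real l * of_int (Poly_Mapping.lookup k i)\<bar> \<le> (\<Sum>i\<in>UNIV. real l * \<bar>of_int (Poly_Mapping.lookup k i)\<bar>)"
        unfolding abs_mult abs_of_nat
        by (rule member_le_sum[where f = "\<lambda>i. real l * \<bar>of_int (Poly_Mapping.lookup k i)\<bar>"]) auto
      then show "\<bar>real l * of_int (Poly_Mapping.lookup k i)\<bar> \<le> 1 + (\<Sum>i\<in>UNIV. real l * \<bar>of_int (Poly_Mapping.lookup k i)\<bar>)"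
        by simp
    qed
    moreover have "(\<Sum>k\<in>lattice_points. (of_int q * r k - real (c k)) * (real l * of_int (Poly_Mapping.lookup k i))) =
        of_int q * (real l * (\<Sum>k\<in>lattice_points. r k * of_int (Poly_Mapping.lookup k i)))
        - (\<Sum>k\<in>lattice_points. real (l * c k) * of_int (Poly_Mapping.lookup k i))"
      unfolding sum_distrib_left sum_subtractf[symmetric]
      by (intro sum.cong refl) (simp add: algebra_simps)
    moreover have "real l * (\<Sum>k\<in>lattice_points. r k * of_int (Poly_Mapping.lookup k i)) = of_int (Poly_Mapping.lookup m i)"
      using arg_cong[OF r(3), of "\<lambda>v. v $ i"] l by (simp add: field_simps)
    ultimately have "\<bar>real_of_int (q * Poly_Mapping.lookup m i -
        (\<Sum>k\<in>lattice_points. int (l * c k) * Poly_Mapping.lookup k i))\<bar> < 1" by simp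
    then show ?thesis by linarith
  qed
  have look: "Poly_Mapping.lookup (nmul j k) i = int j * Poly_Mapping.lookup k i" for j i and k :: "'n \<Rightarrow>\<^sub>0 int"
    by (induction j) (simp_all add: lookup_add distrib_right)
  have "nmul (nat q) m = (\<Sum>k\<in>lattice_points. nmul (l * c k) k)"
    by (rule poly_mapping_eqI) (use q vec in \<open>simp add: look lookup_sum del: of_nat_mult\<close>)
  then have "character m ^ nat q = (\<Prod>k\<in>lattice_points. character k ^ (l * c k))"
    by (metis (no_types, lifting) character_nmul character_sum prod.cong)
  moreover have "sum c lattice_points = nat q" using sq by (metis nat_int)
  ultimately show ?thesis using that[of "nat q" c] q by simp
qed

text \<open>The \<open>q\<close>-th power of the local expression of \<chi>^m is a product of
  \<open>l * q\<close> factors \<open>character k * D\<close>, counted with multiplicity, each of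
  modulus at most \<open>coord_max x\<close>. Taking \<open>q\<close>-th roots gives the
  bound.\<close>

lemma character_bound:
  assumes x: "x \<in> points_over X L" and l: "1 \<le> l" and m: "\<And>u. real l * \<psi> u \<le> lattice_vec m \<bullet> u"
  shows "cmod (snd x (character m * D (fst x) ^ l)) \<le> coord_max x ^ l"
proof -
  let ?R = "fst x" and ?ev = "snd x"
  obtain q c where q: "0 < q" "sum c lattice_points = q"
    "character m ^ q = (\<Prod>k\<in>lattice_points. character k ^ (l * c k))"
    by (rule rational_combination[OF l m])
  have "(character m * D ?R ^ l) ^ q = (\<Prod>k\<in>lattice_points. (character k * D ?R) ^ (l * c k))"
    unfolding power_mult_distrib prod.distrib q(3) power_sum[symmetric] sum_distrib_left[symmetric] q(2)
    by (simp add: power_mult)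
  then have "?ev (character m * D ?R ^ l) ^ q = (\<Prod>k\<in>lattice_points. ?ev (character k * D ?R) ^ (l * c k))"
    using ring_hom_on_power[OF points_overD(2)[OF x] points_overD(3)[OF x] character_section[OF points_overD(1)[OF x] m], of q]
      ring_hom_on_prod[OF points_overD(2)[OF x] points_overD(3)[OF x], of lattice_points "\<lambda>k. (character k * D ?R) ^ (l * c k)"]
      ring_hom_on_power[OF points_overD(2)[OF x] points_overD(3)[OF x] lattice_point_section[OF points_overD(1)[OF x]]]
      subring_power[OF points_overD(3)[OF x] lattice_point_section[OF points_overD(1)[OF x]]]
    by simp
  then have "cmod (?ev (character m * D ?R ^ l)) ^ q = (\<Prod>k\<in>lattice_points. cmod (?ev (character k * D ?R)) ^ (l * c k))"
    by (metis (no_types, lifting) norm_power prod.cong prod_norm)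
  also have "\<dots> \<le> (\<Prod>k\<in>lattice_points. coord_max x ^ (l * c k))"
    by (intro prod_mono conjI power_mono coord_max_ge) auto
  also have "\<dots> = (coord_max x ^ l) ^ q"
    unfolding power_sum[symmetric] sum_distrib_left[symmetric] q(2) by (simp add: power_mult)
  finally show ?thesis
    using q(1) coord_max_pos[OF x] by (metis less_imp_le power_less_imp_less_base not_le zero_le_power norm_ge_zero power_mono_iff)
qed

lemma scaled_polytope:
  assumes "1 \<le> l"
  shows "lattice_vec m \<in> (*\<^sub>R) (real l) ` polytope_of \<psi> \<longleftrightarrow> (\<forall>u. real l * \<psi> u \<le> lattice_vec m \<bullet> u)"
proof
  assume r: "\<forall>u. real l * \<psi> u \<le> lattice_vec m \<bullet> u"
  have "lattice_vec m = real l *\<^sub>R ((1 / real l) *\<^sub>R lattice_vec m)" using assms by simp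
  moreover have "(1 / real l) *\<^sub>R lattice_vec m \<in> polytope_of \<psi>"
    unfolding polytope_of_def using r assms by (simp add: field_simps)
  ultimately show "lattice_vec m \<in> (*\<^sub>R) (real l) ` polytope_of \<psi>" by blast
qed (use assms in \<open>auto simp: polytope_of_def\<close>)

lemma small_characters:
  assumes l: "1 \<le> l" and m: "\<And>u. real l * \<psi> u \<le> lattice_vec m \<bullet> u"
  shows "character m \<in> small_sections X (tensor_power l Dbar)"
    "- character m \<in> small_sections X (tensor_power l Dbar)"
proof -
  have sec: "character m * D R ^ l \<in> R" if "R \<in> X" for R using character_section[OF that m] .
  have 1: "hnorm (tensor_power l Dbar) x (character m) \<le> 1" if x: "x \<in> points_over X UNIV" for x
    unfolding hnorm_canonical using character_bound[OF x l m] coord_max_pos[OF x] by (simp add: divide_le_eq)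
  have "hnorm (tensor_power l Dbar) x (- character m) = hnorm (tensor_power l Dbar) x (character m)"
    if x: "x \<in> points_over X UNIV" for x
    using ring_hom_on_uminus[OF points_overD(2)[OF x] points_overD(3)[OF x] sec[OF points_overD(1)[OF x]]]
    unfolding hnorm_canonical by simp
  then show "character m \<in> small_sections X (tensor_power l Dbar)"
    "- character m \<in> small_sections X (tensor_power l Dbar)"
    unfolding small_sections_def sections_def sup_norm_def fst_tensor_power
    using 1 sec subring_uminus[OF point_subring] by (auto intro!: SUP_least)
qed

lemma small_sections_eq:
  assumes l: "1 \<le> l"
  shows "small_sections X (tensor_power l Dbar) =
      {character m | m. lattice_vec m \<in> (*\<^sub>R) (real l) ` polytope_of \<psi>} \<union>
      {- character m | m. lattice_vec m \<in> (*\<^sub>R) (real l) ` polytope_of \<psi>} \<union> {0}" (is "?S = ?T")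
proof
  have "0 \<in> ?S"
  proof -
    have "hnorm (tensor_power l Dbar) x 0 \<le> 1" if x: "x \<in> points_over X UNIV" for x
      using ring_hom_on_zero[OF points_overD(2)[OF x] points_overD(3)[OF x]] unfolding hnorm_canonical by simp
    then show ?thesis
      unfolding small_sections_def sections_def sup_norm_def
      using subring_zero[OF point_subring] by (auto intro!: SUP_least)
  qed
  then show "?T \<subseteq> ?S"
    unfolding scaled_polytope[OF l] using small_characters[OF l] by auto
  show "?S \<subseteq> ?T"
  proof
    fix s assume s: "s \<in> ?S"
    then have sec: "s \<in> sections X (\<lambda>R. D R ^ l)" unfolding small_sections_def fst_tensor_power by blast
    obtain q where q: "s = Fract q 1" "\<And>k u. k \<in> Poly_Mapping.keys q \<Longrightarrow> real l * \<psi> u \<le> lattice_vec k \<bullet> u"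
      using sections_cases[OF sec] by blast
    obtain z where z: "\<forall>i. cmod (z i) = 1"
      "(\<Sum>m\<in>Poly_Mapping.keys q. (of_int (Poly_Mapping.lookup q m))\<^sup>2) \<le> (cmod (laurent_eval z q))\<^sup>2"
      using laurent_eval_square_ge[of q] by blast
    obtain x where x0: "x \<in> points_over X UNIV"
      "\<forall>l q. Fract q 1 \<in> sections X (\<lambda>R. D R ^ l) \<longrightarrow>
        hnorm (tensor_power l Dbar) x (Fract q 1) = cmod (laurent_eval z q)"
      by (rule exists_torus_point[OF z(1)])
    then have x: "x \<in> points_over X UNIV"
      "hnorm (tensor_power l Dbar) x (Fract q 1) = cmod (laurent_eval z q)"
      using sec unfolding q(1) by blast+
    have "ereal (hnorm (tensor_power l Dbar) x s) \<le> sup_norm X (tensor_power l Dbar) s"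
      unfolding sup_norm_def using x(1) by (rule SUP_upper)
    also have "\<dots> \<le> 1" using s unfolding small_sections_def by blast
    finally have "cmod (laurent_eval z q) \<le> 1" using x(2) q(1) by simp
    then have "(cmod (laurent_eval z q))\<^sup>2 \<le> 1" by (simp add: power_le_one)
    then have "real_of_int (\<Sum>m\<in>Poly_Mapping.keys q. (Poly_Mapping.lookup q m)\<^sup>2) \<le> 1" using z(2) by simp
    then have sq: "(\<Sum>m\<in>Poly_Mapping.keys q. (Poly_Mapping.lookup q m)\<^sup>2) \<le> 1" by linarith
    show "s \<in> ?T"
    proof (cases "q = 0")
      case True then show ?thesis using q(1) by (simp add: Zero_fract_def)
    next
      case False
      then obtain m where m: "m \<in> Poly_Mapping.keys q" by (metis ex_in_conv keys_eq_empty)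
      \<comment> \<open>Every nonzero integral coefficient contributes at least 1 to a sum of
        squares that is at most 1, so one monomial remains, with coefficient 1 or -1.\<close>
      have ge: "1 \<le> (Poly_Mapping.lookup q k)\<^sup>2" if "k \<in> Poly_Mapping.keys q" for k
        using that by (simp add: in_keys_iff int_one_le_iff_zero_less)
      have "int (card (Poly_Mapping.keys q)) \<le> (\<Sum>m\<in>Poly_Mapping.keys q. (Poly_Mapping.lookup q m)\<^sup>2)"
        using sum_mono[of "Poly_Mapping.keys q" "\<lambda>_. 1" "\<lambda>m. (Poly_Mapping.lookup q m)\<^sup>2"] ge by simp
      then have "card (Poly_Mapping.keys q) \<le> 1" using sq by linarith
      moreover have "card (Poly_Mapping.keys q) \<noteq> 0" using m by auto
      ultimately have "card (Poly_Mapping.keys q) = 1" by linarith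
      then obtain k where "Poly_Mapping.keys q = {k}" by (rule card_1_singletonE)
      then have km: "Poly_Mapping.keys q = {m}" using m by simp
      then have "(Poly_Mapping.lookup q m)\<^sup>2 \<le> 1" using sq by simp
      then have "\<bar>Poly_Mapping.lookup q m\<bar> \<le> 1" by (simp add: abs_square_le_1)
      moreover have "Poly_Mapping.lookup q m \<noteq> 0" using m by (simp add: in_keys_iff)
      ultimately have "Poly_Mapping.lookup q m = 1 \<or> Poly_Mapping.lookup q m = -1" by linarith
      moreover have "s = of_int (Poly_Mapping.lookup q m) * character m"
        unfolding q(1) Fract_expand km by simp
      ultimately have "s = character m \<or> s = - character m" by auto
      then show ?thesis unfolding scaled_polytope[OF l] using q(2)[OF m] by auto
    qed
  qed
qed

section \<open>Relative nefness\<close>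

text \<open>Every ideal in the chains contains 1 and is therefore all of \<open>y\<close>, which
  leaves no strict inclusion. It makes the denominators \<open>b y = 1\<close> contribute nothing to
  the degree.\<close>

lemma curve_length_one:
  assumes y: "is_subring y" and \<eta>: "is_subring \<eta>"
  shows "curve_length \<eta> y 1 = 0"
proof -
  let ?I = "{r * 1 + s |r s. r \<in> y \<and> s \<in> y \<inter> max_ideal \<eta>}"
  have "0 \<in> y \<inter> max_ideal \<eta>"
    using subring_zero[OF y] subring_zero[OF \<eta>] unfolding max_ideal_def by simp
  then have yI: "y \<subseteq> ?I" by force
  have "n = 0" if J: "\<forall>i\<le>n. is_ideal y (J i) \<and> ?I \<subseteq> J i" "\<forall>i<n. J i \<subset> J (Suc i)" for n J
  proof (rule ccontr)
    assume "n \<noteq> 0"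
    then have "J 0 \<subset> J 1" "is_ideal y (J 0)" "?I \<subseteq> J 0" "is_ideal y (J 1)" using J by auto
    then show False using yI ideal_subset[of y "J 1"] by blast
  qed
  then have "{n. \<exists>J :: nat \<Rightarrow> _ set. (\<forall>i\<le>n. is_ideal y (J i) \<and> ?I \<subseteq> J i) \<and> (\<forall>i<n. J i \<subset> J (Suc i))} \<subseteq> {0}"
    by blast
  moreover have "Sup S = 0" if "S \<subseteq> {0 :: nat}" for S
    using that by (auto simp: subset_singleton_iff)
  ultimately show ?thesis unfolding curve_length_def quotient_length_def by blast
qed

text \<open>A global section generating at \<eta> restricts to a nonzero section of the curve
  without poles. With all denominators equal to 1, each order is a length.\<close>

lemma relatively_nef_tensor_power: "relatively_nef X (\<lambda>R. D R ^ l)"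
  unfolding relatively_nef_def
proof (intro allI impI)
  fix \<eta> assume "curve_in_fibre X \<eta>"
  then have \<eta>: "\<eta> \<in> X" unfolding curve_in_fibre_def by blast
  have \<eta>S: "is_subring \<eta>" by (rule point_subring[OF \<eta>])
  let ?C = "fibre_closure X \<eta> - {\<eta>}"
  have C: "y \<in> X" "y \<subseteq> \<eta>" if "y \<in> ?C" for y using that unfolding fibre_closure_def by auto
  obtain m where m: "m \<in> lattice_points" "character m * D \<eta> \<in> \<eta> - max_ideal \<eta>"
    using exists_generator[OF \<eta>] by blast
  define t where "t = character m ^ l"
  have t: "t * D y ^ l = (character m * D y) ^ l" for y unfolding t_def by (simp add: power_mult_distrib)
  have unit: "t * D \<eta> ^ l \<in> \<eta> - max_ideal \<eta>" unfolding t by (rule unit_power[OF \<eta>S m(2)])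
  \<comment> \<open>Regular at \<open>y\<close> since \<chi>^m is a global section; nonzero on the
    curve since the equations at \<open>y\<close> and at \<eta> differ by a unit of \<eta>.\<close>
  have a: "t * D y ^ l \<in> y - max_ideal \<eta>" if y: "y \<in> ?C" for y
  proof -
    have "t * D y ^ l \<in> y"
      unfolding t by (rule subring_power[OF point_subring[OF C(1)[OF y]] lattice_point_section[OF C(1)[OF y] m(1)]])
    moreover have "(t * D \<eta> ^ l) * (D y / D \<eta>) ^ l \<in> \<eta> - max_ideal \<eta>"
      by (rule unit_mult[OF \<eta>S unit unit_power[OF \<eta>S divisor_quotient_unit[OF \<eta> C[OF y]]]])
    moreover have "(t * D \<eta> ^ l) * (D y / D \<eta>) ^ l = t * D y ^ l"
      using divisor_nonzero[OF \<eta>] by (simp add: power_divide)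
    ultimately show ?thesis by auto
  qed
  have b: "1 \<in> y - max_ideal \<eta>" if y: "y \<in> ?C" for y
    using subring_one[OF point_subring[OF C(1)[OF y]]] subring_one[OF \<eta>S] unfolding max_ideal_def by force
  let ?e = "\<lambda>y. int (curve_length \<eta> y (t * D y ^ l)) - int (curve_length \<eta> y 1)"
  have e: "0 \<le> ?e y" if "y \<in> ?C" for y
    using curve_length_one[OF point_subring[OF C(1)[OF that]] \<eta>S] by simp
  let ?n = "\<Sum>y | y \<in> ?C \<and> ?e y \<noteq> 0. ?e y * int (residue_degree y)"
  have "has_curve_degree X (\<lambda>R. D R ^ l) \<eta> ?n"
    unfolding has_curve_degree_def Let_def
    by (intro exI[of _ t] exI[of _ "\<lambda>y. t * D y ^ l"] exI[of _ "\<lambda>_. 1"]) (use unit a b in simp)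
  moreover have "0 \<le> ?n" by (intro sum_nonneg mult_nonneg_nonneg) (use e in auto)
  ultimately show "\<exists>n\<ge>0. has_curve_degree X (\<lambda>R. D R ^ l) \<eta> n" by blast
qed

end

section \<open>Second differences\<close>

lemma DERIV_along_line:
  fixes h :: "complex^'n::finite \<Rightarrow> real"
  assumes "h differentiable (at (z + t *\<^sub>R v))"
  shows "((\<lambda>t. h (z + t *\<^sub>R v)) has_real_derivative dir_deriv v h (z + t *\<^sub>R v)) (at t)"
proof -
  let ?f = "frechet_derivative h (at (z + t *\<^sub>R v))"
  have h: "(h has_derivative ?f) (at (z + t *\<^sub>R v))"
    using assms by (simp add: frechet_derivative_works)
  have "((\<lambda>t. z + t *\<^sub>R v) has_derivative (\<lambda>s. s *\<^sub>R v)) (at t)"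
    by (auto intro!: derivative_eq_intros)
  then have "((\<lambda>t. h (z + t *\<^sub>R v)) has_derivative (\<lambda>s. ?f (s *\<^sub>R v))) (at t)"
    using h by (rule has_derivative_compose)
  moreover have "?f (s *\<^sub>R v) = dir_deriv v h (z + t *\<^sub>R v) * s" for s
    using has_derivative_bounded_linear[OF h] by (simp add: dir_deriv_def linear_simps)
  ultimately show ?thesis by (simp add: has_field_derivative_def)
qed

lemma dir_deriv_differentiable:
  assumes "Ck 2 h"
  shows "h differentiable (at z)" "dir_deriv v h differentiable (at z)"
    "continuous_on UNIV (dir_deriv v (dir_deriv v h))"
  using assms unfolding numeral_2_eq_2 dir_deriv_def by auto

text \<open>The function \<phi> is even, so its Maclaurin expansion has no linear term. The Lagrange
  remainder writes the second difference through an average of two second derivatives, which can be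
  both bounded and passed to the limit.\<close>

lemma second_difference:
  fixes h :: "complex^'n::finite \<Rightarrow> real"
  assumes h: "Ck 2 h" and r: "0 < r"
  obtains t where "0 < t" "t \<le> r"
    "h (z + r *\<^sub>R v) + h (z - r *\<^sub>R v) - 2 * h z =
      (dir_deriv v (dir_deriv v h) (z + t *\<^sub>R v) + dir_deriv v (dir_deriv v h) (z - t *\<^sub>R v)) / 2 * r\<^sup>2"
proof -
  let ?d = "dir_deriv v h" and ?dd = "dir_deriv v (dir_deriv v h)"
  define \<phi> where "\<phi> t = h (z + t *\<^sub>R v) + h (z + (- t) *\<^sub>R v)" for t
  define \<phi>1 where "\<phi>1 t = ?d (z + t *\<^sub>R v) - ?d (z + (- t) *\<^sub>R v)" for t
  define \<phi>2 where "\<phi>2 t = ?dd (z + t *\<^sub>R v) + ?dd (z + (- t) *\<^sub>R v)" for t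
  have hd: "((\<lambda>t. h (z + t *\<^sub>R v)) has_real_derivative ?d (z + t *\<^sub>R v)) (at t)" for t
    by (rule DERIV_along_line[OF dir_deriv_differentiable(1)[OF h]])
  have dd: "((\<lambda>t. ?d (z + t *\<^sub>R v)) has_real_derivative ?dd (z + t *\<^sub>R v)) (at t)" for t
    by (rule DERIV_along_line[OF dir_deriv_differentiable(2)[OF h]])
  have neg: "(uminus has_real_derivative - 1) (at t)" for t :: real
    by (auto intro!: derivative_eq_intros)
  have 1: "(\<phi> has_real_derivative \<phi>1 t) (at t)" for t
    unfolding \<phi>_def \<phi>1_def
    using DERIV_add[OF hd[of t] DERIV_chain2[OF hd[of "- t"] neg]] by simp
  have 2: "(\<phi>1 has_real_derivative \<phi>2 t) (at t)" for t
    unfolding \<phi>1_def \<phi>2_def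
    using DERIV_diff[OF dd[of t] DERIV_chain2[OF dd[of "- t"] neg]] by simp
  \<comment> \<open>Only the derivatives of order at most 2 enter; later entries repeat the last one
    to make the sequence total.\<close>
  define diff where "diff m = (if m = 0 then \<phi> else if m = 1 then \<phi>1 else \<phi>2)" for m :: nat
  have "\<exists>t. 0 < t \<and> t \<le> r \<and> \<phi> r = (\<Sum>m<2. diff m 0 / fact m * r ^ m) + diff 2 t / fact 2 * r ^ 2"
  proof (rule Maclaurin2[OF r])
    show "diff 0 = \<phi>" by (simp add: diff_def)
    show "\<forall>m t. m < 2 \<and> 0 \<le> t \<and> t \<le> r \<longrightarrow> DERIV (diff m) t :> diff (Suc m) t"
      using 1 2 by (auto simp: diff_def less_2_cases_iff)
  qed
  then obtain t where t: "0 < t" "t \<le> r"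
    "\<phi> r = (\<Sum>m<2. diff m 0 / fact m * r ^ m) + diff 2 t / fact 2 * r ^ 2" by blast
  have "(\<Sum>m<2. diff m 0 / fact m * r ^ m) = 2 * h z"
    by (simp add: numeral_2_eq_2 diff_def \<phi>_def \<phi>1_def)
  then have "\<phi> r = 2 * h z + \<phi>2 t / 2 * r\<^sup>2" using t(3) by (simp add: diff_def)
  then show ?thesis using that[OF t(1,2)] by (simp add: \<phi>_def \<phi>2_def)
qed

lemma dir_deriv_off_support:
  fixes h :: "complex^'n::finite \<Rightarrow> real"
  assumes "closed S" "\<And>z. z \<notin> S \<Longrightarrow> h z = 0" "z \<notin> S"
  shows "dir_deriv v h z = 0"
proof -
  have "(h has_derivative (\<lambda>_. 0)) (at z)"
    by (rule has_derivative_transform_within_open[of "\<lambda>_. 0" _ _ _ "- S"]) (use assms in auto)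
  then show ?thesis
    unfolding dir_deriv_def using frechet_derivative_at by metis
qed

text \<open>Nothing is known about \<open>u\<close> outside \<open>V\<close>. The product is
  continuous on \<open>V\<close> and is 0 on the complement of \<open>T\<close>; these two open sets
  cover the space.\<close>

lemma continuous_compact_support:
  fixes u g :: "'a::euclidean_space \<Rightarrow> real"
  assumes V: "open V" and u: "continuous_on V u" and g: "continuous_on UNIV g"
    and T: "compact T" "T \<subseteq> V" and supp: "\<And>z. z \<notin> T \<Longrightarrow> g z = 0"
  shows "continuous_on UNIV (\<lambda>z. u z * g z)" "integrable lborel (\<lambda>z. u z * g z)"
proof -
  have "continuous_on (V \<union> - T) (\<lambda>z. u z * g z)"
  proof (rule continuous_on_open_Un[OF V])
    show "open (- T)" using T by (simp add: compact_imp_closed open_Compl)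
    show "continuous_on V (\<lambda>z. u z * g z)"
      using u continuous_on_subset[OF g] by (intro continuous_on_mult) auto
    have "continuous_on (- T) (\<lambda>z. 0 :: real)" by simp
    then show "continuous_on (- T) (\<lambda>z. u z * g z)"
      by (rule continuous_on_eq) (use supp in auto)
  qed
  moreover have "V \<union> - T = UNIV" using T by blast
  ultimately show c: "continuous_on UNIV (\<lambda>z. u z * g z)" by simp
  have "integrable lborel (\<lambda>z. indicator T z *\<^sub>R (u z * g z))"
    using borel_integrable_compact[OF T(1) continuous_on_subset[OF c]] by simp
  moreover have "(\<lambda>z. indicator T z *\<^sub>R (u z * g z)) = (\<lambda>z. u z * g z)"
  proof
    show "indicator T z *\<^sub>R (u z * g z) = u z * g z" for z
      using supp[of z] by (cases "z \<in> T") auto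
  qed
  ultimately show "integrable lborel (\<lambda>z. u z * g z)" by simp
qed

lemma integral_translate:
  fixes f :: "'a::euclidean_space \<Rightarrow> real"
  assumes "continuous_on UNIV f"
  shows "(\<integral>z. f (c + z) \<partial>lborel) = (\<integral>z. f z \<partial>lborel)"
proof -
  have "(\<integral>z. f z \<partial>lborel) = (\<integral>z. f z \<partial>(distr lborel borel ((+) c)))" by (simp add: lborel_distr_plus)
  also have "\<dots> = (\<integral>z. f (c + z) \<partial>lborel)"
    by (rule integral_distr) (use assms in \<open>auto intro: borel_measurable_continuous_onI\<close>)
  finally show ?thesis by simp
qed

text \<open>
  Integrating against the second differences of a test function is the same as taking second
  differences of \<open>u\<close>. If these are bounded below by \<open>o(r\<^sup>2)\<close>, then \<open>dd\<^sup>cu\<close> is semi-positive.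
\<close>

lemma ddc_semipositiveI:
  fixes V :: "(complex^'n::finite) set"
  assumes V: "open V" and u: "continuous_on V u"
    and sub: "\<And>S \<xi>. compact S \<Longrightarrow> S \<subseteq> V \<Longrightarrow> \<exists>C. \<exists>r0>0. \<forall>z\<in>S. \<forall>r. 0 < r \<and> r \<le> r0 \<longrightarrow>
      - C * r ^ 3 \<le> u (z + r *\<^sub>R \<xi>) + u (z - r *\<^sub>R \<xi>) + u (z + r *\<^sub>R (\<i> *s \<xi>)) + u (z - r *\<^sub>R (\<i> *s \<xi>)) - 4 * u z"
  shows "ddc_semipositive V u"
  unfolding ddc_semipositive_def
proof (intro allI impI)
  fix \<xi> :: "complex^'n" and h assume h: "test_function V h"
  have h2: "Ck 2 h" and h0: "\<And>z. 0 \<le> h z" and hc: "continuous_on UNIV h"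
    using h unfolding test_function_def by (auto dest: spec[of _ 0] simp del: Ck.simps(2))
  obtain S where S: "compact S" "S \<subseteq> V" "\<And>z. z \<notin> S \<Longrightarrow> h z = 0"
    using h unfolding test_function_def by blast
  obtain C r0 where r0: "0 < r0" and C: "\<And>z r. z \<in> S \<Longrightarrow> 0 < r \<Longrightarrow> r \<le> r0 \<Longrightarrow>
      - C * r ^ 3 \<le> u (z + r *\<^sub>R \<xi>) + u (z - r *\<^sub>R \<xi>) + u (z + r *\<^sub>R (\<i> *s \<xi>)) + u (z - r *\<^sub>R (\<i> *s \<xi>)) - 4 * u z"
    using sub[OF S(1,2), of \<xi>] by blast
  obtain e where e: "0 < e" "(\<Union>x\<in>S. cball x e) \<subseteq> V"
    by (rule compact_subset_open_imp_cball_epsilon_subset[OF S(1) V S(2)])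
  \<comment> \<open>A compact thickening of the support inside \<open>V\<close>: it contains the
    supports of all the translates of \<open>h\<close> below, and \<open>u\<close> is bounded on
    it.\<close>
  define T where "T = {x + y | x y. x \<in> S \<and> y \<in> cball (0 :: complex^'n) e}"
  have T: "compact T" unfolding T_def using S(1) by (intro compact_sums) auto
  have TV: "T \<subseteq> V"
  proof
    fix z assume "z \<in> T"
    then obtain x y where "z = x + y" "x \<in> S" "norm y \<le> e" unfolding T_def by auto
    then have "z \<in> cball x e" "x \<in> S" by (auto simp: dist_norm)
    then show "z \<in> V" using e by blast
  qed
  have STI: "z \<in> T" if "z - c \<in> S" "norm c \<le> e" for z c
    unfolding T_def using that by (intro CollectI exI[of _ "z - c"] exI[of _ c]) auto
  have ST: "S \<subseteq> T" using STI[of _ 0] e by auto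
  let ?\<zeta> = "{\<xi>, \<i> *s \<xi>}"
  define R where "R = 1 + norm \<xi> + norm (\<i> *s \<xi>)"
  have R: "0 < R" "\<And>v. v \<in> ?\<zeta> \<Longrightarrow> norm v \<le> R" unfolding R_def by (auto simp: add_pos_nonneg)
  \<comment> \<open>Steps tending to 0, below \<open>r0\<close> so that the hypothesis applies, and
    below \<open>e / R\<close> so that translation by them along \<xi> and
    \<open>\<i> *s \<xi>\<close> has length at most \<open>e\<close>.\<close>
  define r where "r n = min r0 (e / R) / real (Suc n)" for n
  have rpos: "0 < r n" for n unfolding r_def using r0 e R by simp
  have rle: "r n \<le> min r0 (e / R)" for n
  proof -
    have "0 \<le> min r0 (e / R)" using r0 e R by simp
    from mult_right_mono[OF _ this, of 1 "real (Suc n)"]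
    show ?thesis unfolding r_def by (subst pos_divide_le_eq) (simp_all add: mult.commute)
  qed
  have rlim: "r \<longlonglongrightarrow> 0"
  proof -
    have "(\<lambda>n. min r0 (e / R) * (1 / real (Suc n))) \<longlonglongrightarrow> min r0 (e / R) * 0"
      by (intro tendsto_mult tendsto_const LIMSEQ_Suc[OF lim_1_over_n])
    then show ?thesis unfolding r_def by simp
  qed
  have small: "norm (r n *\<^sub>R v) \<le> e" if "v \<in> ?\<zeta>" for v n
  proof -
    have "norm (r n *\<^sub>R v) \<le> (e / R) * R"
      unfolding norm_scaleR using R(2)[OF that] rle[of n] rpos[of n] e R by (intro mult_mono) auto
    then show ?thesis using R by simp
  qed
  define D where "D v z = dir_deriv v (dir_deriv v h) z" for v z
  have Dc: "continuous_on UNIV (D v)" for v unfolding D_def using dir_deriv_differentiable(3)[OF h2] .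
  have D0: "D v z = 0" if "z \<notin> S" for v z
    unfolding D_def using dir_deriv_off_support[OF compact_imp_closed[OF S(1)]] S(3) that by metis
  have levi: "levi \<xi> h z = D \<xi> z + D (\<i> *s \<xi>) z" for z unfolding levi_def D_def ..
  have "\<exists>B. \<forall>v\<in>?\<zeta>. \<forall>z. \<bar>D v z\<bar> \<le> B"
  proof -
    have "\<exists>B. \<forall>z. \<bar>D v z\<bar> \<le> B" for v
    proof -
      have "bounded (D v ` S)"
        using compact_continuous_image[OF continuous_on_subset[OF Dc] S(1)] compact_imp_bounded by blast
      then obtain B where "\<And>z. z \<in> S \<Longrightarrow> \<bar>D v z\<bar> \<le> B" unfolding bounded_iff by auto
      then have "\<bar>D v z\<bar> \<le> max B 0" for z using D0[of z v] by (cases "z \<in> S") (auto simp: max.coboundedI1)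
      then show ?thesis by blast
    qed
    then obtain B1 B2 where "\<forall>z. \<bar>D \<xi> z\<bar> \<le> B1" "\<forall>z. \<bar>D (\<i> *s \<xi>) z\<bar> \<le> B2" by metis
    then show ?thesis by (intro exI[of _ "max B1 B2"]) (auto simp: max.coboundedI1 max.coboundedI2)
  qed
  then obtain B where B: "\<And>v z. v \<in> ?\<zeta> \<Longrightarrow> \<bar>D v z\<bar> \<le> B" by blast
  have "bounded (u ` T)"
    using compact_continuous_image[OF continuous_on_subset[OF u TV] T] compact_imp_bounded by blast
  then obtain M where M: "\<And>z. z \<in> T \<Longrightarrow> \<bar>u z\<bar> \<le> M" unfolding bounded_iff by auto
  define q where "q v n z = (h (z + r n *\<^sub>R v) + h (z - r n *\<^sub>R v) - 2 * h z) / (r n)\<^sup>2" for v n z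
  have qt: "\<exists>t. 0 < t \<and> t \<le> r n \<and> q v n z = (D v (z + t *\<^sub>R v) + D v (z - t *\<^sub>R v)) / 2" for v n z
  proof -
    obtain t where "0 < t" "t \<le> r n" "h (z + r n *\<^sub>R v) + h (z - r n *\<^sub>R v) - 2 * h z =
        (D v (z + t *\<^sub>R v) + D v (z - t *\<^sub>R v)) / 2 * (r n)\<^sup>2"
      using second_difference[OF h2 rpos[of n], of z v] unfolding D_def by blast
    then show ?thesis using rpos[of n] unfolding q_def by (intro exI[of _ t]) simp
  qed
  have qlim: "(\<lambda>n. q v n z) \<longlonglongrightarrow> D v z" for v z
  proof -
    obtain t where t: "\<And>n. 0 < t n" "\<And>n. t n \<le> r n"
      "\<And>n. q v n z = (D v (z + t n *\<^sub>R v) + D v (z - t n *\<^sub>R v)) / 2"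
      using qt[of _ v z] by metis
    have "t \<longlonglongrightarrow> 0"
      by (rule tendsto_sandwich[OF _ _ tendsto_const rlim]) (use t(2) less_imp_le[OF t(1)] in auto)
    have "isCont (D v) z" for z using Dc by (simp add: continuous_on_eq_continuous_at)
    moreover have "(\<lambda>n. z + t n *\<^sub>R v) \<longlonglongrightarrow> z" "(\<lambda>n. z - t n *\<^sub>R v) \<longlonglongrightarrow> z"
      using tendsto_add[OF tendsto_const tendsto_scaleR[OF \<open>t \<longlonglongrightarrow> 0\<close> tendsto_const], of z v]
        tendsto_diff[OF tendsto_const tendsto_scaleR[OF \<open>t \<longlonglongrightarrow> 0\<close> tendsto_const], of z v] by simp_all
    ultimately have "(\<lambda>n. D v (z + t n *\<^sub>R v)) \<longlonglongrightarrow> D v z" "(\<lambda>n. D v (z - t n *\<^sub>R v)) \<longlonglongrightarrow> D v z"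
      by (auto intro: isCont_tendsto_compose)
    then have "(\<lambda>n. (D v (z + t n *\<^sub>R v) + D v (z - t n *\<^sub>R v)) / 2) \<longlonglongrightarrow> (D v z + D v z) / 2"
      by (intro tendsto_divide tendsto_add tendsto_const) auto
    then show ?thesis unfolding t(3) by simp
  qed
  have qB: "\<bar>q v n z\<bar> \<le> B" if v: "v \<in> ?\<zeta>" for v n z
  proof -
    obtain t where "q v n z = (D v (z + t *\<^sub>R v) + D v (z - t *\<^sub>R v)) / 2" using qt[of n v z] by blast
    moreover have "\<bar>(a + b) / 2\<bar> \<le> B" if "\<bar>a\<bar> \<le> B" "\<bar>b\<bar> \<le> B" for a b :: real
      using that by (simp add: abs_le_iff)
    ultimately show ?thesis using B[OF v] by (simp only:)
  qed
  have shift0: "h (z + c) = 0" if "z \<notin> T" "norm c \<le> e" for z c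
    using S(3)[of "z + c"] STI[of z "- c"] that by auto
  have q0: "q v n z = 0" if v: "v \<in> ?\<zeta>" and z: "z \<notin> T" for v n z
    using shift0[OF z, of "r n *\<^sub>R v"] shift0[OF z, of "- (r n *\<^sub>R v)"] shift0[OF z, of 0] small[OF v, of n] e
    unfolding q_def by simp
  have hc': "continuous_on UNIV (\<lambda>z. h (z + c))" for c
    by (intro continuous_on_compose2[OF hc] continuous_intros) auto
  have int: "integrable lborel (\<lambda>z. u z * h (z + c))" and cont: "continuous_on UNIV (\<lambda>z. u z * h (z + c))"
    if "norm c \<le> e" for c
    using continuous_compact_support[OF V u hc' T TV shift0] that by blast+
  have tr: "(\<integral>z. u z * h (z + c) \<partial>lborel) = (\<integral>z. u (z - c) * h z \<partial>lborel)"
    and tri: "integrable lborel (\<lambda>z. u (z - c) * h z)" if "norm c \<le> e" for c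
  proof -
    show "(\<integral>z. u z * h (z + c) \<partial>lborel) = (\<integral>z. u (z - c) * h z \<partial>lborel)"
      using integral_translate[OF cont[OF that], of "- c"] by simp
    have "integrable (distr lborel borel ((+) (- c))) (\<lambda>z. u z * h (z + c))"
      using int[OF that] by (simp add: lborel_distr_plus)
    then have "integrable lborel (\<lambda>z. u (- c + z) * h (- c + z + c))"
      by (subst (asm) integrable_distr_eq) (use cont[OF that] in \<open>auto intro: borel_measurable_continuous_onI\<close>)
    then show "integrable lborel (\<lambda>z. u (z - c) * h z)" by simp
  qed
  define F where "F n z = u z * (q \<xi> n z + q (\<i> *s \<xi>) n z)" for n z
  \<comment> \<open>Dominated convergence: the difference quotients vanish off \<open>T\<close> and
    are bounded by \<open>B\<close>, and \<open>u\<close> is bounded by \<open>M\<close> on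
    \<open>T\<close>. The factor 2 counts the two real directions of the complex line.\<close>
  have Flim: "(\<lambda>n. \<integral>z. F n z \<partial>lborel) \<longlonglongrightarrow> (\<integral>z. u z * levi \<xi> h z \<partial>lborel)"
  proof (rule integral_dominated_convergence[where w = "\<lambda>z. indicator T z *\<^sub>R (M * (2 * B))"])
    show "(\<lambda>z. u z * levi \<xi> h z) \<in> borel_measurable lborel"
    proof -
      have "continuous_on UNIV (\<lambda>z. u z * levi \<xi> h z)"
        unfolding levi by (rule continuous_compact_support(1)[OF V u _ S(1,2)])
          (auto simp: D0 intro!: continuous_on_add Dc)
      then show ?thesis by (simp add: borel_measurable_continuous_onI)
    qed
    show "F n \<in> borel_measurable lborel" for n
    proof -
      have "continuous_on UNIV (q v n)" for v
        unfolding q_def using rpos[of n] hc'[of "r n *\<^sub>R v"] hc'[of "- (r n *\<^sub>R v)"] hc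
        by (intro continuous_on_divide continuous_on_diff continuous_on_add continuous_on_mult continuous_on_const) auto
      then have "continuous_on UNIV (F n)"
        unfolding F_def by (intro continuous_compact_support(1)[OF V u _ T TV] continuous_on_add) (auto simp: q0)
      then show ?thesis by (simp add: borel_measurable_continuous_onI)
    qed
    show "integrable lborel (\<lambda>z. indicator T z *\<^sub>R (M * (2 * B)))"
      by (rule borel_integrable_compact[OF T]) simp
    show "AE z in lborel. (\<lambda>n. F n z) \<longlonglongrightarrow> u z * levi \<xi> h z"
      unfolding F_def levi by (intro AE_I2 tendsto_intros qlim)
    show "AE z in lborel. norm (F n z) \<le> indicator T z *\<^sub>R (M * (2 * B))" for n
    proof (rule AE_I2)
      fix z
      show "norm (F n z) \<le> indicator T z *\<^sub>R (M * (2 * B))"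
      proof (cases "z \<in> T")
        case True
        have "\<bar>q \<xi> n z + q (\<i> *s \<xi>) n z\<bar> \<le> 2 * B" using qB[of \<xi> n z] qB[of "\<i> *s \<xi>" n z] by auto
        then have "\<bar>u z\<bar> * \<bar>q \<xi> n z + q (\<i> *s \<xi>) n z\<bar> \<le> M * (2 * B)"
          using M[OF True] by (intro mult_mono) auto
        then show ?thesis using True by (simp add: F_def abs_mult)
      qed (simp add: F_def q0)
    qed
  qed
  \<comment> \<open>Translation invariance of the integral moves the shifts from \<open>h\<close> to
    \<open>u\<close>. On \<open>S\<close> the hypothesis bounds the resulting four-point sum below
    by \<open>- C * r n ^ 3\<close>, and \<open>h \<ge> 0\<close> preserves this; dividing by the
    square of \<open>r n\<close> leaves a bound tending to 0.\<close>
  have Fge: "- C * r n * (\<integral>z. h z \<partial>lborel) \<le> (\<integral>z. F n z \<partial>lborel)" for n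
  proof -
    let ?a = "r n *\<^sub>R \<xi>" and ?b = "r n *\<^sub>R (\<i> *s \<xi>)"
    have ab: "norm ?a \<le> e" "norm ?b \<le> e" "norm (- ?a) \<le> e" "norm (- ?b) \<le> e"
      using small[of \<xi> n] small[of "\<i> *s \<xi>" n] by simp_all
    have inth: "integrable lborel h"
      using continuous_compact_support(2)[OF V continuous_on_const hc S(1,2), of 1] S(3) by simp
    have int0: "integrable lborel (\<lambda>z. u z * h z)" using int[of 0] e by simp
    note ints = tri[OF ab(1)] tri[OF ab(2)] tri[OF ab(3)] tri[OF ab(4)] int0
    have "(\<integral>z. F n z \<partial>lborel) = (\<integral>z. (u z * h (z + ?a) + u z * h (z + - ?a) + u z * h (z + ?b) + u z * h (z + - ?b) - 4 * (u z * h z)) / (r n)\<^sup>2 \<partial>lborel)"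
      unfolding F_def q_def by (intro Bochner_Integration.integral_cong refl) (simp add: field_simps add_divide_distrib diff_divide_distrib)
    also have "\<dots> = ((\<integral>z. u z * h (z + ?a) \<partial>lborel) + (\<integral>z. u z * h (z + - ?a) \<partial>lborel) + (\<integral>z. u z * h (z + ?b) \<partial>lborel)
        + (\<integral>z. u z * h (z + - ?b) \<partial>lborel) - 4 * (\<integral>z. u z * h z \<partial>lborel)) / (r n)\<^sup>2"
      using int[OF ab(1)] int[OF ab(2)] int[OF ab(3)] int[OF ab(4)] int0 by simp
    also have "\<dots> = (\<integral>z. (u (z - ?a) * h z + u (z - - ?a) * h z + u (z - ?b) * h z + u (z - - ?b) * h z - 4 * (u z * h z)) / (r n)\<^sup>2 \<partial>lborel)"
      unfolding tr[OF ab(1)] tr[OF ab(2)] tr[OF ab(3)] tr[OF ab(4)] using ints by simp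
    also have "\<dots> \<ge> (\<integral>z. (- C * r n) * h z \<partial>lborel)"
    proof (rule integral_mono)
      show "integrable lborel (\<lambda>z. (- C * r n) * h z)" using inth by simp
      show "integrable lborel (\<lambda>z. (u (z - ?a) * h z + u (z - - ?a) * h z + u (z - ?b) * h z + u (z - - ?b) * h z - 4 * (u z * h z)) / (r n)\<^sup>2)"
        using ints by simp
      fix z
      show "(- C * r n) * h z \<le> (u (z - ?a) * h z + u (z - - ?a) * h z + u (z - ?b) * h z + u (z - - ?b) * h z - 4 * (u z * h z)) / (r n)\<^sup>2"
      proof (cases "z \<in> S")
        case True
        have "- C * r n ^ 3 \<le> u (z + ?a) + u (z - ?a) + u (z + ?b) + u (z - ?b) - 4 * u z"
          using C[OF True rpos[of n]] rle[of n] by simp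
        then have "- C * r n ^ 3 * h z \<le> (u (z + ?a) + u (z - ?a) + u (z + ?b) + u (z - ?b) - 4 * u z) * h z"
          using h0 by (intro mult_right_mono)
        then have "(- C * r n) * h z * (r n)\<^sup>2 \<le> u (z - ?a) * h z + u (z - - ?a) * h z + u (z - ?b) * h z + u (z - - ?b) * h z - 4 * (u z * h z)"
          by (simp add: algebra_simps power2_eq_square power3_eq_cube)
        then show ?thesis using rpos[of n] by (simp add: pos_le_divide_eq)
      qed (simp add: S(3))
    qed
    finally show ?thesis using inth by simp
  qed
  have "(\<lambda>n. - C * r n * (\<integral>z. h z \<partial>lborel)) \<longlonglongrightarrow> - C * 0 * (\<integral>z. h z \<partial>lborel)"
    by (intro tendsto_mult tendsto_const rlim)
  then have "- C * 0 * (\<integral>z. h z \<partial>lborel) \<le> (\<integral>z. u z * levi \<xi> h z \<partial>lborel)"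
    by (rule LIMSEQ_le[OF _ Flim]) (use Fge in blast)
  then show "0 \<le> (\<integral>z. u z * levi \<xi> h z \<partial>lborel)" by simp
qed

section \<open>Maxima of logarithms of holomorphic functions\<close>

lemma has_field_derivative_along_line:
  fixes f :: "complex^'n::finite \<Rightarrow> complex"
  assumes "(f has_derivative (\<lambda>v. \<Sum>i\<in>UNIV. c $ i * v $ i)) (at (z + w *s \<xi>))"
  shows "((\<lambda>w. f (z + w *s \<xi>)) has_field_derivative (\<Sum>i\<in>UNIV. c $ i * \<xi> $ i)) (at w)"
proof -
  have "linear (\<lambda>w. w *s \<xi>)"
    by (rule linearI) (simp_all add: vec_eq_iff distrib_right)
  then have "((\<lambda>w. z + w *s \<xi>) has_derivative (\<lambda>w. w *s \<xi>)) (at w)"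
    using has_derivative_add[OF has_derivative_const linear_imp_has_derivative, of "\<lambda>w. w *s \<xi>" z "at w"] by simp
  from has_derivative_compose[OF this assms]
  have "((\<lambda>w. f (z + w *s \<xi>)) has_derivative (\<lambda>w. \<Sum>i\<in>UNIV. c $ i * (w *s \<xi>) $ i)) (at w)" .
  moreover have "(\<lambda>w. \<Sum>i\<in>UNIV. c $ i * (w *s \<xi>) $ i) = (*) (\<Sum>i\<in>UNIV. c $ i * \<xi> $ i)"
    by (simp add: fun_eq_iff sum_distrib_left sum_distrib_right mult_ac)
  ultimately show ?thesis by (simp add: has_field_derivative_def)
qed

lemma holomorphic_fun_on_imp_continuous_on:
  "holomorphic_fun_on V f \<Longrightarrow> continuous_on V f"
  unfolding holomorphic_fun_on_def
  by (meson continuous_at_imp_continuous_on has_derivative_continuous)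

lemma continuous_on_Max_norm:
  fixes f :: "'i \<Rightarrow> 'a::topological_space \<Rightarrow> complex"
  assumes "finite I" "I \<noteq> {}" "\<And>i. i \<in> I \<Longrightarrow> continuous_on V (f i)"
  shows "continuous_on V (\<lambda>z. Max ((\<lambda>i. cmod (f i z)) ` I))"
  using assms
proof (induction I rule: finite_ne_induct)
  case (insert i I)
  then show ?case by (simp add: continuous_on_max continuous_on_norm)
qed (simp add: continuous_on_norm)

text \<open>
  Fourth roots of unity: the Taylor polynomial of degree two cancels from the sum, as
  \<open>\<Sum> w = \<Sum> w\<^sup>2 = 0\<close> over \<open>w = r, -r, ir, -ir\<close>.
\<close>

lemma four_point_estimate:
  fixes G :: "complex \<Rightarrow> complex"
  assumes \<rho>: "0 < \<rho>" and G: "G holomorphic_on ball 0 \<rho>" and B: "\<And>w. w \<in> ball 0 \<rho> \<Longrightarrow> cmod (G w) \<le> B"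
    and G0: "G 0 = 0" and r: "0 < r" "r < \<rho> / 2"
  shows "- (768 * B / \<rho> ^ 3) * r ^ 3 \<le> Re (G r) + Re (G (- complex_of_real r)) + Re (G (\<i> * r)) + Re (G (- (\<i> * r)))"
proof -
  \<comment> \<open>Cauchy's bound for the third derivative on the half disc: discs of radius
    \<open>\<rho> / 4\<close> about its points stay inside the disc of radius \<rho>.\<close>
  define B3 where "B3 = fact 3 * B / (\<rho> / 4) ^ 3"
  let ?S = "ball (0 :: complex) (\<rho> / 2)"
  have bound: "cmod ((deriv ^^ 3) G x) \<le> B3" if x: "x \<in> ?S" for x
    unfolding B3_def
  proof (rule Cauchy_inequality)
    have sub: "cball x (\<rho> / 4) \<subseteq> ball 0 \<rho>"
    proof
      fix y assume "y \<in> cball x (\<rho> / 4)"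
      then have "dist 0 y < \<rho> / 2 + \<rho> / 4"
        using x dist_triangle[of 0 y x] by simp
      then show "y \<in> ball 0 \<rho>" using \<rho> by simp
    qed
    show "G holomorphic_on ball x (\<rho> / 4)"
      by (rule holomorphic_on_subset[OF G]) (use sub ball_subset_cball in blast)
    show "continuous_on (cball x (\<rho> / 4)) G"
      by (rule continuous_on_subset[OF holomorphic_on_imp_continuous_on[OF G] sub])
    fix y assume "cmod (x - y) = \<rho> / 4"
    then have "y \<in> cball x (\<rho> / 4)" by (simp add: dist_norm)
    then show "cmod (G y) \<le> B" using sub B by blast
  qed (use \<rho> in simp)
  have der: "((deriv ^^ i) G has_field_derivative (deriv ^^ Suc i) G x) (at x within ?S)" if "x \<in> ?S" for i x
  proof -
    have "(deriv ^^ i) G holomorphic_on ball 0 \<rho>" by (rule holomorphic_higher_deriv[OF G]) simp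
    then have "((deriv ^^ i) G has_field_derivative deriv ((deriv ^^ i) G) x) (at x)"
      by (rule holomorphic_derivI) (use that \<rho> in auto)
    then show ?thesis by (simp add: has_field_derivative_at_within)
  qed
  define T where "T w = deriv G 0 * w + (deriv ^^ 2) G 0 * w\<^sup>2 / 2" for w
  have taylor: "cmod (G w - T w) \<le> B3 * r ^ 3 / 2" if w: "cmod w = r" for w
  proof -
    have "cmod ((deriv ^^ 0) G w - (\<Sum>i\<le>2. (deriv ^^ i) G 0 * (w - 0) ^ i / fact i)) \<le> B3 * cmod (w - 0) ^ Suc 2 / fact 2"
    proof (rule complex_Taylor[where S = ?S])
      show "cmod ((deriv ^^ Suc 2) G x) \<le> B3" if "x \<in> ?S" for x
        using bound[OF that] by (simp add: numeral_3_eq_3 numeral_2_eq_2)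
    qed (use der w r \<rho> in auto)
    moreover have "(\<Sum>i\<le>2. (deriv ^^ i) G 0 * (w - 0) ^ i / fact i) = T w"
      by (simp add: numeral_2_eq_2 T_def G0)
    ultimately show ?thesis using w by (simp add: power3_eq_cube)
  qed
  have re: "Re (T w) - B3 * r ^ 3 / 2 \<le> Re (G w)" if "cmod w = r" for w
    using taylor[OF that] abs_Re_le_cmod[of "G w - T w"] by simp
  have "T r + T (- complex_of_real r) + T (\<i> * r) + T (- (\<i> * r)) = 0"
    unfolding T_def by (simp add: power_mult_distrib)
  then have "Re (T r) + Re (T (- complex_of_real r)) + Re (T (\<i> * r)) + Re (T (- (\<i> * r))) = 0"
    by (metis plus_complex.simps(1) zero_complex.simps(1))
  \<comment> \<open>Here 768 is \<open>3! * 4 ^ 3\<close> from the Cauchy bound, divided by the 2 of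
    the Taylor remainder and multiplied by the number 4 of points.\<close>
  moreover have "B3 * r ^ 3 / 2 * 4 = 768 * B / \<rho> ^ 3 * r ^ 3"
    unfolding B3_def by (simp add: fact_numeral power_divide)
  ultimately show ?thesis
    using re[of r] re[of "- complex_of_real r"] re[of "\<i> * r"] re[of "- (\<i> * r)"] r by (simp add: norm_mult)
qed

text \<open>At \<open>z\<close> choose \<open>f i\<close> reaching the maximum. Then
  \<open>u\<close> is at least \<open>2 * ln (cmod (f i))\<close> near \<open>z\<close>, with
  equality at \<open>z\<close>, and the latter is the real part of a holomorphic function along a
  complex line. So the four-point estimate bounds the differences of \<open>u\<close> from below,
  with constants uniform over \<open>S\<close>.\<close>

lemma ddc_semipositive_max_log:
  fixes V :: "(complex^'n::finite) set" and f :: "'i \<Rightarrow> complex^'n \<Rightarrow> complex"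
  assumes V: "open V" and I: "finite I" "I \<noteq> {}"
    and f: "\<And>i. i \<in> I \<Longrightarrow> holomorphic_fun_on V (f i)"
    and nz: "\<And>z. z \<in> V \<Longrightarrow> \<exists>i\<in>I. f i z \<noteq> 0"
    and u: "\<And>z. z \<in> V \<Longrightarrow> u z = 2 * ln (Max ((\<lambda>i. cmod (f i z)) ` I))"
  shows "ddc_semipositive V u"
proof -
  define \<mu> where "\<mu> z = Max ((\<lambda>i. cmod (f i z)) ` I)" for z
  have \<mu>ge: "cmod (f i z) \<le> \<mu> z" if "i \<in> I" for i z
    unfolding \<mu>_def using that I by (intro Max_ge) auto
  have \<mu>at: "\<exists>i\<in>I. \<mu> z = cmod (f i z)" for z
  proof -
    have "\<mu> z \<in> (\<lambda>i. cmod (f i z)) ` I" unfolding \<mu>_def using I by (intro Max_in) auto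
    then show ?thesis by blast
  qed
  have \<mu>pos: "0 < \<mu> z" if z: "z \<in> V" for z
  proof -
    obtain i where "i \<in> I" "f i z \<noteq> 0" using nz[OF z] by blast
    then show ?thesis using \<mu>ge[of i z] by (metis less_le_trans zero_less_norm_iff)
  qed
  have fc: "continuous_on V (f i)" if "i \<in> I" for i
    using f[OF that] by (rule holomorphic_fun_on_imp_continuous_on)
  have \<mu>c: "continuous_on V \<mu>" unfolding \<mu>_def by (rule continuous_on_Max_norm[OF I fc])
  have uc: "continuous_on V u"
  proof -
    have "continuous_on V (\<lambda>z. 2 * ln (\<mu> z))"
    proof (intro continuous_intros \<mu>c ballI)
      show "\<mu> z \<noteq> 0" if "z \<in> V" for z using \<mu>pos[OF that] by simp
    qed
    then show ?thesis by (rule continuous_on_eq) (simp add: u \<mu>_def)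
  qed
  show ?thesis
  proof (rule ddc_semipositiveI[OF V uc])
    fix S and \<xi> :: "complex^'n" assume S: "compact S" "S \<subseteq> V"
    obtain e where e: "0 < e" "(\<Union>x\<in>S. cball x e) \<subseteq> V"
      by (rule compact_subset_open_imp_cball_epsilon_subset[OF S(1) V S(2)])
    define T where "T = {x + y | x y. x \<in> S \<and> y \<in> cball (0 :: complex^'n) e}"
    have T: "compact T" unfolding T_def using S(1) by (intro compact_sums) auto
    have TI: "y \<in> T" if "z \<in> S" "dist y z \<le> e" for y z
      unfolding T_def mem_Collect_eq
      by (rule exI[of _ z], rule exI[of _ "y - z"]) (use that in \<open>auto simp: dist_norm norm_minus_commute\<close>)
    have TV: "T \<subseteq> V"
    proof
      fix z assume "z \<in> T"
      then obtain x y where "z = x + y" "x \<in> S" "norm y \<le> e" unfolding T_def by auto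
      then have "z \<in> cball x e" "x \<in> S" by (auto simp: dist_norm)
      then show "z \<in> V" using e by blast
    qed
    obtain \<delta> where \<delta>: "0 < \<delta>" "\<And>z. z \<in> S \<Longrightarrow> \<delta> \<le> \<mu> z"
    proof (cases "S = {}")
      case False
      obtain z0 where z0: "z0 \<in> S" "\<And>z. z \<in> S \<Longrightarrow> \<mu> z0 \<le> \<mu> z"
        using continuous_attains_inf[OF S(1) False continuous_on_subset[OF \<mu>c S(2)]] by blast
      then show ?thesis using \<mu>pos S(2) by (intro that[of "\<mu> z0"]) auto
    qed (use that[of 1] in auto)
    \<comment> \<open>Since the chosen \<open>f i\<close> has modulus at least \<delta> at
      \<open>z\<close>, a variation below \<open>\<delta> / 2\<close> keeps the quotient
      \<open>g\<close> within 1/2 of 1. Uniform continuity makes the radius independent of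
      \<open>z\<close>.\<close>
    have "\<forall>i\<in>I. \<exists>d>0. \<forall>y\<in>T. \<forall>z\<in>T. dist y z < d \<longrightarrow> cmod (f i y - f i z) < \<delta> / 2"
    proof
      fix i assume "i \<in> I"
      then have "uniformly_continuous_on T (f i)"
        by (intro compact_uniformly_continuous[OF continuous_on_subset[OF fc TV] T])
      then obtain d where "0 < d" "\<forall>x\<in>T. \<forall>y\<in>T. dist y x < d \<longrightarrow> dist (f i y) (f i x) < \<delta> / 2"
        using \<delta>(1) unfolding uniformly_continuous_on_def by (meson half_gt_zero)
      then show "\<exists>d>0. \<forall>y\<in>T. \<forall>z\<in>T. dist y z < d \<longrightarrow> cmod (f i y - f i z) < \<delta> / 2"
        unfolding dist_norm[of "f i _"] by blast
    qed
    from bchoice[OF this] obtain d where "\<forall>i\<in>I. 0 < d i \<and> (\<forall>y\<in>T. \<forall>z\<in>T. dist y z < d i \<longrightarrow> cmod (f i y - f i z) < \<delta> / 2)"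
      by blast
    then have d: "\<And>i. i \<in> I \<Longrightarrow> 0 < d i"
      "\<And>i y z. i \<in> I \<Longrightarrow> y \<in> T \<Longrightarrow> z \<in> T \<Longrightarrow> dist y z < d i \<Longrightarrow> cmod (f i y - f i z) < \<delta> / 2" by blast+
    define r1 where "r1 = min e (Min (d ` I))"
    have "Min (d ` I) \<le> d i" if "i \<in> I" for i using that I(1) by (intro Min_le) auto
    then have r1: "0 < r1" "r1 \<le> e" "\<And>i. i \<in> I \<Longrightarrow> r1 \<le> d i"
      unfolding r1_def using e d(1) I by (auto intro: min.coboundedI2)
    define \<rho> where "\<rho> = r1 / (1 + norm \<xi> + norm (\<i> *s \<xi>))"
    have n: "0 < 1 + norm \<xi> + norm (\<i> *s \<xi>)" by (auto simp: add_pos_nonneg)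
    have \<rho>: "0 < \<rho>" unfolding \<rho>_def using r1 n by simp
    have nrm: "norm (w *s \<xi>) < r1" if "cmod w < \<rho>" for w
    proof -
      have "w *s \<xi> = Re w *\<^sub>R \<xi> + Im w *\<^sub>R (\<i> *s \<xi>)"
        by (simp add: vec_eq_iff complex_eq_iff algebra_simps)
      then have "norm (w *s \<xi>) \<le> \<bar>Re w\<bar> * norm \<xi> + \<bar>Im w\<bar> * norm (\<i> *s \<xi>)"
        by (metis norm_triangle_ineq norm_scaleR)
      also have "\<dots> \<le> cmod w * norm \<xi> + cmod w * norm (\<i> *s \<xi>)"
        by (intro add_mono mult_right_mono abs_Re_le_cmod abs_Im_le_cmod) auto
      also have "\<dots> \<le> cmod w * (1 + norm \<xi> + norm (\<i> *s \<xi>))" by (simp add: algebra_simps)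
      also have "\<dots> < \<rho> * (1 + norm \<xi> + norm (\<i> *s \<xi>))" using that n by (intro mult_strict_right_mono)
      also have "\<dots> = r1" unfolding \<rho>_def using n by simp
      finally show ?thesis .
    qed
    have "- (2 * (768 * 5 / \<rho> ^ 3)) * r ^ 3 \<le>
        u (z + r *\<^sub>R \<xi>) + u (z - r *\<^sub>R \<xi>) + u (z + r *\<^sub>R (\<i> *s \<xi>)) + u (z - r *\<^sub>R (\<i> *s \<xi>)) - 4 * u z"
      if z: "z \<in> S" and r: "0 < r" "r \<le> \<rho> / 3" for z r
    proof -
      have zV: "z \<in> V" using z S by blast
      obtain i where i: "i \<in> I" "\<mu> z = cmod (f i z)" using \<mu>at by blast
      have fz: "\<delta> \<le> cmod (f i z)" "f i z \<noteq> 0" using \<delta>(2)[OF z] i(2) \<mu>pos[OF zV] by auto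
      have line: "z + w *s \<xi> \<in> V" "cmod (f i (z + w *s \<xi>) - f i z) < \<delta> / 2" if w: "cmod w < \<rho>" for w
      proof -
        have dz: "dist (z + w *s \<xi>) z < r1" using nrm[OF w] by (simp add: dist_norm)
        then have "z + w *s \<xi> \<in> T" using TI[OF z, of "z + w *s \<xi>"] r1 by simp
        moreover have "z \<in> T" using TI[OF z, of z] e by simp
        ultimately show "z + w *s \<xi> \<in> V" "cmod (f i (z + w *s \<xi>) - f i z) < \<delta> / 2"
          using TV d(2)[OF i(1)] dz r1(3)[OF i(1)] by auto
      qed
      define g where "g w = f i (z + w *s \<xi>) / f i z" for w
      have g1: "cmod (g w - 1) < 1 / 2" if "cmod w < \<rho>" for w
      proof -
        have "g w - 1 = (f i (z + w *s \<xi>) - f i z) / f i z" unfolding g_def using fz by (simp add: field_simps)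
        then have "cmod (g w - 1) = cmod (f i (z + w *s \<xi>) - f i z) / cmod (f i z)" by (simp add: norm_divide)
        also have "\<dots> < (\<delta> / 2) / cmod (f i z)"
          using line(2)[OF that] fz by (intro divide_strict_right_mono) auto
        also have "\<dots> \<le> (\<delta> / 2) / \<delta>" using fz \<delta>(1) by (intro divide_left_mono) auto
        finally show ?thesis using \<delta>(1) by simp
      qed
      have gre: "1 / 2 < Re (g w)" "cmod (g w) < 3 / 2" "1 / 2 < cmod (g w)" if "cmod w < \<rho>" for w
      proof -
        show "1 / 2 < Re (g w)" using g1[OF that] abs_Re_le_cmod[of "g w - 1"] by simp
        then show "1 / 2 < cmod (g w)" using complex_Re_le_cmod[of "g w"] by linarith
        show "cmod (g w) < 3 / 2" using g1[OF that] norm_triangle_ineq[of "g w - 1" 1] by simp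
      qed
      have gh: "g holomorphic_on ball 0 \<rho>"
        unfolding holomorphic_on_open[OF open_ball]
      proof
        fix w :: complex assume "w \<in> ball 0 \<rho>"
        then have "z + w *s \<xi> \<in> V" using line(1)[of w] by simp
        then obtain c where "(f i has_derivative (\<lambda>v. \<Sum>j\<in>UNIV. c $ j * v $ j)) (at (z + w *s \<xi>))"
          using f[OF i(1)] unfolding holomorphic_fun_on_def by blast
        from DERIV_cdivide[OF has_field_derivative_along_line[OF this]]
        show "\<exists>f'. (g has_field_derivative f') (at w)" unfolding g_def by blast
      qed
      define G where "G w = Ln (g w)" for w
      have Gh: "G holomorphic_on ball 0 \<rho>"
        unfolding G_def
      proof (rule holomorphic_on_Ln'[OF _ gh])
        fix w :: complex assume "w \<in> ball 0 \<rho>"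
        then have "1 / 2 < Re (g w)" using gre(1)[of w] by simp
        then show "g w \<notin> \<real>\<^sub>\<le>\<^sub>0" by (auto simp: complex_nonpos_Reals_iff)
      qed
      have ReG: "Re (G w) = ln (cmod (g w))" if "cmod w < \<rho>" for w
        unfolding G_def using gre(3)[OF that] by (intro Re_Ln) auto
      \<comment> \<open>The imaginary part is at most \<pi> < 4 in absolute value; the real part is
        at most 1, because the modulus of \<open>g w\<close> lies between 1/2 and 3/2.\<close>
      have GB: "cmod (G w) \<le> 5" if "w \<in> ball 0 \<rho>" for w
      proof -
        have w: "cmod w < \<rho>" using that by simp
        have g0: "g w \<noteq> 0" using gre(3)[OF w] by auto
        have "\<bar>Im (G w)\<bar> \<le> 4" unfolding G_def
          using mpi_less_Im_Ln[OF g0] Im_Ln_le_pi[OF g0] pi_less_4 by linarith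
        moreover have "\<bar>Re (G w)\<bar> \<le> 1"
        proof -
          have "ln (cmod (g w)) \<le> cmod (g w) - 1" using gre(3)[OF w] by (intro ln_le_minus_one) auto
          moreover have "ln (1 / cmod (g w)) \<le> 1 / cmod (g w) - 1" using gre(3)[OF w] by (intro ln_le_minus_one) auto
          moreover have "1 / cmod (g w) \<le> 2" using gre(3)[OF w] by (simp add: divide_le_eq)
          moreover have "ln (1 / cmod (g w)) = - ln (cmod (g w))" using gre(3)[OF w] by (simp add: ln_div)
          ultimately show ?thesis unfolding ReG[OF w] using gre(2)[OF w] by linarith
        qed
        ultimately show ?thesis using cmod_le[of "G w"] by linarith
      qed
      have "G 0 = 0" unfolding G_def g_def using fz by simp
      from four_point_estimate[OF \<rho> Gh GB this r(1)]
      have est: "- (768 * 5 / \<rho> ^ 3) * r ^ 3 \<le> Re (G r) + Re (G (- complex_of_real r)) + Re (G (\<i> * r)) + Re (G (- (\<i> * r)))"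
        using r \<rho> by simp
      \<comment> \<open>The maximum dominates \<open>f i\<close> at the moved point and equals it at
        \<open>z\<close>; the factor 2 is that of the potential.\<close>
      have lower: "u z + 2 * Re (G w) \<le> u (z + w *s \<xi>)" if w: "cmod w < \<rho>" for w
      proof -
        have gw: "0 < cmod (g w)" using gre(3)[OF w] by linarith
        have "f i (z + w *s \<xi>) = f i z * g w" unfolding g_def using fz by simp
        then have eq: "cmod (f i (z + w *s \<xi>)) = cmod (f i z) * cmod (g w)" by (simp add: norm_mult)
        have "ln (cmod (f i (z + w *s \<xi>))) = ln (cmod (f i z)) + ln (cmod (g w))"
          unfolding eq using gw fz(2) by (intro ln_mult_pos) simp_all
        moreover have "0 < cmod (f i (z + w *s \<xi>))" unfolding eq using gw fz(2) by simp
        then have "ln (cmod (f i (z + w *s \<xi>))) \<le> ln (\<mu> (z + w *s \<xi>))"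
          using \<mu>ge[OF i(1), of "z + w *s \<xi>"] \<mu>pos[OF line(1)[OF w]] by (subst ln_le_cancel_iff) simp_all
        ultimately show ?thesis
          using u[OF zV] u[OF line(1)[OF w]] ReG[OF w] i(2) unfolding \<mu>_def by simp
      qed
      have eqs: "z + complex_of_real r *s \<xi> = z + r *\<^sub>R \<xi>" "z + (- complex_of_real r) *s \<xi> = z - r *\<^sub>R \<xi>"
        "z + (\<i> * complex_of_real r) *s \<xi> = z + r *\<^sub>R (\<i> *s \<xi>)" "z + (- (\<i> * complex_of_real r)) *s \<xi> = z - r *\<^sub>R (\<i> *s \<xi>)"
        by (simp_all add: vec_eq_iff scaleR_conv_of_real[where 'a = complex] mult_ac)
      have c: "cmod (complex_of_real r) < \<rho>" "cmod (- complex_of_real r) < \<rho>"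
        "cmod (\<i> * complex_of_real r) < \<rho>" "cmod (- (\<i> * complex_of_real r)) < \<rho>"
        using r \<rho> by (simp_all add: norm_mult)
      show ?thesis
        using lower[OF c(1)] lower[OF c(2)] lower[OF c(3)] lower[OF c(4)] est
          mult.assoc[of 2 "- (768 * 5 / \<rho> ^ 3)" "r ^ 3"] unfolding eqs by simp
    qed
    then show "\<exists>C. \<exists>r0>0. \<forall>z\<in>S. \<forall>r. 0 < r \<and> r \<le> r0 \<longrightarrow> - C * r ^ 3 \<le>
        u (z + r *\<^sub>R \<xi>) + u (z - r *\<^sub>R \<xi>) + u (z + r *\<^sub>R (\<i> *s \<xi>)) + u (z - r *\<^sub>R (\<i> *s \<xi>)) - 4 * u z"
      using \<rho> by (intro exI[of _ "2 * (768 * 5 / \<rho> ^ 3)"] exI[of _ "\<rho> / 3"]) auto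
  qed
qed

text \<open>A chart controls only the functions in \<open>A\<close>. Near a given point
  \<open>q\<close> is a quotient of two of them, with a denominator that remains nonzero in a
  neighbourhood; the fraction may change from point to point.\<close>

lemma holomorphic_fun_on_regular:
  fixes g :: "complex^'n::finite \<Rightarrow> 'k::field cpoint"
  assumes V: "open V" and A: "is_subring A" and spec: "\<And>z. z \<in> V \<Longrightarrow> fst (g z) \<in> spec_rings A"
    and pt: "\<And>z. z \<in> V \<Longrightarrow> g z \<in> points_over X UNIV"
    and hol: "\<And>f. f \<in> A \<Longrightarrow> holomorphic_fun_on V (\<lambda>z. snd (g z) f)"
    and q: "\<And>z. z \<in> V \<Longrightarrow> q \<in> fst (g z)"
  shows "holomorphic_fun_on V (\<lambda>z. snd (g z) q)"
  unfolding holomorphic_fun_on_def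
proof
  fix z0 assume z0: "z0 \<in> V"
  have sub: "A \<subseteq> fst (g z)" if "z \<in> V" for z
    using spec[OF that] subset_localize[OF A] unfolding spec_rings_def by blast
  have hom: "ring_hom_on (fst (g z)) (snd (g z))"
    "\<And>r. r \<in> fst (g z) \<Longrightarrow> snd (g z) r = 0 \<longleftrightarrow> r \<in> max_ideal (fst (g z))" if "z \<in> V" for z
    using pt[OF that] unfolding points_over_def by auto
  obtain p where p: "is_prime_ideal A p" "fst (g z0) = localize A p"
    using spec[OF z0] unfolding spec_rings_def by blast
  obtain a b where ab: "q = a / b" "a \<in> A" "b \<in> A" "b \<notin> p" using q[OF z0] p(2) localizeE by metis
  let ?a = "\<lambda>z. snd (g z) a" and ?b = "\<lambda>z. snd (g z) b"
  have b0: "?b z0 \<noteq> 0"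
    using hom(2)[OF z0, of b] sub[OF z0] ab localize_unit_iff[OF A p(1) ab(3)] p(2) by auto
  have "b \<noteq> 0" using ab(4) prime_ideal_zero[OF p(1)] by auto
  define N where "N = V \<inter> ?b -` (- {0})"
  have N: "open N"
    unfolding N_def
    by (rule continuous_open_preimage[OF holomorphic_fun_on_imp_continuous_on[OF hol[OF ab(3)]] V]) auto
  have z0N: "z0 \<in> N" unfolding N_def using z0 b0 by simp
  have eq: "?a z / ?b z = snd (g z) q" if "z \<in> N" for z
  proof -
    have z: "z \<in> V" "?b z \<noteq> 0" using that unfolding N_def by auto
    have "snd (g z) (q * b) = snd (g z) q * ?b z"
      using ring_hom_onD(3)[OF hom(1)[OF z(1)] q[OF z(1)]] sub[OF z(1)] ab(3) by blast
    then show ?thesis using z(2) ab(1) \<open>b \<noteq> 0\<close> by simp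
  qed
  obtain ca where ca: "(?a has_derivative (\<lambda>v. \<Sum>i\<in>UNIV. ca $ i * v $ i)) (at z0)"
    using hol[OF ab(2)] z0 unfolding holomorphic_fun_on_def by blast
  obtain cb where cb: "(?b has_derivative (\<lambda>v. \<Sum>i\<in>UNIV. cb $ i * v $ i)) (at z0)"
    using hol[OF ab(3)] z0 unfolding holomorphic_fun_on_def by blast
  have "((\<lambda>z. ?a z / ?b z) has_derivative
      (\<lambda>v. ((\<Sum>i\<in>UNIV. ca $ i * v $ i) * ?b z0 - ?a z0 * (\<Sum>i\<in>UNIV. cb $ i * v $ i)) / (?b z0 * ?b z0))) (at z0)"
    by (rule has_derivative_divide'[OF ca cb b0])
  also have "(\<lambda>v :: complex^'n. ((\<Sum>i\<in>UNIV. ca $ i * v $ i) * ?b z0 - ?a z0 * (\<Sum>i\<in>UNIV. cb $ i * v $ i)) / (?b z0 * ?b z0))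
      = (\<lambda>v. \<Sum>i\<in>UNIV. (\<chi> i. (ca $ i * ?b z0 - ?a z0 * cb $ i) / (?b z0 * ?b z0)) $ i * v $ i)"
    unfolding sum_distrib_right sum_distrib_left sum_subtractf[symmetric] sum_divide_distrib vec_lambda_beta times_divide_eq_left
    by (intro ext sum.cong refl arg_cong2[of _ _ _ _ "(/)"]) (simp_all add: algebra_simps)
  finally have "((\<lambda>z. snd (g z) q) has_derivative
      (\<lambda>v. \<Sum>i\<in>UNIV. (\<chi> i. (ca $ i * ?b z0 - ?a z0 * cb $ i) / (?b z0 * ?b z0)) $ i * v $ i)) (at z0)"
    by (rule has_derivative_transform_within_open[OF _ N z0N]) (rule eq)
  then show "\<exists>c :: complex^'n. ((\<lambda>z. snd (g z) q) has_derivative (\<lambda>v. \<Sum>i\<in>UNIV. c $ i * v $ i)) (at z0)" by blast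
qed

text \<open>For a frame \<open>e\<close> the potential is twice the logarithm of the largest modulus
  of the quotients \<open>character m ^ l / e\<close>. These are regular on the chart because
  \<open>e\<close> generates there, and by global generation they have no common zero.\<close>

lemma (in projective_toric) chern_semipositive_tensor_power:
  "chern_semipositive X (tensor_power l Dbar)"
  unfolding chern_semipositive_def fst_tensor_power
proof (intro allI impI, elim conjE)
  fix V :: "(complex^'n::{finite,linorder}) set" and g e
  assume chart: "holomorphic_chart X V g"
    and e: "\<forall>z\<in>V. e * D (fst (g z)) ^ l \<in> fst (g z) - max_ideal (fst (g z))"
  have V: "open V" and gX: "\<And>z. z \<in> V \<Longrightarrow> g z \<in> points_over X UNIV"
    using chart unfolding holomorphic_chart_def by auto
  obtain A where A: "affine_open X A" "\<forall>z\<in>V. fst (g z) \<in> spec_rings A"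
    "\<forall>f\<in>A. holomorphic_fun_on V (\<lambda>z. snd (g z) f)"
    using chart unfolding holomorphic_chart_def by blast
  have As: "is_subring A" using A(1) is_subring_hull unfolding affine_open_def by auto
  define f where "f m z = snd (g z) (character m ^ l / e)" for m z
  have q: "character m ^ l / e \<in> fst (g z)"
    and fz: "f m z * snd (g z) (e * D (fst (g z)) ^ l) = snd (g z) (character m * D (fst (g z))) ^ l"
    and ez: "snd (g z) (e * D (fst (g z)) ^ l) \<noteq> 0"
    if z: "z \<in> V" and m: "m \<in> lattice_points" for z m
  proof -
    let ?R = "fst (g z)"
    note x = points_overD[OF gX[OF z]]
    have eu: "e * D ?R ^ l \<in> ?R - max_ideal ?R" using e z by blast
    have "D ?R \<noteq> 0" by (rule divisor_nonzero[OF x(1)])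
    then have eq: "(character m * D ?R) ^ l * inverse (e * D ?R ^ l) = character m ^ l / e"
      using unit_nonzero[OF eu] by (simp add: power_mult_distrib divide_inverse)
    have cm: "character m * D ?R \<in> ?R" by (rule lattice_point_section[OF x(1) m])
    have "inverse (e * D ?R ^ l) \<in> ?R" using eu unfolding unit_inverse by blast
    then show 1: "character m ^ l / e \<in> ?R"
      using subring_mult[OF x(3) subring_power[OF x(3) cm]] unfolding eq[symmetric] by blast
    have "snd (g z) ((character m ^ l / e) * (e * D ?R ^ l)) = f m z * snd (g z) (e * D ?R ^ l)"
      unfolding f_def using ring_hom_onD(3)[OF x(2) 1] eu by blast
    moreover have "(character m ^ l / e) * (e * D ?R ^ l) = (character m * D ?R) ^ l"
      using unit_nonzero[OF eu] by (simp add: power_mult_distrib)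
    ultimately show "f m z * snd (g z) (e * D ?R ^ l) = snd (g z) (character m * D ?R) ^ l"
      using ring_hom_on_power[OF x(2,3) cm] by simp
    show "snd (g z) (e * D ?R ^ l) \<noteq> 0" using x(4) eu by blast
  qed
  have hol: "holomorphic_fun_on V (f m)" if "m \<in> lattice_points" for m
    unfolding f_def
  proof (rule holomorphic_fun_on_regular[OF V As])
    show "fst (g z) \<in> spec_rings A" if "z \<in> V" for z using A(2) that by blast
    show "holomorphic_fun_on V (\<lambda>z. snd (g z) f)" if "f \<in> A" for f using A(3) that by blast
  qed (rule gX, assumption, rule q[OF _ that])
  have max: "Max ((\<lambda>m. cmod (f m z)) ` lattice_points) * cmod (snd (g z) (e * D (fst (g z)) ^ l)) = coord_max (g z) ^ l"
    and pos: "0 < cmod (snd (g z) (e * D (fst (g z)) ^ l))" "0 < coord_max (g z) ^ l"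
    and nz: "\<exists>m\<in>lattice_points. f m z \<noteq> 0" if z: "z \<in> V" for z
  proof -
    let ?c = "cmod (snd (g z) (e * D (fst (g z)) ^ l))"
    obtain m where m: "m \<in> lattice_points" "coord_max (g z) = cmod (snd (g z) (character m * D (fst (g z))))"
      by (rule coord_max_attained)
    show c: "0 < ?c" using ez[OF z m(1)] by simp
    show cp: "0 < coord_max (g z) ^ l" using coord_max_pos[OF gX[OF z]] by simp
    have fc: "cmod (f k z) * ?c = cmod (snd (g z) (character k * D (fst (g z)))) ^ l" if "k \<in> lattice_points" for k
      using fz[OF z that] by (metis norm_mult norm_power)
    have "cmod (f k z) \<le> cmod (f m z)" if k: "k \<in> lattice_points" for k
    proof -
      have "cmod (f k z) * ?c \<le> cmod (f m z) * ?c"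
        unfolding fc[OF k] fc[OF m(1)] m(2)[symmetric] by (intro power_mono coord_max_ge[OF k]) auto
      then show ?thesis using c by simp
    qed
    then have "Max ((\<lambda>m. cmod (f m z)) ` lattice_points) = cmod (f m z)"
      using finite_lattice_points m(1) by (intro Max_eqI) auto
    then show "Max ((\<lambda>m. cmod (f m z)) ` lattice_points) * ?c = coord_max (g z) ^ l"
      using fc[OF m(1)] m(2) by simp
    have "0 < cmod (f m z) * ?c" unfolding fc[OF m(1)] m(2)[symmetric] by (rule cp)
    then have "f m z \<noteq> 0" by auto
    then show "\<exists>m\<in>lattice_points. f m z \<noteq> 0" using m(1) by blast
  qed
  show "ddc_semipositive V (\<lambda>z. - ln ((hnorm (tensor_power l Dbar) (g z) e)\<^sup>2))"
  proof (rule ddc_semipositive_max_log[OF V finite_lattice_points lattice_points_nonempty hol nz])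
    fix z assume z: "z \<in> V"
    define c where "c = cmod (snd (g z) (e * D (fst (g z)) ^ l))"
    define M where "M = Max ((\<lambda>m. cmod (f m z)) ` lattice_points)"
    have Mc: "M * c = coord_max (g z) ^ l" "0 < c" using max[OF z] pos(1)[OF z] unfolding M_def c_def by auto
    then have "0 < M" using pos(2)[OF z] by (metis zero_less_mult_pos2)
    have "hnorm (tensor_power l Dbar) (g z) e = 1 / M"
      unfolding hnorm_canonical c_def[symmetric] Mc(1)[symmetric] using Mc(2) \<open>0 < M\<close> by simp
    then show "- ln ((hnorm (tensor_power l Dbar) (g z) e)\<^sup>2) = 2 * ln (Max ((\<lambda>m. cmod (f m z)) ` lattice_points))"
      using \<open>0 < M\<close> unfolding M_def[symmetric] by (simp add: ln_div ln_realpow power_divide)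
  qed
qed

section \<open>Algebraic integers\<close>

lemma sum_lessThan_add: "(\<Sum>j<K + k. f j) = (\<Sum>j<K. f j) + (\<Sum>j<k. f (K + j :: nat) :: 'a::comm_monoid_add)"
  by (induction k) (simp_all add: add.assoc)

text \<open>Submodules of \<open>\<int>\<^sup>N\<close> satisfy the ascending chain condition.\<close>

lemma int_vectors_dependent:
  fixes c :: "nat \<Rightarrow> nat \<Rightarrow> int"
  shows "\<exists>k m. \<forall>i<N. c k i = (\<Sum>j<k. m j * c j i)"
proof (induction N arbitrary: c)
  case (Suc N)
  \<comment> \<open>The ideal of last coordinates is generated by its least positive element
    \<open>d\<close>, already a combination of the first \<open>K\<close> vectors. Subtracting
    multiples of that combination kills the last coordinate of all later vectors, and induction
    applies to them.\<close>
  define I where "I = {t. \<exists>k m. t = (\<Sum>j<k. m j * c j N)}"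
  have comb: "a - q * b \<in> I" if ab: "a \<in> I" "b \<in> I" for a b q
  proof -
    obtain k m where a: "a = (\<Sum>j<k. m j * c j N)" using ab unfolding I_def by blast
    obtain l n where b: "b = (\<Sum>j<l. n j * c j N)" using ab unfolding I_def by blast
    have ext: "(\<Sum>j<k. m j * c j N) = (\<Sum>j<max k l. (if j < k then m j else 0) * c j N)" for k l and m :: "nat \<Rightarrow> int"
      by (rule sum.mono_neutral_cong_left) auto
    have "a - q * b = (\<Sum>j<max k l. ((if j < k then m j else 0) - q * (if j < l then n j else 0)) * c j N)"
      unfolding a b ext[of m k l] ext[of n l k] max.commute[of l k]
      by (simp add: left_diff_distrib sum_subtractf sum_distrib_left mult.assoc)
    then show ?thesis unfolding I_def
      by (intro CollectI exI[of _ "max k l"] exI[of _ "\<lambda>j. (if j < k then m j else 0) - q * (if j < l then n j else 0)"])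
  qed
  have cI: "c k N \<in> I" for k
    unfolding I_def by (intro CollectI exI[of _ "Suc k"] exI[of _ "\<lambda>j. if j = k then 1 else 0"]) simp
  have zI: "0 \<in> I" unfolding I_def by (intro CollectI exI[of _ 0]) simp
  show ?case
  proof (cases "\<forall>k. c k N = 0")
    case True
    then show ?thesis using Suc.IH[of c] by (auto simp: less_Suc_eq)
  next
    case False
    then obtain k0 where "c k0 N \<noteq> 0" by blast
    moreover have "- c k0 N \<in> I" using comb[OF zI cI[of k0], of 1] by simp
    ultimately have "\<exists>n::nat. 0 < n \<and> int n \<in> I"
      using cI[of k0] by (intro exI[of _ "nat \<bar>c k0 N\<bar>"]) (auto simp: abs_if)
    then obtain d :: nat where d: "0 < d" "int d \<in> I" and least: "\<And>n. n < d \<Longrightarrow> \<not> (0 < n \<and> int n \<in> I)"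
      using exists_least_iff[of "\<lambda>n. 0 < n \<and> int n \<in> I"] by blast
    obtain K \<mu> where K: "int d = (\<Sum>j<K. \<mu> j * c j N)" using d(2) unfolding I_def by blast
    define q where "q k = c k N div int d" for k
    have q: "c k N = q k * int d" for k
    proof -
      have "c k N - q k * int d = c k N mod int d" unfolding q_def by (simp add: minus_div_mult_eq_mod)
      then have "c k N mod int d \<in> I" using comb[OF cI[of k] d(2), of "q k"] by simp
      moreover have "0 \<le> c k N mod int d" "c k N mod int d < int d" using d by simp_all
      moreover have "t = 0" if "t \<in> I" "0 \<le> t" "t < int d" for t
        using least[of "nat t"] that by (cases "t = 0") (auto simp: nat_less_iff)
      ultimately have "c k N mod int d = 0" by blast
      then show ?thesis unfolding q_def by (simp add: dvd_eq_mod_eq_0)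
    qed
    define c' where "c' k i = c (K + k) i - q (K + k) * (\<Sum>j<K. \<mu> j * c j i)" for k i
    obtain k m where km: "\<forall>i<N. c' k i = (\<Sum>j<k. m j * c' j i)" using Suc.IH[of c'] by blast
    have "c' j N = 0" for j unfolding c'_def using K q by simp
    then have km': "c' k i = (\<Sum>j<k. m j * c' j i)" if "i < Suc N" for i
      using km that by (cases "i = N") auto
    \<comment> \<open>The relation among the modified vectors, shifted by \<open>K\<close>; the
      first \<open>K\<close> multipliers collect the subtracted multiples of the combination
      \<mu>.\<close>
    define m' where "m' j = (if j < K then (q (K + k) - (\<Sum>l<k. m l * q (K + l))) * \<mu> j else m (j - K))" for j
    have "c (K + k) i = (\<Sum>j<K + k. m' j * c j i)" if i: "i < Suc N" for i
    proof -
      let ?s = "\<Sum>j<K. \<mu> j * c j i"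
      have "c (K + k) i = q (K + k) * ?s + (\<Sum>j<k. m j * c' j i)"
        using km'[OF i] unfolding c'_def[of k] by simp
      also have "(\<Sum>j<k. m j * c' j i) = (\<Sum>j<k. m j * c (K + j) i) - (\<Sum>j<k. m j * q (K + j)) * ?s"
        unfolding c'_def by (simp add: right_diff_distrib sum_subtractf sum_distrib_right mult.assoc)
      also have "q (K + k) * ?s + ((\<Sum>j<k. m j * c (K + j) i) - (\<Sum>j<k. m j * q (K + j)) * ?s)
          = (q (K + k) - (\<Sum>l<k. m l * q (K + l))) * ?s + (\<Sum>j<k. m j * c (K + j) i)"
        by (simp add: algebra_simps)
      also have "\<dots> = (\<Sum>j<K + k. m' j * c j i)"
        unfolding sum_lessThan_add m'_def by (simp add: sum_distrib_left mult.assoc)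
      finally show ?thesis .
    qed
    then show ?thesis by blast
  qed
qed simp

definition zspan :: "'a::comm_ring_1 set \<Rightarrow> 'a set" where
  "zspan B = {\<Sum>b\<in>B. of_int (n b) * b | n. True}"

lemma zspan_add: "x \<in> zspan B \<Longrightarrow> y \<in> zspan B \<Longrightarrow> x + y \<in> zspan B"
proof -
  assume "x \<in> zspan B" "y \<in> zspan B"
  then obtain m n where "x = (\<Sum>b\<in>B. of_int (m b) * b)" "y = (\<Sum>b\<in>B. of_int (n b) * b)"
    unfolding zspan_def by blast
  then have "x + y = (\<Sum>b\<in>B. of_int ((\<lambda>b. m b + n b) b) * b)"
    by (simp add: sum.distrib distrib_right)
  then show ?thesis unfolding zspan_def by (intro CollectI exI[of _ "\<lambda>b. m b + n b"]) simp
qed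

lemma zspan_of_int_mult: "x \<in> zspan B \<Longrightarrow> of_int k * x \<in> zspan B"
proof -
  assume "x \<in> zspan B"
  then obtain m where "x = (\<Sum>b\<in>B. of_int (m b) * b)" unfolding zspan_def by blast
  then have "of_int k * x = (\<Sum>b\<in>B. of_int ((\<lambda>b. k * m b) b) * b)"
    by (simp add: sum_distrib_left mult.assoc)
  then show ?thesis unfolding zspan_def by (intro CollectI exI[of _ "\<lambda>b. k * m b"]) simp
qed

lemma zspan_zero: "0 \<in> zspan B"
  unfolding zspan_def by (intro CollectI exI[of _ "\<lambda>_. 0"]) simp

lemma zspan_base: "finite B \<Longrightarrow> b \<in> B \<Longrightarrow> b \<in> zspan B"
proof -
  assume "finite B" "b \<in> B"
  then have "b = (\<Sum>x\<in>B. of_int (if x = b then 1 else 0) * x)"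
    by (simp add: if_distrib[of of_int] if_distrib[of "\<lambda>y. y * _"] cong: if_cong)
  then show ?thesis unfolding zspan_def by (intro CollectI exI[of _ "\<lambda>x. if x = b then 1 else 0"]) simp
qed

lemma zspan_sum: "(\<And>i. i \<in> I \<Longrightarrow> f i \<in> zspan B) \<Longrightarrow> sum f I \<in> zspan B"
  by (induction I rule: infinite_finite_induct) (auto intro: zspan_zero zspan_add)

lemma zspan_mult_closed:
  assumes "\<And>b. b \<in> B \<Longrightarrow> z * b \<in> zspan B" "x \<in> zspan B"
  shows "z * x \<in> zspan B"
proof -
  obtain m where x: "x = (\<Sum>b\<in>B. of_int (m b) * b)" using assms(2) unfolding zspan_def by blast
  have "z * x = (\<Sum>b\<in>B. of_int (m b) * (z * b))"
    unfolding x sum_distrib_left by (intro sum.cong refl) (simp only: mult.left_commute)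
  then show ?thesis using zspan_sum[of B "\<lambda>b. of_int (m b) * (z * b)" B] zspan_of_int_mult assms(1) by metis
qed

lemma algebraic_intI_power:
  fixes z :: complex
  assumes "z ^ k = (\<Sum>j<k. of_int (m j) * z ^ j)"
  shows "algebraic_int z"
proof -
  define r where "r = (\<Sum>j<k. monom (of_int (m j)) j :: complex poly)"
  define p where "p = monom 1 k - r"
  have cr: "coeff r i = (if i < k then of_int (m i) else 0)" for i
    unfolding r_def coeff_sum by (simp add: sum.delta' if_distrib cong: if_cong)
  have "lead_coeff p = 1"
  proof -
    have "coeff p k = 1" by (simp add: p_def cr)
    moreover have "degree p \<le> k" by (rule degree_le) (simp add: p_def cr)
    ultimately have "degree p = k" by (metis le_antisym le_degree zero_neq_one)
    then show ?thesis using \<open>coeff p k = 1\<close> by simp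
  qed
  moreover have "\<forall>i. coeff p i \<in> \<int>" by (simp add: p_def cr)
  moreover have "poly p z = 0" using assms by (simp add: p_def r_def poly_sum poly_monom)
  ultimately show ?thesis by (rule algebraic_int.intros)
qed

lemma algebraic_intE_power:
  fixes z :: complex
  assumes "algebraic_int z"
  obtains k m where "0 < k" "z ^ k = (\<Sum>j<k. of_int (m j) * z ^ j)"
  using assms
proof cases
  case (1 p)
  define k where "k = degree p"
  have "\<forall>i. \<exists>n::int. coeff p i = of_int n" using 1(2) by (metis Ints_cases)
  then obtain n :: "nat \<Rightarrow> int" where n: "\<And>i. coeff p i = of_int (n i)" by metis
  have "k \<noteq> 0" using 1 unfolding k_def by (metis degree_0_id poly_const_conv coeff_pCons_0 lead_coeff_pCons(2) zero_neq_one degree_eq_zeroE pCons_0_0)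
  have "0 = (\<Sum>j\<le>k. coeff p j * z ^ j)" using 1(3) unfolding k_def poly_altdef by simp
  also have "\<dots> = (\<Sum>j<k. coeff p j * z ^ j) + z ^ k"
    using 1(1) unfolding k_def by (simp add: lessThan_Suc_atMost[symmetric])
  finally have "- (\<Sum>j<k. coeff p j * z ^ j) = z ^ k" by (intro minus_unique) simp
  then have "z ^ k = (\<Sum>j<k. of_int (- n j) * z ^ j)" by (simp add: n sum_negf)
  then show ?thesis using that[of k "\<lambda>j. - n j"] \<open>k \<noteq> 0\<close> by simp
qed

text \<open>The coefficient vectors of \<open>z ^ k * b0\<close> must satisfy a relation expressing
  one of them by the preceding ones. Its leading coefficient is 1, so cancelling \<open>b0\<close>
  leaves an integral equation for \<open>z\<close>; no determinant is involved.\<close>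

lemma algebraic_int_of_stable_module:
  fixes z :: complex
  assumes B: "finite B" and st: "\<And>b. b \<in> B \<Longrightarrow> z * b \<in> zspan B" and b0: "b0 \<in> B" "b0 \<noteq> 0"
  shows "algebraic_int z"
proof -
  obtain h where h: "bij_betw h {..<card B} B"
    using ex_bij_betw_nat_finite[OF B] by (auto simp: atLeast0LessThan)
  have "z ^ k * b0 \<in> zspan B" for k
    by (induction k) (use zspan_base[OF B b0(1)] zspan_mult_closed[OF st] in \<open>auto simp: mult.assoc\<close>)
  then have "\<forall>k. \<exists>n. z ^ k * b0 = (\<Sum>b\<in>B. of_int (n b) * b)" unfolding zspan_def by blast
  then obtain n where n: "\<And>k. z ^ k * b0 = (\<Sum>b\<in>B. of_int (n k b) * b)" by metis
  have n': "z ^ k * b0 = (\<Sum>i<card B. of_int (n k (h i)) * h i)" for k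
    unfolding n by (rule sum.reindex_bij_betw[OF h, symmetric])
  obtain k m where km: "\<And>i. i < card B \<Longrightarrow> n k (h i) = (\<Sum>j<k. m j * n j (h i))"
    using int_vectors_dependent[of "card B" "\<lambda>k i. n k (h i)"] by blast
  have "z ^ k * b0 = (\<Sum>i<card B. (\<Sum>j<k. of_int (m j) * of_int (n j (h i))) * h i)"
    unfolding n' by (intro sum.cong refl) (simp add: km)
  also have "\<dots> = (\<Sum>j<k. of_int (m j) * (\<Sum>i<card B. of_int (n j (h i)) * h i))"
    unfolding sum_distrib_right sum_distrib_left by (subst sum.swap) (simp only: mult.assoc)
  also have "\<dots> = (\<Sum>j<k. of_int (m j) * z ^ j) * b0"
    unfolding n'[symmetric] sum_distrib_right by (simp only: mult.assoc)
  finally have "z ^ k = (\<Sum>j<k. of_int (m j) * z ^ j)" using b0 by simp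
  then show ?thesis by (rule algebraic_intI_power)
qed

lemma algebraic_int_add_mult:
  fixes x y :: complex
  assumes "algebraic_int x" "algebraic_int y"
  shows "algebraic_int (x + y)" "algebraic_int (x * y)"
proof -
  obtain p a where p: "0 < p" "x ^ p = (\<Sum>j<p. of_int (a j) * x ^ j)"
    using algebraic_intE_power[OF assms(1)] by blast
  obtain q b where q: "0 < q" "y ^ q = (\<Sum>j<q. of_int (b j) * y ^ j)"
    using algebraic_intE_power[OF assms(2)] by blast
  \<comment> \<open>The products of powers below the two degrees span a module stable under both
    \<open>x\<close> and \<open>y\<close>; the top powers are rewritten by the integral
    equations.\<close>
  define B where "B = (\<lambda>(i, j). x ^ i * y ^ j) ` ({..<p} \<times> {..<q})"
  have B: "finite B" unfolding B_def by simp
  have mem: "x ^ i * y ^ j \<in> zspan B" if "i < p" "j < q" for i j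
    using that by (intro zspan_base[OF B]) (auto simp: B_def)
  have x: "x * c \<in> zspan B" if c: "c \<in> B" for c
  proof -
    obtain i j where ij: "c = x ^ i * y ^ j" "i < p" "j < q" using c unfolding B_def by auto
    show ?thesis
    proof (cases "Suc i < p")
      case True then show ?thesis using mem[of "Suc i" j] ij by (simp add: mult.assoc)
    next
      case False
      then have "p = Suc i" using ij by simp
      then have "x * c = x ^ p * y ^ j" using ij(1) by (simp add: mult_ac)
      also have "\<dots> = (\<Sum>l<p. of_int (a l) * (x ^ l * y ^ j))"
        unfolding p(2) sum_distrib_right by (simp only: mult.assoc)
      finally show ?thesis by (simp only:) (intro zspan_sum zspan_of_int_mult mem, use ij in auto)
    qed
  qed
  have y: "y * c \<in> zspan B" if c: "c \<in> B" for c
  proof -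
    obtain i j where ij: "c = x ^ i * y ^ j" "i < p" "j < q" using c unfolding B_def by auto
    show ?thesis
    proof (cases "Suc j < q")
      case True then show ?thesis using mem[of i "Suc j"] ij by (simp add: mult_ac)
    next
      case False
      then have "q = Suc j" using ij by simp
      then have "y * c = x ^ i * y ^ q" using ij(1) by (simp add: mult_ac)
      also have "\<dots> = (\<Sum>l<q. of_int (b l) * (x ^ i * y ^ l))"
        unfolding q(2) sum_distrib_left by (intro sum.cong refl) (simp only: mult_ac)
      finally show ?thesis by (simp only:) (intro zspan_sum zspan_of_int_mult mem, use ij in auto)
    qed
  qed
  have "1 \<in> B" using p(1) q(1) unfolding B_def by force
  show "algebraic_int (x + y)"
    by (rule algebraic_int_of_stable_module[OF B _ \<open>1 \<in> B\<close>]) (auto simp: distrib_right intro: zspan_add x y)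
  show "algebraic_int (x * y)"
    by (rule algebraic_int_of_stable_module[OF B _ \<open>1 \<in> B\<close>]) (auto simp: mult.assoc intro: zspan_mult_closed[OF x] y)
qed

lemma algebraic_int_prod:
  fixes f :: "'i \<Rightarrow> complex"
  shows "(\<And>i. i \<in> I \<Longrightarrow> algebraic_int (f i)) \<Longrightarrow> algebraic_int (prod f I)"
  by (induction I rule: infinite_finite_induct) (auto intro: algebraic_int_add_mult(2) int_imp_algebraic_int)

lemma is_subring_ring_of_integers:
  assumes "is_subring K" shows "is_subring (ring_of_integers K)"
  unfolding is_subring_def ring_of_integers_def
proof (intro conjI ballI)
  show "1 \<in> {z \<in> K. algebraic_int z}"
    using subring_one[OF assms] int_imp_algebraic_int[of 1] by simp
  fix a b assume ab: "a \<in> {z \<in> K. algebraic_int z}" "b \<in> {z \<in> K. algebraic_int z}"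
  then have "algebraic_int (a + - b)" by (intro algebraic_int_add_mult) auto
  then show "a - b \<in> {z \<in> K. algebraic_int z}" using ab subring_diff[OF assms] by simp
  show "a * b \<in> {z \<in> K. algebraic_int z}"
    using ab subring_mult[OF assms] algebraic_int_add_mult(2) by simp
qed

section \<open>Polynomials over a subfield of the complex numbers\<close>

definition is_subfield :: "complex set \<Rightarrow> bool" where
  "is_subfield F \<longleftrightarrow> is_subring F \<and> (\<forall>z\<in>F. inverse z \<in> F)"

text \<open>They remain complex polynomials, so that their roots and the coefficients in
  \<open>F\<close> live in one type.\<close>

definition polys_over :: "complex set \<Rightarrow> complex poly set" where
  "polys_over F = {p. \<forall>n. coeff p n \<in> F}"

lemma is_subfieldD: "is_subfield F \<Longrightarrow> is_subring F" "is_subfield F \<Longrightarrow> z \<in> F \<Longrightarrow> inverse z \<in> F"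
  unfolding is_subfield_def by auto

lemma is_subfield_Rats: "is_subfield \<rat>"
  unfolding is_subfield_def is_subring_def by (auto intro: Rats_diff Rats_mult Rats_inverse)

lemma Rats_subset_subfield:
  assumes "is_subfield F" shows "\<rat> \<subseteq> F"
proof
  fix x :: complex assume "x \<in> \<rat>"
  then obtain q where "x = of_rat q" by (rule Rats_cases)
  moreover obtain a b where "q = Rat.Fract a b" "b > 0" by (cases q) auto
  ultimately have "x = of_int a * inverse (of_int b)" by (simp add: of_rat_rat divide_inverse)
  then show "x \<in> F" using subring_of_int subring_mult is_subfieldD[OF assms] by metis
qed

lemma polys_over_pCons: "pCons a p \<in> polys_over F \<longleftrightarrow> a \<in> F \<and> p \<in> polys_over F"
  unfolding polys_over_def by (auto simp: coeff_pCons split: nat.splits)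

context
  fixes F :: "complex set" assumes F: "is_subring F"
begin

lemma polys_over_diff: "p \<in> polys_over F \<Longrightarrow> q \<in> polys_over F \<Longrightarrow> p - q \<in> polys_over F"
  and polys_over_add: "p \<in> polys_over F \<Longrightarrow> q \<in> polys_over F \<Longrightarrow> p + q \<in> polys_over F"
  and polys_over_smult: "c \<in> F \<Longrightarrow> p \<in> polys_over F \<Longrightarrow> smult c p \<in> polys_over F"
  and polys_over_monom: "c \<in> F \<Longrightarrow> monom c n \<in> polys_over F"
  and polys_over_pderiv: "p \<in> polys_over F \<Longrightarrow> pderiv p \<in> polys_over F"
  and polys_over_0: "0 \<in> polys_over F"
  and polys_over_1: "1 \<in> polys_over F"
  using subring_diff[OF F] subring_add[OF F] subring_mult[OF F] subring_zero[OF F] subring_one[OF F]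
    subring_sum[OF F] subring_of_nat[OF F]
  by (auto simp: polys_over_def coeff_mult coeff_pderiv simp del: of_nat_Suc)

lemma polys_over_mult: "p \<in> polys_over F \<Longrightarrow> q \<in> polys_over F \<Longrightarrow> p * q \<in> polys_over F"
  unfolding polys_over_def coeff_mult mem_Collect_eq
  by (intro allI subring_sum[OF F] subring_mult[OF F]) auto

lemma polys_over_pcompose:
  assumes "p \<in> polys_over F" "q \<in> polys_over F" shows "pcompose p q \<in> polys_over F"
  using assms(1)
proof (induction p)
  case (pCons a p)
  then show ?case
    using polys_over_add polys_over_mult assms(2) polys_over_0 by (simp add: pcompose_pCons polys_over_pCons)
qed (simp add: polys_over_0)

lemma poly_in_subring: "p \<in> polys_over F \<Longrightarrow> z \<in> F \<Longrightarrow> poly p z \<in> F"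
  unfolding poly_altdef polys_over_def
  by (intro subring_sum[OF F] subring_mult[OF F] subring_power[OF F]) auto

lemma polys_over_division:
  assumes q: "q \<in> polys_over F" "lead_coeff q = 1" and p: "p \<in> polys_over F"
  shows "\<exists>s\<in>polys_over F. \<exists>r\<in>polys_over F. p = q * s + r \<and> (r = 0 \<or> degree r < degree q)"
  using p
proof (induction "degree p" arbitrary: p rule: less_induct)
  case less
  show ?case
  proof (cases "p = 0 \<or> degree p < degree q")
    case True
    then show ?thesis using less.prems polys_over_0 by (intro bexI[of _ 0] bexI[of _ p]) auto
  next
    case False
    define m where "m = monom (lead_coeff p) (degree p - degree q)"
    have m: "m \<in> polys_over F" unfolding m_def using less.prems by (intro polys_over_monom) (simp add: polys_over_def)
    define p' where "p' = p - q * m"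
    have q0: "q \<noteq> 0" using q(2) by auto
    have p': "p' \<in> polys_over F" unfolding p'_def by (intro polys_over_diff polys_over_mult less.prems q m)
    have deg: "degree (q * m) = degree p" "lead_coeff (q * m) = lead_coeff p"
    proof -
      have m0: "m \<noteq> 0" using False unfolding m_def by simp
      have lm: "lead_coeff m = lead_coeff p" unfolding m_def by (rule lead_coeff_monom)
      show "degree (q * m) = degree p"
        unfolding degree_mult_eq[OF q0 m0] using False unfolding m_def by (simp add: degree_monom_eq)
      show "lead_coeff (q * m) = lead_coeff p" unfolding lead_coeff_mult lm q(2) by simp
    qed
    have "p' = 0 \<or> degree p' < degree p"
    proof -
      have "degree p' \<le> degree p" unfolding p'_def using deg(1) by (intro degree_diff_le) simp_all
      moreover have "coeff p' (degree p) = 0" unfolding p'_def using deg by simp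
      ultimately show ?thesis by (metis leading_coeff_0_iff le_neq_implies_less)
    qed
    then obtain s r where sr: "s \<in> polys_over F" "r \<in> polys_over F" "p' = q * s + r" "r = 0 \<or> degree r < degree q"
    proof
      assume "p' = 0"
      then show ?thesis using that[of 0 0] polys_over_0 by simp
    next
      assume "degree p' < degree p"
      then show ?thesis using less.hyps[OF _ p'] that by blast
    qed
    have "p = q * (m + s) + r" using sr(3) unfolding p'_def by (simp add: algebra_simps)
    then show ?thesis using sr polys_over_add[OF m sr(1)] by blast
  qed
qed

end

text \<open>Characterized by divisibility over \<open>F\<close>; minimality of the degree follows,
  and the property can be carried to another root in \<open>min_poly_conjugate\<close>.\<close>

definition is_min_poly :: "complex set \<Rightarrow> complex \<Rightarrow> complex poly \<Rightarrow> bool" where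
  "is_min_poly F z q \<longleftrightarrow> q \<in> polys_over F \<and> lead_coeff q = 1 \<and> poly q z = 0 \<and>
     (\<forall>p\<in>polys_over F. poly p z = 0 \<longrightarrow> (\<exists>s\<in>polys_over F. p = q * s))"

lemma min_poly_degree_pos: "is_min_poly F z q \<Longrightarrow> 0 < degree q"
  unfolding is_min_poly_def
  by (metis degree_eq_zeroE gr0I lead_coeff_pCons(2) poly_const_conv zero_neq_one)

lemma min_poly_degree_le:
  assumes "is_min_poly F z q" "p \<in> polys_over F" "poly p z = 0" "p \<noteq> 0"
  shows "degree q \<le> degree p"
proof -
  obtain s where "p = q * s" using assms unfolding is_min_poly_def by blast
  then show ?thesis using assms(4) by (simp add: degree_mult_eq)
qed

definition adjoin :: "complex set \<Rightarrow> complex \<Rightarrow> complex set" where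
  "adjoin F z = (\<lambda>p. poly p z) ` polys_over F"

text \<open>Both sides are the resultant of the monic polynomials with roots \<open>A\<close> and
  \<open>B\<close>, which is symmetric up to sign.\<close>

lemma prod_mset_differences:
  fixes A B :: "complex multiset"
  shows "(\<Prod>\<alpha>\<in>#A. \<Prod>\<beta>\<in>#B. \<alpha> - \<beta>) = (- 1) ^ (size A * size B) * (\<Prod>\<beta>\<in>#B. \<Prod>\<alpha>\<in>#A. \<beta> - \<alpha>)"
proof (induction A)
  case (add a A)
  have "(\<Prod>\<beta>\<in>#B. a - \<beta>) = (- 1) ^ size B * (\<Prod>\<beta>\<in>#B. \<beta> - a)" for B
    by (induction B) (simp_all add: algebra_simps)
  then show ?case using add by (simp add: prod_mset.distrib power_add mult_ac)
qed simp

section \<open>Minimal polynomials, simple extensions and resultants\<close>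

context
  fixes F :: "complex set" assumes F: "is_subfield F"
begin

text \<open>A generator of a nonzero ideal of polynomials, here given by the predicate \<open>P\<close>.\<close>

lemma polys_over_principal:
  assumes P: "P p0" "p0 \<noteq> 0" "\<And>p. P p \<Longrightarrow> p \<in> polys_over F"
    and add: "\<And>p q s. P p \<Longrightarrow> P q \<Longrightarrow> s \<in> polys_over F \<Longrightarrow> P (p - q * s)"
  obtains q where "P q" "lead_coeff q = 1" "\<And>p. P p \<Longrightarrow> \<exists>s\<in>polys_over F. p = q * s"
proof -
  note Fr = is_subfieldD(1)[OF F]
  have P0: "P 0" using add[OF P(1) P(1) polys_over_1[OF Fr]] by simp
  obtain q0 where q0: "P q0" "q0 \<noteq> 0" and least: "\<And>p. P p \<Longrightarrow> p \<noteq> 0 \<Longrightarrow> degree q0 \<le> degree p"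
    using ex_has_least_nat[of "\<lambda>p. P p \<and> p \<noteq> 0" p0 degree] P(1,2) by blast
  define c where "c = - inverse (lead_coeff q0)"
  have lc: "lead_coeff q0 \<noteq> 0" "lead_coeff q0 \<in> F" using q0 P(3) unfolding polys_over_def by auto
  have cF: "c \<in> F" unfolding c_def using subring_uminus[OF Fr] is_subfieldD(2)[OF F lc(2)] by blast
  define q where "q = 0 - q0 * [:c:]"
  have q: "P q" unfolding q_def
    by (rule add[OF P0 q0(1)]) (use cF polys_over_0[OF Fr] polys_over_pCons in blast)
  have qs: "q = smult (- c) q0" unfolding q_def by simp
  have lq: "lead_coeff q = 1" unfolding qs c_def using lc by (simp add: lead_coeff_smult)
  have dq: "degree q = degree q0" unfolding qs c_def using lc by simp
  have "\<exists>s\<in>polys_over F. p = q * s" if p: "P p" for p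
  proof -
    obtain s r where sr: "s \<in> polys_over F" "p = q * s + r" "r = 0 \<or> degree r < degree q"
      using polys_over_division[OF Fr P(3)[OF q] lq P(3)[OF p]] by blast
    have "P r" using add[OF p q sr(1)] sr(2) by simp
    then have "r = 0" using least[of r] sr(3) dq by fastforce
    then show ?thesis using sr by auto
  qed
  then show ?thesis using that q lq by blast
qed

lemma min_poly_exists:
  assumes "g \<in> polys_over F" "g \<noteq> 0" "poly g z = 0"
  obtains q where "is_min_poly F z q"
proof -
  note Fr = is_subfieldD(1)[OF F]
  let ?P = "\<lambda>p. p \<in> polys_over F \<and> poly p z = 0"
  have P0: "?P g" using assms by blast
  have add: "?P (p - q * s)" if "?P p" "?P q" "s \<in> polys_over F" for p q s
    using that polys_over_diff[OF Fr] polys_over_mult[OF Fr] by simp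
  obtain q where "?P q" "lead_coeff q = 1" "\<And>p. ?P p \<Longrightarrow> \<exists>s\<in>polys_over F. p = q * s"
    using polys_over_principal[of ?P g, OF P0 assms(2) conjunct1 add] by blast
  then show ?thesis using that unfolding is_min_poly_def by blast
qed

text \<open>The minimal polynomial \<open>g\<close> of \<open>w\<close> divides \<open>q\<close>.
  The cofactor has smaller degree and so does not vanish at \<open>z\<close>; thus \<open>g\<close>
  does, and everything that vanishes at \<open>w\<close> also vanishes at \<open>z\<close>.\<close>

lemma min_poly_conjugate:
  assumes q: "is_min_poly F z q" and w: "poly q w = 0"
  shows "is_min_poly F w q"
proof -
  have q': "q \<in> polys_over F" "lead_coeff q = 1" "poly q z = 0" "q \<noteq> 0"
    using q unfolding is_min_poly_def by auto
  obtain g where g: "is_min_poly F w g" using min_poly_exists[OF q'(1,4) w] by blast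
  then obtain s where s: "s \<in> polys_over F" "q = g * s" using q' w unfolding is_min_poly_def by blast
  have s0: "s \<noteq> 0" "g \<noteq> 0" using s q' by auto
  have "poly s z \<noteq> 0"
  proof
    assume "poly s z = 0"
    then have "degree q \<le> degree s" using min_poly_degree_le[OF q s(1)] s0 by blast
    then show False using s s0 min_poly_degree_pos[OF g] by (simp add: degree_mult_eq)
  qed
  then have gz: "poly g z = 0" using q'(3) s(2) by simp
  have g': "g \<in> polys_over F" using g unfolding is_min_poly_def by blast
  have "\<exists>t\<in>polys_over F. p = q * t" if p: "p \<in> polys_over F" "poly p w = 0" for p
  proof -
    obtain t where t: "t \<in> polys_over F" "p = g * t" using g p unfolding is_min_poly_def by blast
    then have "poly p z = 0" using gz by simp
    then show ?thesis using q p(1) unfolding is_min_poly_def by blast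
  qed
  then show ?thesis using q' w unfolding is_min_poly_def by blast
qed

lemma min_poly_separable:
  assumes q: "is_min_poly F z q"
  shows "poly (pderiv q) z \<noteq> 0"
proof
  assume z: "poly (pderiv q) z = 0"
  have "pderiv q \<noteq> 0" using min_poly_degree_pos[OF q] by (simp add: pderiv_eq_0_iff)
  moreover have "pderiv q \<in> polys_over F"
    using q polys_over_pderiv[OF is_subfieldD(1)[OF F]] unfolding is_min_poly_def by blast
  ultimately have "degree q \<le> degree (pderiv q)" using min_poly_degree_le[OF q _ z] by blast
  then show False using min_poly_degree_pos[OF q] by (simp add: degree_pderiv)
qed

lemma subfield_adjoin:
  assumes q: "is_min_poly F z q"
  shows "is_subfield (adjoin F z)"
proof -
  note Fr = is_subfieldD(1)[OF F]
  have "is_subring (adjoin F z)"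
    unfolding is_subring_def
  proof (intro conjI ballI)
    show "1 \<in> adjoin F z" unfolding adjoin_def using polys_over_1[OF Fr] by (intro image_eqI[of _ _ 1]) auto
    fix a b assume "a \<in> adjoin F z" "b \<in> adjoin F z"
    then obtain p r where pr: "a = poly p z" "b = poly r z" "p \<in> polys_over F" "r \<in> polys_over F"
      unfolding adjoin_def by blast
    show "a - b \<in> adjoin F z" unfolding adjoin_def
      using pr polys_over_diff[OF Fr pr(3,4)] by (intro image_eqI[of _ _ "p - r"]) auto
    show "a * b \<in> adjoin F z" unfolding adjoin_def
      using pr polys_over_mult[OF Fr pr(3,4)] by (intro image_eqI[of _ _ "p * r"]) auto
  qed
  moreover have "inverse a \<in> adjoin F z" if a: "a \<in> adjoin F z" for a
  proof (cases "a = 0")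
    case True then show ?thesis using a by simp
  next
    case False
    obtain p where p: "a = poly p z" "p \<in> polys_over F" using a unfolding adjoin_def by blast
    \<comment> \<open>The ideal generated by \<open>p\<close> and \<open>q\<close>. Its monic
      generator divides \<open>p\<close>, hence is nonzero at \<open>z\<close>, and divides
      \<open>q\<close>, hence is constant by minimality; the Bezout relation evaluated at
      \<open>z\<close> gives the inverse.\<close>
    let ?P = "\<lambda>f. \<exists>u\<in>polys_over F. \<exists>v\<in>polys_over F. f = u * p + v * q"
    have q': "q \<in> polys_over F" "lead_coeff q = 1" "poly q z = 0"
      using q unfolding is_min_poly_def by auto
    have Pp: "?P p" by (intro bexI[of _ 1] bexI[of _ 0]) (simp_all add: polys_over_0[OF Fr] polys_over_1[OF Fr])
    have Pq: "?P q" by (intro bexI[of _ 0] bexI[of _ 1]) (simp_all add: polys_over_0[OF Fr] polys_over_1[OF Fr])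
    have sub: "?P f \<Longrightarrow> f \<in> polys_over F" for f
      using polys_over_add[OF Fr] polys_over_mult[OF Fr] p q' by blast
    have add: "?P (f - g * s)" if fg: "?P f" "?P g" "s \<in> polys_over F" for f g s
    proof -
      obtain u v u' v' where "u \<in> polys_over F" "v \<in> polys_over F" "f = u * p + v * q"
        "u' \<in> polys_over F" "v' \<in> polys_over F" "g = u' * p + v' * q" using fg by blast
      then show ?thesis
        using polys_over_diff[OF Fr] polys_over_mult[OF Fr] fg(3)
        by (intro bexI[of _ "u - u' * s"] bexI[of _ "v - v' * s"]) (auto simp: algebra_simps)
    qed
    have p0: "p \<noteq> 0" using p False by auto
    obtain h where h: "?P h" "lead_coeff h = 1" "\<And>f. ?P f \<Longrightarrow> \<exists>s\<in>polys_over F. f = h * s"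
      using polys_over_principal[of ?P p, OF Pp p0 sub add] by blast
    have hz: "poly h z \<noteq> 0" using h(3)[OF Pp] False p(1) by auto
    obtain s where s: "s \<in> polys_over F" "q = h * s" using h(3)[OF Pq] by blast
    have s0: "s \<noteq> 0" "h \<noteq> 0" using s q' by auto
    have "poly s z = 0" using s(2) q'(3) hz by simp
    then have "degree q \<le> degree s" using min_poly_degree_le[OF q s(1)] s0 by blast
    then have "degree h = 0" using s s0 by (simp add: degree_mult_eq)
    then have "h = 1" using h(2) by (metis degree_0_id lead_coeff_pCons(2) degree_eq_zeroE one_pCons pCons_0_0)
    then obtain u v where uv: "u \<in> polys_over F" "1 = u * p + v * q" using h(1) by blast
    have "1 = poly u z * a" using arg_cong[OF uv(2), of "\<lambda>f. poly f z"] p(1) q'(3) by simp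
    then have "inverse a = poly u z" by (metis inverse_unique mult.commute)
    then show ?thesis unfolding adjoin_def using uv(1) by blast
  qed
  ultimately show ?thesis unfolding is_subfield_def by blast
qed

lemma adjoin_subset:
  assumes "F \<subseteq> E" "is_subring E" "z \<in> E"
  shows "adjoin F z \<subseteq> E"
  unfolding adjoin_def using poly_in_subring[OF assms(2) _ assms(3)] assms(1)
  by (auto simp: polys_over_def)

lemma base_subset_adjoin: "F \<subseteq> adjoin F z"
proof
  fix x assume "x \<in> F"
  then have "[:x:] \<in> polys_over F"
    using polys_over_pCons polys_over_0[OF is_subfieldD(1)[OF F]] by blast
  then show "x \<in> adjoin F z" unfolding adjoin_def by (intro image_eqI[of _ _ "[:x:]"]) auto
qed

lemma generator_in_adjoin: "z \<in> adjoin F z"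
proof -
  have "[:0, 1:] \<in> polys_over F"
    using polys_over_pCons polys_over_0[OF is_subfieldD(1)[OF F]]
      subring_zero[OF is_subfieldD(1)[OF F]] subring_one[OF is_subfieldD(1)[OF F]] by blast
  then show ?thesis unfolding adjoin_def by (intro image_eqI[of _ _ "[:0, 1:]"]) auto
qed

text \<open>Reciprocity of resultants reduces the degree as in Euclid's algorithm.\<close>

lemma prod_over_roots:
  assumes "q \<in> polys_over F" "lead_coeff q = 1" "p \<in> polys_over F"
  shows "(\<Prod>\<alpha>\<in>#proots q. poly p \<alpha>) \<in> F"
  using assms
proof (induction "degree q" arbitrary: p q rule: less_induct)
  case less
  note Fr = is_subfieldD(1)[OF F]
  have q0: "q \<noteq> 0" using less.prems by auto
  obtain s r where sr: "r \<in> polys_over F" "p = q * s + r" "r = 0 \<or> degree r < degree q"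
    using polys_over_division[OF Fr less.prems] by blast
  \<comment> \<open>At the roots of \<open>q\<close> the polynomial and its remainder take the same
    values.\<close>
  have pr: "image_mset (poly p) (proots q) = image_mset (poly r) (proots q)"
    by (rule image_mset_cong) (use sr(2) q0 in auto)
  show ?case
  proof (cases "r = 0")
    case True
    then have "(\<Prod>\<alpha>\<in>#proots q. poly p \<alpha>) = (if proots q = {#} then 1 else 0)"
      unfolding pr by (cases "proots q") auto
    then show ?thesis using subring_zero[OF Fr] subring_one[OF Fr] by simp
  next
    case False
    define c where "c = lead_coeff r"
    have c: "c \<noteq> 0" "c \<in> F" using False sr(1) unfolding c_def polys_over_def by auto
    define t where "t = smult (inverse c) r"
    have t: "t \<in> polys_over F" "lead_coeff t = 1" "degree t < degree q"
      using sr c False polys_over_smult[OF Fr is_subfieldD(2)[OF F c(2)] sr(1)]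
      unfolding t_def c_def by (simp_all add: lead_coeff_smult)
    have "poly r \<alpha> = c * (\<Prod>\<beta>\<in>#proots r. \<alpha> - \<beta>)" for \<alpha>
      by (subst complex_poly_decompose_multiset[of r, symmetric]) (simp add: poly_prod_mset c_def)
    moreover have "proots r = proots t" unfolding t_def using c by simp
    ultimately have r: "poly r \<alpha> = c * (\<Prod>\<beta>\<in>#proots t. \<alpha> - \<beta>)" for \<alpha> by simp
    have qe: "poly q = (\<lambda>\<beta>. \<Prod>\<alpha>\<in>#proots q. \<beta> - \<alpha>)"
      by (rule ext, subst complex_poly_decompose_multiset[of q, symmetric]) (simp add: poly_prod_mset less.prems(2))
    \<comment> \<open>Exchanging the two families of roots turns this into a product of values of
      \<open>q\<close> over the roots of \<open>t\<close>, of smaller degree, up to sign and a power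
      of the leading coefficient \<open>c\<close>; the induction hypothesis covers it.\<close>
    have "(\<Prod>\<alpha>\<in>#proots q. poly p \<alpha>) = c ^ size (proots q) * (\<Prod>\<alpha>\<in>#proots q. \<Prod>\<beta>\<in>#proots t. \<alpha> - \<beta>)"
      unfolding pr r by (simp add: prod_mset.distrib)
    also have "\<dots> = c ^ size (proots q) * ((- 1) ^ (size (proots q) * size (proots t)) * (\<Prod>\<beta>\<in>#proots t. poly q \<beta>))"
      by (subst prod_mset_differences) (simp only: qe)
    also have "\<dots> \<in> F"
      using less.hyps[OF t(3) t(1,2) less.prems(1)] c(2) subring_one[OF Fr]
      by (intro subring_mult[OF Fr] subring_power[OF Fr] subring_uminus[OF Fr])
    finally show ?thesis .
  qed
qed

end

section \<open>Number fields and their embeddings\<close>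

lemma module_rat_scale: "module rat_scale"
  by unfold_locales (simp_all add: rat_scale_def distrib_left distrib_right of_rat_add of_rat_mult mult.assoc)

lemma number_fieldD:
  assumes "number_field K" shows "is_subfield K" "is_subring K"
  using assms unfolding number_field_def is_subfield_def by auto

lemma common_denominator:
  fixes S :: "rat set"
  assumes "finite S" shows "\<exists>N::nat. 0 < N \<and> (\<forall>q\<in>S. \<exists>k::int. of_nat N * q = of_int k)"
  using assms
proof (induction S)
  case empty
  show ?case by (intro exI[of _ 1]) simp
next
  case (insert q S)
  then obtain N :: nat where N: "0 < N" "\<And>q. q \<in> S \<Longrightarrow> \<exists>k::int. of_nat N * q = of_int k" by blast
  obtain a b where ab: "q = Rat.Fract a b" "b > 0" by (cases q) auto
  have bq: "of_int b * q = of_int a" using ab by (simp add: Fract_of_int_quotient)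
  have nb: "rat_of_nat (N * nat b) = of_nat N * of_int b" using ab by simp
  have "\<exists>k::int. of_nat (N * nat b) * r = of_int k" if r: "r \<in> insert q S" for r
  proof (cases "r = q")
    case True
    have "of_nat (N * nat b) * q = of_int (int N * a)" unfolding nb mult.assoc bq by simp
    then show ?thesis unfolding True by (rule exI)
  next
    case False
    then obtain k :: int where k: "of_nat N * r = of_int k" using N(2)[of r] r by blast
    have "of_nat (N * nat b) * r = of_int b * (of_nat N * r)" unfolding nb by (simp only: mult_ac)
    then have "of_nat (N * nat b) * r = of_int (b * k)" unfolding k by simp
    then show ?thesis by (rule exI)
  qed
  then show ?case using N(1) ab(2) by (intro exI[of _ "N * nat b"]) auto
qed

text \<open>Multiplication by \<open>z\<close> is described on a finite spanning set by rational
  coefficients. A common denominator \<open>N\<close> makes them integral, so \<open>N z\<close>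
  stabilizes the subgroup spanned by that set.\<close>

lemma number_field_scaled_integral:
  assumes K: "number_field K" and z: "z \<in> K"
  obtains N :: nat where "0 < N" "algebraic_int (of_nat N * z)"
proof -
  obtain B where B: "finite B" and KB': "K = module.span rat_scale B"
    using K unfolding number_field_def by blast
  have KB: "K = range (\<lambda>u. \<Sum>b\<in>B. rat_scale (u b) b)"
    unfolding KB' by (rule module.span_finite[OF module_rat_scale B])
  have BK: "b \<in> K" if "b \<in> B" for b
  proof -
    have "b = (\<Sum>x\<in>B. rat_scale (if x = b then 1 else 0) x)"
      using B that by (simp add: rat_scale_def if_distrib[of of_rat] if_distrib[of "\<lambda>y. y * _"] cong: if_cong)
    then show ?thesis unfolding KB by (rule range_eqI[where x = "\<lambda>x. if x = b then 1 else 0"])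
  qed
  have "\<exists>b\<in>B. b \<noteq> 0"
  proof (rule ccontr)
    assume "\<not> ?thesis"
    then have "K \<subseteq> {0}" unfolding KB by (auto simp: rat_scale_def intro!: sum.neutral)
    then show False using subring_one[OF number_fieldD(2)[OF K]] by auto
  qed
  then obtain b0 where b0: "b0 \<in> B" "b0 \<noteq> 0" by blast
  have "\<forall>b\<in>B. \<exists>u. z * b = (\<Sum>c\<in>B. rat_scale (u c) c)"
  proof
    fix b assume "b \<in> B"
    then have "z * b \<in> K" by (rule subring_mult[OF number_fieldD(2)[OF K] z BK])
    then show "\<exists>u. z * b = (\<Sum>c\<in>B. rat_scale (u c) c)" unfolding KB by auto
  qed
  then obtain u where u: "\<And>b. b \<in> B \<Longrightarrow> z * b = (\<Sum>c\<in>B. rat_scale (u b c) c)" by metis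
  have fin: "finite ((\<lambda>(b, c). u b c) ` (B \<times> B))" using B by simp
  obtain N :: nat where N: "0 < N" "\<forall>q\<in>(\<lambda>(b, c). u b c) ` (B \<times> B). \<exists>k::int. of_nat N * q = of_int k"
    using common_denominator[OF fin] by blast
  then have "\<forall>b\<in>B. \<forall>c\<in>B. \<exists>k::int. of_nat N * u b c = of_int k" by auto
  then obtain k :: "complex \<Rightarrow> complex \<Rightarrow> int" where k: "\<And>b c. b \<in> B \<Longrightarrow> c \<in> B \<Longrightarrow> of_nat N * u b c = of_int (k b c)"
    by metis
  have "(of_nat N * z) * b \<in> zspan B" if b: "b \<in> B" for b
  proof -
    have "(of_nat N * z) * b = (\<Sum>c\<in>B. of_nat N * (of_rat (u b c) * c))"
      unfolding mult.assoc u[OF b] rat_scale_def sum_distrib_left ..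
    also have "\<dots> = (\<Sum>c\<in>B. of_int (k b c) * c)"
    proof (rule sum.cong[OF refl])
      fix c assume "c \<in> B"
      have "complex_of_nat N * of_rat (u b c) = of_rat (of_nat N * u b c)" by (simp add: of_rat_mult)
      also have "\<dots> = of_int (k b c)" unfolding k[OF b \<open>c \<in> B\<close>] by simp
      finally show "of_nat N * (of_rat (u b c) * c) = of_int (k b c) * c" by (simp only: mult.assoc[symmetric])
    qed
    finally show ?thesis unfolding zspan_def by blast
  qed
  then have "algebraic_int (of_nat N * z)" by (rule algebraic_int_of_stable_module[OF B _ b0])
  then show ?thesis using that N(1) by blast
qed

lemma number_field_min_poly:
  assumes K: "number_field K" and z: "z \<in> K"
  obtains q where "is_min_poly \<rat> z q"
proof -
  obtain N :: nat where N: "0 < N" "algebraic_int (of_nat N * z)"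
    by (rule number_field_scaled_integral[OF K z])
  obtain p where p: "lead_coeff p = 1" "\<forall>i. coeff p i \<in> \<int>" "poly p (of_nat N * z) = 0"
    using N(2) by (auto elim: algebraic_int.cases)
  define g where "g = pcompose p [:0, of_nat N:]"
  have "p \<in> polys_over \<rat>" unfolding polys_over_def using p(2) Ints_subset_Rats by blast
  moreover have "[:0, of_nat N:] \<in> polys_over \<rat>"
    by (simp add: polys_over_pCons polys_over_0[OF is_subfieldD(1)[OF is_subfield_Rats]])
  ultimately have "g \<in> polys_over \<rat>"
    unfolding g_def by (rule polys_over_pcompose[OF is_subfieldD(1)[OF is_subfield_Rats]])
  moreover have "g \<noteq> 0"
  proof
    assume "g = 0"
    then have "p = 0" using pcompose_eq_0[of p "[:0, of_nat N:]"] N(1) unfolding g_def by simp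
    then show False using p(1) by simp
  qed
  moreover have "poly g z = 0" unfolding g_def poly_pcompose using p(3) by (simp add: mult.commute)
  ultimately show ?thesis using min_poly_exists[OF is_subfield_Rats] that by blast
qed

text \<open>
  For all but finitely many \<open>c\<close> the polynomials \<open>g x\<close> and \<open>f (\<gamma> - c x)\<close> over \<open>\<rat>(\<gamma>)\<close>, \<open>\<gamma> = \<alpha> + c \<beta>\<close>, have
  no common root except \<open>\<beta>\<close>.
\<close>

lemma primitive_element_two:
  assumes K: "number_field K" and \<alpha>: "\<alpha> \<in> K" and \<beta>: "\<beta> \<in> K"
  obtains \<gamma> where "\<gamma> \<in> K" "\<alpha> \<in> adjoin \<rat> \<gamma>" "\<beta> \<in> adjoin \<rat> \<gamma>"
proof -
  note Q = is_subfield_Rats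
  obtain f where f: "is_min_poly \<rat> \<alpha> f" by (rule number_field_min_poly[OF K \<alpha>])
  obtain g where g: "is_min_poly \<rat> \<beta> g" by (rule number_field_min_poly[OF K \<beta>])
  have fg: "f \<in> polys_over \<rat>" "f \<noteq> 0" "poly f \<alpha> = 0" "g \<in> polys_over \<rat>" "g \<noteq> 0" "poly g \<beta> = 0"
    using f g unfolding is_min_poly_def by auto
  \<comment> \<open>The \<open>c\<close> for which \<gamma> - c b is a root \<open>a\<close> of
    \<open>f\<close>, for a root \<open>b\<close> of \<open>g\<close> other than \<beta>. For
    \<open>b\<close> equal to \<beta> the division gives 0, which merely excludes
    \<open>c = 0\<close>.\<close>
  define bad where "bad = (\<lambda>(a, b). (a - \<alpha>) / (\<beta> - b)) ` ({a. poly f a = 0} \<times> {b. poly g b = 0})"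
  have "finite bad" unfolding bad_def using poly_roots_finite fg by auto
  moreover have "infinite (range (of_nat :: nat \<Rightarrow> complex))" by (rule range_inj_infinite) (rule inj_of_nat)
  ultimately have "\<not> range (of_nat :: nat \<Rightarrow> complex) \<subseteq> bad" using finite_subset by blast
  then obtain n :: nat where n: "(of_nat n :: complex) \<notin> bad" by blast
  define c where "c = (of_nat n :: complex)"
  define \<gamma> where "\<gamma> = \<alpha> + c * \<beta>"
  have Kr: "is_subring K" by (rule number_fieldD(2)[OF K])
  have \<gamma>: "\<gamma> \<in> K" unfolding \<gamma>_def c_def
    using subring_add[OF Kr \<alpha> subring_mult[OF Kr subring_of_nat[OF Kr] \<beta>]] .
  obtain m where m: "is_min_poly \<rat> \<gamma> m" by (rule number_field_min_poly[OF K \<gamma>])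
  define E where "E = adjoin \<rat> \<gamma>"
  have E: "is_subfield E" unfolding E_def by (rule subfield_adjoin[OF Q m])
  have Er: "is_subring E" by (rule is_subfieldD(1)[OF E])
  have QE: "\<rat> \<subseteq> E" by (rule Rats_subset_subfield[OF E])
  have lift: "p \<in> polys_over E" if "p \<in> polys_over \<rat>" for p using that QE unfolding polys_over_def by blast
  have \<gamma>E: "\<gamma> \<in> E" unfolding E_def by (rule generator_in_adjoin[OF Q])
  have cE: "c \<in> E" unfolding c_def by (rule subring_of_nat[OF Er])
  define h where "h = pcompose f [:\<gamma>, - c:]"
  have "[:\<gamma>, - c:] \<in> polys_over E"
    using polys_over_pCons polys_over_0[OF Er] \<gamma>E subring_uminus[OF Er cE] by blast
  then have hE: "h \<in> polys_over E" unfolding h_def by (rule polys_over_pcompose[OF Er lift[OF fg(1)]])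
  have hp: "poly h x = poly f (\<gamma> - c * x)" for x unfolding h_def poly_pcompose by (simp add: mult.commute)
  have "poly h \<beta> = 0" unfolding hp \<gamma>_def using fg(3) by simp
  obtain q where q: "is_min_poly E \<beta> q" by (rule min_poly_exists[OF E lift[OF fg(4)] fg(5,6)])
  obtain s t where st: "g = q * s" "h = q * t"
    using q lift[OF fg(4)] hE fg(6) \<open>poly h \<beta> = 0\<close> unfolding is_min_poly_def by blast
  have root: "w = \<beta>" if "poly q w = 0" for w
  proof (rule ccontr)
    assume w: "w \<noteq> \<beta>"
    have "poly g w = 0" "poly f (\<gamma> - c * w) = 0" using that st hp[of w] by auto
    moreover have "c = ((\<gamma> - c * w) - \<alpha>) / (\<beta> - w)" using w unfolding \<gamma>_def by (simp add: field_simps)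
    ultimately have "c \<in> bad" unfolding bad_def by force
    then show False using n unfolding c_def by blast
  qed
  \<comment> \<open>Over the field generated by \<gamma>, the minimal polynomial of \<beta> has
    simple roots and no root but \<beta>. So it is linear, and its constant term puts \<beta> in
    that field.\<close>
  have "rsquarefree q" unfolding rsquarefree_roots using root min_poly_separable[OF E q] by blast
  then have "smult (lead_coeff q) (\<Prod>z|poly q z = 0. [:- z, 1:]) = q" by (rule complex_poly_decompose_rsquarefree)
  moreover have "{z. poly q z = 0} = {\<beta>}" using root q unfolding is_min_poly_def by blast
  ultimately have "q = [:- \<beta>, 1:]" using q unfolding is_min_poly_def by simp
  then have "- \<beta> \<in> E" using q polys_over_pCons unfolding is_min_poly_def by blast
  then have \<beta>E: "\<beta> \<in> E" using subring_uminus[OF Er] by force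
  have "\<alpha> = \<gamma> - c * \<beta>" unfolding \<gamma>_def by simp
  then have "\<alpha> \<in> E" using subring_diff[OF Er \<gamma>E subring_mult[OF Er cE \<beta>E]] by simp
  then show ?thesis using that \<gamma> \<beta>E unfolding E_def by blast
qed

lemma primitive_element:
  assumes K: "number_field K"
  obtains \<theta> where "\<theta> \<in> K" "algebraic_int \<theta>" "K = adjoin \<rat> \<theta>"
proof -
  note Q = is_subfield_Rats
  note Kr = number_fieldD(2)[OF K]
  have QK: "\<rat> \<subseteq> K" by (rule Rats_subset_subfield[OF number_fieldD(1)[OF K]])
  have sub: "is_subring (adjoin \<rat> \<gamma>)" if \<gamma>: "\<gamma> \<in> K" for \<gamma>
  proof -
    obtain m where "is_min_poly \<rat> \<gamma> m" by (rule number_field_min_poly[OF K \<gamma>])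
    then show ?thesis using is_subfieldD(1)[OF subfield_adjoin[OF Q]] by blast
  qed
  have mono: "adjoin \<rat> \<gamma> \<subseteq> adjoin \<rat> \<delta>" if "\<gamma> \<in> adjoin \<rat> \<delta>" "\<delta> \<in> K" for \<gamma> \<delta>
    by (rule adjoin_subset[OF Q base_subset_adjoin[OF Q] sub[OF that(2)] that(1)])
  have fin: "\<exists>\<gamma>\<in>K. S \<subseteq> adjoin \<rat> \<gamma>" if "finite S" "S \<subseteq> K" for S
    using that
  proof (induction S)
    case empty
    then show ?case using subring_one[OF Kr] by blast
  next
    case (insert \<beta> S)
    then obtain \<gamma> where \<gamma>: "\<gamma> \<in> K" "S \<subseteq> adjoin \<rat> \<gamma>" by blast
    have "\<beta> \<in> K" using insert.prems by blast
    obtain \<delta> where \<delta>: "\<delta> \<in> K" "\<gamma> \<in> adjoin \<rat> \<delta>" "\<beta> \<in> adjoin \<rat> \<delta>"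
      by (rule primitive_element_two[OF K \<gamma>(1) \<open>\<beta> \<in> K\<close>])
    then show ?case using mono[OF \<delta>(2,1)] \<gamma>(2) by blast
  qed
  obtain B where B: "finite B" and KB': "K = module.span rat_scale B"
    using K unfolding number_field_def by blast
  have KB: "K = range (\<lambda>u. \<Sum>b\<in>B. rat_scale (u b) b)"
    unfolding KB' by (rule module.span_finite[OF module_rat_scale B])
  have BK: "B \<subseteq> K" unfolding KB' by (rule module.span_superset[OF module_rat_scale])
  obtain \<gamma> where \<gamma>: "\<gamma> \<in> K" "B \<subseteq> adjoin \<rat> \<gamma>" using fin[OF B BK] by blast
  have "K \<subseteq> adjoin \<rat> \<gamma>"
  proof
    fix x assume "x \<in> K"
    then obtain u where x: "x = (\<Sum>b\<in>B. of_rat (u b) * b)" unfolding KB rat_scale_def by auto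
    show "x \<in> adjoin \<rat> \<gamma>"
      unfolding x
    proof (intro subring_sum[OF sub[OF \<gamma>(1)]] subring_mult[OF sub[OF \<gamma>(1)]])
      show "of_rat (u b) \<in> adjoin \<rat> \<gamma>" for b using base_subset_adjoin[OF Q, of \<gamma>] by auto
      show "b \<in> adjoin \<rat> \<gamma>" if "b \<in> B" for b using \<gamma>(2) that by blast
    qed
  qed
  \<comment> \<open>A nonzero integer multiple of the generator generates the same field and can be
    made integral; then all integral polynomials in it lie in the ring of integers.\<close>
  obtain N :: nat where N: "0 < N" "algebraic_int (of_nat N * \<gamma>)"
    by (rule number_field_scaled_integral[OF K \<gamma>(1)])
  define \<theta> where "\<theta> = of_nat N * \<gamma>"
  have \<theta>: "\<theta> \<in> K" unfolding \<theta>_def using subring_mult[OF Kr subring_of_nat[OF Kr] \<gamma>(1)] .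
  have "inverse (of_nat N) \<in> adjoin \<rat> \<theta>" using base_subset_adjoin[OF Q, of \<theta>] by auto
  then have "inverse (of_nat N) * \<theta> \<in> adjoin \<rat> \<theta>"
    using subring_mult[OF sub[OF \<theta>]] generator_in_adjoin[OF Q] by blast
  then have "\<gamma> \<in> adjoin \<rat> \<theta>" unfolding \<theta>_def using N(1) by (simp add: mult.assoc[symmetric])
  then have "K \<subseteq> adjoin \<rat> \<theta>" using \<open>K \<subseteq> adjoin \<rat> \<gamma>\<close> mono[OF _ \<theta>] by blast
  moreover have "adjoin \<rat> \<theta> \<subseteq> K" by (rule adjoin_subset[OF Q QK Kr \<theta>])
  ultimately show ?thesis using that[of \<theta>] \<theta> N(2) unfolding \<theta>_def by blast
qed

section \<open>Embeddings as conjugates, and the norm of an integer\<close>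

lemma embedding_Rats:
  assumes K: "number_field K" and \<tau>: "\<tau> \<in> embeddings K" and x: "x \<in> \<rat>"
  shows "\<tau> x = x"
proof -
  note Kr = number_fieldD(2)[OF K]
  have h: "ring_hom_on K \<tau>" using \<tau> unfolding embeddings_def by blast
  obtain q where q: "x = of_rat q" using x by (rule Rats_cases)
  obtain a b where ab: "q = Rat.Fract a b" "b > 0" by (cases q) auto
  have xb: "x * of_int b = of_int a" using ab unfolding q by (simp add: of_rat_rat)
  have "x \<in> K" using x Rats_subset_subfield[OF number_fieldD(1)[OF K]] by blast
  then have "\<tau> x * of_int b = of_int a"
    using ring_hom_onD(3)[OF h _ subring_of_int[OF Kr], of x b] ring_hom_on_of_int[OF h Kr] xb by simp
  then have "\<tau> x * of_int b = x * of_int b" using xb by simp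
  then show ?thesis using ab(2) by simp
qed

lemma embedding_poly:
  assumes K: "number_field K" and \<tau>: "\<tau> \<in> embeddings K" and p: "p \<in> polys_over \<rat>" and z: "z \<in> K"
  shows "\<tau> (poly p z) = poly p (\<tau> z)"
proof -
  note Kr = number_fieldD(2)[OF K]
  have h: "ring_hom_on K \<tau>" using \<tau> unfolding embeddings_def by blast
  have cK: "coeff p i \<in> K" for i
    using p Rats_subset_subfield[OF number_fieldD(1)[OF K]] unfolding polys_over_def by blast
  have "\<tau> (poly p z) = (\<Sum>i\<le>degree p. \<tau> (coeff p i * z ^ i))"
    unfolding poly_altdef by (rule ring_hom_on_sum[OF h Kr]) (intro subring_mult[OF Kr] cK subring_power[OF Kr] z)
  also have "\<dots> = (\<Sum>i\<le>degree p. coeff p i * \<tau> z ^ i)"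
  proof (rule sum.cong[OF refl])
    fix i
    have "\<tau> (coeff p i) = coeff p i" by (rule embedding_Rats[OF K \<tau>]) (use p in \<open>simp add: polys_over_def\<close>)
    then show "\<tau> (coeff p i * z ^ i) = coeff p i * \<tau> z ^ i"
      using ring_hom_onD(3)[OF h cK subring_power[OF Kr z]] ring_hom_on_power[OF h Kr z] by simp
  qed
  finally show ?thesis unfolding poly_altdef .
qed

text \<open>Embeddings fix the rationals, so the image of \<theta> is a root of \<open>q\<close> and
  determines the embedding on \<open>K\<close>; off \<open>K\<close> all are 0. Conversely a root
  \<alpha> defines one by sending \<open>poly p \<theta>\<close> to
  \<open>poly p \<alpha>\<close>.\<close>

lemma embeddings_bij_roots:
  assumes K: "number_field K" and K\<theta>: "K = adjoin \<rat> \<theta>" and q: "is_min_poly \<rat> \<theta> q"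
  shows "bij_betw (\<lambda>\<tau>. \<tau> \<theta>) (embeddings K) {\<alpha>. poly q \<alpha> = 0}"
proof -
  note Q = is_subfield_Rats
  have \<theta>: "\<theta> \<in> K" unfolding K\<theta> by (rule generator_in_adjoin[OF Q])
  have q': "q \<in> polys_over \<rat>" "poly q \<theta> = 0" using q unfolding is_min_poly_def by auto
  have inj: "inj_on (\<lambda>\<tau>. \<tau> \<theta>) (embeddings K)"
  proof (rule inj_onI, rule ext)
    fix \<tau> \<tau>' z assume t: "\<tau> \<in> embeddings K" "\<tau>' \<in> embeddings K" "\<tau> \<theta> = \<tau>' \<theta>"
    show "\<tau> z = \<tau>' z"
    proof (cases "z \<in> K")
      case True
      then obtain p where "z = poly p \<theta>" "p \<in> polys_over \<rat>" unfolding K\<theta> adjoin_def by blast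
      then show ?thesis using embedding_poly[OF K t(1) _ \<theta>] embedding_poly[OF K t(2) _ \<theta>] t(3) by simp
    next
      case False
      then show ?thesis using t unfolding embeddings_def by simp
    qed
  qed
  have "\<alpha> \<in> (\<lambda>\<tau>. \<tau> \<theta>) ` embeddings K" if \<alpha>: "poly q \<alpha> = 0" for \<alpha>
  proof -
    have wd: "poly p \<alpha> = poly p' \<alpha>"
      if "poly p \<theta> = poly p' \<theta>" "p \<in> polys_over \<rat>" "p' \<in> polys_over \<rat>" for p p'
    proof -
      have "poly (p - p') \<theta> = 0" "p - p' \<in> polys_over \<rat>"
        using that polys_over_diff[OF is_subfieldD(1)[OF Q]] by simp_all
      then obtain s where "p - p' = q * s" using q unfolding is_min_poly_def by blast
      then have "poly (p - p') \<alpha> = 0" using \<alpha> by simp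
      then show ?thesis by simp
    qed
    \<comment> \<open>The chosen representative does not matter: two polynomials equal at \<theta>
      differ by a multiple of \<open>q\<close>, hence agree at \<alpha>.\<close>
    define \<tau> where "\<tau> z = (if z \<in> K then poly (SOME p. p \<in> polys_over \<rat> \<and> z = poly p \<theta>) \<alpha> else 0)" for z
    have \<tau>: "\<tau> (poly p \<theta>) = poly p \<alpha>" if p: "p \<in> polys_over \<rat>" for p
    proof -
      let ?s = "SOME r. r \<in> polys_over \<rat> \<and> poly p \<theta> = poly r \<theta>"
      have "?s \<in> polys_over \<rat> \<and> poly p \<theta> = poly ?s \<theta>" by (rule someI[of _ p]) (use p in simp)
      moreover have "poly p \<theta> \<in> K" unfolding K\<theta> adjoin_def using p by blast
      ultimately show ?thesis unfolding \<tau>_def using wd[of ?s p] p by simp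
    qed
    have "\<tau> \<in> embeddings K"
      unfolding embeddings_def ring_hom_on_def
    proof (intro CollectI conjI ballI allI impI)
      show "\<tau> 1 = 1" using \<tau>[OF polys_over_1[OF is_subfieldD(1)[OF Q]]] by simp
      show "\<tau> z = 0" if "z \<notin> K" for z unfolding \<tau>_def using that by simp
      fix a b assume "a \<in> K" "b \<in> K"
      then obtain p r where pr: "a = poly p \<theta>" "b = poly r \<theta>" "p \<in> polys_over \<rat>" "r \<in> polys_over \<rat>"
        unfolding K\<theta> adjoin_def by blast
      show "\<tau> (a + b) = \<tau> a + \<tau> b"
        using \<tau>[OF polys_over_add[OF is_subfieldD(1)[OF Q] pr(3,4)]] \<tau>[OF pr(3)] \<tau>[OF pr(4)] pr(1,2) by simp
      show "\<tau> (a * b) = \<tau> a * \<tau> b"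
        using \<tau>[OF polys_over_mult[OF is_subfieldD(1)[OF Q] pr(3,4)]] \<tau>[OF pr(3)] \<tau>[OF pr(4)] pr(1,2) by simp
    qed
    moreover have "\<tau> \<theta> = \<alpha>"
    proof -
      have "[:0, 1:] \<in> polys_over \<rat>"
        by (simp add: polys_over_pCons polys_over_0[OF is_subfieldD(1)[OF Q]])
      from \<tau>[OF this] show ?thesis by simp
    qed
    ultimately show ?thesis by blast
  qed
  moreover have "poly q (\<tau> \<theta>) = 0" if "\<tau> \<in> embeddings K" for \<tau>
  proof -
    have "\<tau> 0 = 0" by (rule embedding_Rats[OF K that]) simp
    then show ?thesis using embedding_poly[OF K that q'(1) \<theta>] q'(2) by simp
  qed
  ultimately show ?thesis unfolding bij_betw_def using inj by blast
qed

lemma finite_embeddings: assumes K: "number_field K" shows "finite (embeddings K)"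
proof -
  obtain \<theta> where \<theta>: "\<theta> \<in> K" "K = adjoin \<rat> \<theta>" using primitive_element[OF K] by blast
  obtain q where q: "is_min_poly \<rat> \<theta> q" by (rule number_field_min_poly[OF K \<theta>(1)])
  then have "q \<noteq> 0" unfolding is_min_poly_def by auto
  then show ?thesis
    using bij_betw_finite[OF embeddings_bij_roots[OF K \<theta>(2) q]] poly_roots_finite by blast
qed

lemma embedding_nonzero:
  assumes K: "number_field K" and \<tau>: "\<tau> \<in> embeddings K" and z: "z \<in> K" "z \<noteq> 0"
  shows "\<tau> z \<noteq> 0"
proof
  assume "\<tau> z = 0"
  have h: "ring_hom_on K \<tau>" using \<tau> unfolding embeddings_def by blast
  have "\<tau> (z * inverse z) = \<tau> z * \<tau> (inverse z)"
    using ring_hom_onD(3)[OF h z(1) is_subfieldD(2)[OF number_fieldD(1)[OF K] z(1)]] .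
  then show False using \<open>\<tau> z = 0\<close> z(2) ring_hom_onD(1)[OF h] by simp
qed

lemma embedding_algebraic_int:
  assumes K: "number_field K" and \<tau>: "\<tau> \<in> embeddings K" and z: "z \<in> K" "algebraic_int z"
  shows "algebraic_int (\<tau> z)"
proof -
  obtain p where p: "lead_coeff p = 1" "\<forall>i. coeff p i \<in> \<int>" "poly p z = 0"
    using z(2) by (auto elim: algebraic_int.cases)
  have "p \<in> polys_over \<rat>" unfolding polys_over_def using p(2) Ints_subset_Rats by blast
  then have "poly p (\<tau> z) = \<tau> 0" using embedding_poly[OF K \<tau> _ z(1)] p(3) by metis
  also have "\<tau> 0 = 0" by (rule embedding_Rats[OF K \<tau>]) simp
  finally show ?thesis using p(1,2) by (intro algebraic_int.intros) auto
qed

text \<open>The product of the conjugates is rational, being a product over the roots of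
  \<open>q\<close>, and is an algebraic integer. So it is an integer, and nonzero because embeddings
  are injective.\<close>

lemma norm_ge_one:
  assumes K: "number_field K" and y: "y \<in> ring_of_integers K" "y \<noteq> 0"
  shows "1 \<le> (\<Prod>\<tau>\<in>embeddings K. cmod (\<tau> y))"
proof -
  note Q = is_subfield_Rats
  have yK: "y \<in> K" "algebraic_int y" using y unfolding ring_of_integers_def by auto
  obtain \<theta> where \<theta>: "\<theta> \<in> K" "K = adjoin \<rat> \<theta>" using primitive_element[OF K] by blast
  obtain q where q: "is_min_poly \<rat> \<theta> q" by (rule number_field_min_poly[OF K \<theta>(1)])
  have q': "q \<in> polys_over \<rat>" "lead_coeff q = 1" "q \<noteq> 0" using q unfolding is_min_poly_def by auto
  obtain p where p: "y = poly p \<theta>" "p \<in> polys_over \<rat>" using yK(1) \<theta>(2) unfolding adjoin_def by blast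
  define P where "P = (\<Prod>\<tau>\<in>embeddings K. \<tau> y)"
  have "P = (\<Prod>\<tau>\<in>embeddings K. poly p (\<tau> \<theta>))"
    unfolding P_def p(1) by (intro prod.cong refl embedding_poly[OF K _ p(2) \<theta>(1)])
  also have "\<dots> = (\<Prod>\<alpha>\<in>{\<alpha>. poly q \<alpha> = 0}. poly p \<alpha>)"
    by (rule prod.reindex_bij_betw[OF embeddings_bij_roots[OF K \<theta>(2) q]])
  also have "\<dots> = (\<Prod>\<alpha>\<in>#proots q. poly p \<alpha>)"
  proof -
    \<comment> \<open>Simple roots identify the multiset in \<open>prod_over_roots\<close> with the
      set of roots indexed by the embeddings.\<close>
    have "rsquarefree q"
      unfolding rsquarefree_roots using min_poly_separable[OF Q min_poly_conjugate[OF Q q]] by blast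
    then have ord: "order \<alpha> q = 1" if "poly q \<alpha> = 0" for \<alpha>
      using that q'(3) by (simp add: rsquarefree_root_order)
    have "(\<Prod>\<alpha>\<in>#proots q. poly p \<alpha>) = (\<Prod>\<alpha>\<in>{\<alpha>. poly q \<alpha> = 0}. poly p \<alpha> ^ order \<alpha> q)"
      using q'(3) by (subst image_prod_mset_multiplicity) simp_all
    also have "\<dots> = (\<Prod>\<alpha>\<in>{\<alpha>. poly q \<alpha> = 0}. poly p \<alpha>)" by (intro prod.cong refl) (simp add: ord)
    finally show ?thesis by simp
  qed
  also have "\<dots> \<in> \<rat>" by (rule prod_over_roots[OF Q q'(1,2) p(2)])
  finally have "P \<in> \<rat>" .
  moreover have "algebraic_int P"
    unfolding P_def by (intro algebraic_int_prod embedding_algebraic_int[OF K _ yK])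
  ultimately have "P \<in> \<int>" by (intro rational_algebraic_int_is_int)
  then obtain n :: int where n: "P = of_int n" by (rule Ints_cases)
  have "P \<noteq> 0" unfolding P_def using finite_embeddings[OF K] embedding_nonzero[OF K _ yK(1) y(2)] by simp
  then have "1 \<le> \<bar>n\<bar>" using n by auto
  then have "1 \<le> cmod P" unfolding n by simp
  then show ?thesis unfolding P_def by (simp add: prod_norm)
qed

section \<open>Heights\<close>

lemma pigeonhole_fibre:
  assumes "finite T" "finite C" "f ` T \<subseteq> C" "card C * m < card T"
  shows "\<exists>c. m < card {x \<in> T. f x = c}"
proof (rule ccontr)
  assume "\<not> ?thesis"
  then have le: "\<And>c. card {x \<in> T. f x = c} \<le> m" by (simp add: not_less)
  have "card T = (\<Sum>c\<in>C. card {x \<in> T. f x = c})"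
    using sum.group[OF assms(1-3), of "\<lambda>_. 1 :: nat"] by simp
  also have "\<dots> \<le> card C * m" using sum_bounded_above[of C "\<lambda>c. card {x \<in> T. f x = c}" m] le by simp
  finally show False using assms(4) by simp
qed

text \<open>Some fibre of \<open>f\<close> on \<open>T\<close> has more than
  \<open>card C ^ k\<close> elements. Translating it by one of its members and multiplying by
  \<open>b\<close> sends it injectively into \<open>R\<close>, where the argument is repeated with
  the exponent lowered by one.\<close>

lemma iterated_pigeonhole:
  fixes R :: "complex set"
  assumes R: "is_subring R" and C: "finite C" "f ` R \<subseteq> C" and b: "b \<noteq> 0"
    and f: "\<And>x y. x \<in> R \<Longrightarrow> y \<in> R \<Longrightarrow> f x = f y \<Longrightarrow> b * (x - y) \<in> R"
    and T: "finite T" "T \<subseteq> R" "card C ^ k < card T"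
  shows "\<exists>x\<in>T. \<exists>y\<in>T. x \<noteq> y \<and> b ^ k * (x - y) \<in> R"
  using T
proof (induction k arbitrary: T)
  case 0
  then obtain x y where xy: "x \<in> T" "y \<in> T" "x \<noteq> y" using card_le_Suc0_iff_eq[OF 0(1)] by auto
  then have "x - y \<in> R" using 0(2) subring_diff[OF R] by blast
  then show ?case using xy by (intro bexI[of _ x] bexI[of _ y]) simp_all
next
  case (Suc k)
  have "f ` T \<subseteq> C" using Suc.prems(2) C(2) by blast
  then obtain c where c: "card C ^ k < card {x \<in> T. f x = c}"
    using pigeonhole_fibre[OF Suc.prems(1) C(1), of f "card C ^ k"] Suc.prems(3) by auto
  let ?T = "{x \<in> T. f x = c}"
  have "0 < card ?T" using c by linarith
  then have "?T \<noteq> {}" by (metis card.empty less_irrefl)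
  then obtain t where t: "t \<in> ?T" by blast
  let ?g = "\<lambda>x. b * (x - t)"
  have inj: "inj_on ?g ?T" using b by (simp add: inj_on_def)
  have "?g ` ?T \<subseteq> R" using f t Suc.prems(2) by auto
  moreover have "card C ^ k < card (?g ` ?T)" using c card_image[OF inj] by simp
  moreover have "finite (?g ` ?T)" using Suc.prems(1) by simp
  ultimately have "\<exists>x\<in>?g ` ?T. \<exists>y\<in>?g ` ?T. x \<noteq> y \<and> b ^ k * (x - y) \<in> R" by (intro Suc.IH)
  then obtain x y where "x \<in> ?T" "y \<in> ?T" "?g x \<noteq> ?g y" "b ^ k * (?g x - ?g y) \<in> R" by blast
  moreover have "b ^ k * (?g x - ?g y) = b ^ Suc k * (x - y)" by (simp add: algebra_simps)
  ultimately show ?case by auto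
qed

text \<open>
  If \<open>b\<close> maps a subgroup of index at most \<open>n\<close> of the ring of integers into this ring, then
  \<open>b\<^sup>k\<close> does so with index \<open>n\<^sup>k\<close>. Small elements of the subgroup, found by the pigeonhole principle, have
  images of norm at least 1; letting \<open>k\<close> grow removes the constants.
\<close>

lemma norm_index_bound:
  assumes K: "number_field K" and b: "b \<in> K" "b \<noteq> 0"
    and C: "finite C" "f ` ring_of_integers K \<subseteq> C"
    and f: "\<And>x y. x \<in> ring_of_integers K \<Longrightarrow> y \<in> ring_of_integers K \<Longrightarrow> f x = f y \<Longrightarrow> b * (x - y) \<in> ring_of_integers K"
  shows "1 \<le> real (card C) * (\<Prod>\<tau>\<in>embeddings K. cmod (\<tau> b))"
proof -
  note Q = is_subfield_Rats
  note Kr = number_fieldD(2)[OF K]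
  define R where "R = ring_of_integers K"
  define \<beta> where "\<beta> = (\<Prod>\<tau>\<in>embeddings K. cmod (\<tau> b))"
  define n where "n = card C"
  have R: "is_subring R" unfolding R_def by (rule is_subring_ring_of_integers[OF Kr])
  have n: "1 \<le> n"
  proof -
    have "f 0 \<in> C" using C(2) subring_zero[OF R] unfolding R_def by blast
    then show ?thesis unfolding n_def using C(1) by (metis One_nat_def Suc_leI card_gt_0_iff empty_iff)
  qed
  obtain \<theta> where \<theta>: "\<theta> \<in> K" "algebraic_int \<theta>" "K = adjoin \<rat> \<theta>" using primitive_element[OF K] by blast
  obtain q where q: "is_min_poly \<rat> \<theta> q" by (rule number_field_min_poly[OF K \<theta>(1)])
  have q0: "q \<noteq> 0" using q unfolding is_min_poly_def by auto
  define d where "d = degree q"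
  have d: "0 < d" unfolding d_def by (rule min_poly_degree_pos[OF q])
  have cardE: "card (embeddings K) \<le> d"
    using bij_betw_same_card[OF embeddings_bij_roots[OF K \<theta>(3) q]] card_poly_roots_bound[OF q0] unfolding d_def by simp
  \<comment> \<open>Integral polynomials of degree below that of \<theta>: distinct coefficient
    vectors give distinct integers of \<open>K\<close>, and bounded coefficients give bounded
    conjugates.\<close>
  define P where "P m = (\<Sum>i<d. monom (of_int (m i)) i :: complex poly)" for m :: "nat \<Rightarrow> int"
  have cP: "coeff (P m) i = (if i < d then of_int (m i) else 0)" for m i
    unfolding P_def coeff_sum by (simp add: sum.delta' if_distrib cong: if_cong)
  have PQ: "P m \<in> polys_over \<rat>" for m unfolding polys_over_def by (simp add: cP)
  have eP: "poly (P m) z = (\<Sum>i<d. of_int (m i) * z ^ i)" for m z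
    unfolding P_def poly_sum poly_monom ..
  have \<theta>R: "\<theta> \<in> R" unfolding R_def ring_of_integers_def using \<theta> by blast
  have PR: "poly (P m) \<theta> \<in> R" for m
    unfolding eP by (intro subring_sum[OF R] subring_mult[OF R] subring_of_int[OF R] subring_power[OF R] \<theta>R)
  have Pdiff: "P m - P m' = P (\<lambda>i. m i - m' i)" for m m' by (rule poly_eqI) (simp add: cP)
  have Pinj: "m i = m' i" if "poly (P m) \<theta> = poly (P m') \<theta>" "i < d" for m m' i
  proof (rule ccontr)
    assume ne: "m i \<noteq> m' i"
    let ?p = "P (\<lambda>i. m i - m' i)"
    have "coeff ?p i \<noteq> 0" using ne that(2) by (simp add: cP)
    then have p0: "?p \<noteq> 0" by auto
    have "poly ?p \<theta> = 0" unfolding Pdiff[symmetric] using that(1) by simp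
    then have "d \<le> degree ?p" unfolding d_def by (rule min_poly_degree_le[OF q PQ _ p0])
    moreover have "degree ?p < d"
      using p0 d by (intro degree_lessI) (auto simp: cP)
    ultimately show False by simp
  qed
  define c where "c = 1 + (\<Sum>\<tau>\<in>embeddings K. \<Sum>i<d. cmod (\<tau> \<theta>) ^ i)"
  have c1: "1 \<le> c" unfolding c_def by (simp add: sum_nonneg)
  have size: "cmod (\<tau> (poly (P m) \<theta>)) \<le> real N * c"
    if \<tau>: "\<tau> \<in> embeddings K" and m: "\<And>i. i < d \<Longrightarrow> \<bar>m i\<bar> \<le> int N" for \<tau> m N
  proof -
    have "\<tau> (poly (P m) \<theta>) = (\<Sum>i<d. of_int (m i) * \<tau> \<theta> ^ i)"
      using embedding_poly[OF K \<tau> PQ \<theta>(1)] eP by simp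
    also have "cmod \<dots> \<le> (\<Sum>i<d. real N * cmod (\<tau> \<theta>) ^ i)"
    proof (rule order_trans[OF norm_sum sum_mono])
      fix i assume "i \<in> {..<d}"
      then have "\<bar>m i\<bar> \<le> int N" using m by simp
      then have "\<bar>real_of_int (m i)\<bar> \<le> real N" by linarith
      then show "cmod (of_int (m i) * \<tau> \<theta> ^ i) \<le> real N * cmod (\<tau> \<theta>) ^ i"
        by (simp add: norm_mult norm_power mult_right_mono)
    qed
    also have "\<dots> = real N * (\<Sum>i<d. cmod (\<tau> \<theta>) ^ i)" by (simp add: sum_distrib_left)
    also have "(\<Sum>i<d. cmod (\<tau> \<theta>) ^ i) \<le> (\<Sum>\<tau>\<in>embeddings K. \<Sum>i<d. cmod (\<tau> \<theta>) ^ i)"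
      by (rule member_le_sum[OF \<tau>, where f = "\<lambda>\<tau>. \<Sum>i<d. cmod (\<tau> \<theta>) ^ i"])
        (auto intro: sum_nonneg finite_embeddings[OF K])
    then have "real N * (\<Sum>i<d. cmod (\<tau> \<theta>) ^ i) \<le> real N * c"
      unfolding c_def by (intro mult_left_mono) auto
    finally show ?thesis .
  qed
  have \<beta>0: "0 \<le> \<beta>" unfolding \<beta>_def by (simp add: prod_nonneg)
  have main: "1 \<le> ((\<beta> * real n) ^ d) ^ j * (2 * c) ^ d" for j
  proof -
    \<comment> \<open>The least side for which the box of \<open>N ^ d\<close> coefficient vectors
      has more than \<open>n ^ (j * d)\<close> elements.\<close>
    define N where "N = n ^ j + 1"
    define T where "T = (\<lambda>g. poly (P (\<lambda>i. int (g i))) \<theta>) ` PiE {..<d} (\<lambda>_. {..<N})"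
    have "inj_on (\<lambda>g. poly (P (\<lambda>i. int (g i))) \<theta>) (PiE {..<d} (\<lambda>_. {..<N}))"
    proof (rule inj_onI)
      fix g g' assume g: "g \<in> PiE {..<d} (\<lambda>_. {..<N})" "g' \<in> PiE {..<d} (\<lambda>_. {..<N})"
        and eq: "poly (P (\<lambda>i. int (g i))) \<theta> = poly (P (\<lambda>i. int (g' i))) \<theta>"
      show "g = g'" by (rule PiE_ext[OF g]) (use Pinj[OF eq] in simp)
    qed
    then have "card T = N ^ d" unfolding T_def by (simp add: card_image card_PiE)
    moreover have "(n ^ j) ^ d < N ^ d" unfolding N_def using d by (intro power_strict_mono) auto
    ultimately have "n ^ (j * d) < card T" by (simp add: power_mult)
    moreover have "finite T" "T \<subseteq> R" unfolding T_def using PR by (auto intro: finite_PiE)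
    ultimately obtain x y where xy: "x \<in> T" "y \<in> T" "x \<noteq> y" "b ^ (j * d) * (x - y) \<in> R"
      using iterated_pigeonhole[OF R C(1) C(2)[folded R_def] b(2) f[folded R_def], of T "j * d"] unfolding n_def by blast
    obtain g where g: "x = poly (P (\<lambda>i. int (g i))) \<theta>" "g \<in> PiE {..<d} (\<lambda>_. {..<N})" using xy(1) unfolding T_def by blast
    obtain g' where g': "y = poly (P (\<lambda>i. int (g' i))) \<theta>" "g' \<in> PiE {..<d} (\<lambda>_. {..<N})" using xy(2) unfolding T_def by blast
    define m where "m i = int (g i) - int (g' i)" for i
    have xym: "x - y = poly (P m) \<theta>" unfolding m_def g(1) g'(1) Pdiff[symmetric] by simp
    have mN: "\<bar>m i\<bar> \<le> int N" if "i < d" for i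
    proof -
      have "g i < N" "g' i < N" using g(2) g'(2) that by (auto simp: PiE_iff)
      then show ?thesis unfolding m_def by linarith
    qed
    have xyK: "x - y \<in> K" unfolding xym using PR[of m] unfolding R_def ring_of_integers_def by blast
    have "b ^ (j * d) * (x - y) \<noteq> 0" using b(2) xy(3) by simp
    then have "1 \<le> (\<Prod>\<tau>\<in>embeddings K. cmod (\<tau> (b ^ (j * d) * (x - y))))"
      using norm_ge_one[OF K] xy(4) unfolding R_def by blast
    also have "\<dots> = (\<Prod>\<tau>\<in>embeddings K. cmod (\<tau> b) ^ (j * d) * cmod (\<tau> (x - y)))"
    proof (rule prod.cong[OF refl])
      fix \<tau> assume "\<tau> \<in> embeddings K"
      then have h: "ring_hom_on K \<tau>" unfolding embeddings_def by blast
      show "cmod (\<tau> (b ^ (j * d) * (x - y))) = cmod (\<tau> b) ^ (j * d) * cmod (\<tau> (x - y))"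
        unfolding ring_hom_onD(3)[OF h subring_power[OF Kr b(1)] xyK] ring_hom_on_power[OF h Kr b(1)]
        by (simp add: norm_mult norm_power)
    qed
    also have "\<dots> = \<beta> ^ (j * d) * (\<Prod>\<tau>\<in>embeddings K. cmod (\<tau> (x - y)))"
      unfolding \<beta>_def by (simp add: prod.distrib prod_power_distrib)
    also have "\<dots> \<le> \<beta> ^ (j * d) * (real N * c) ^ card (embeddings K)"
    proof (intro mult_left_mono)
      have "(\<Prod>\<tau>\<in>embeddings K. cmod (\<tau> (x - y))) \<le> (\<Prod>\<tau>\<in>embeddings K. real N * c)"
        by (intro prod_mono) (use size[OF _ mN] in \<open>auto simp: xym\<close>)
      then show "(\<Prod>\<tau>\<in>embeddings K. cmod (\<tau> (x - y))) \<le> (real N * c) ^ card (embeddings K)" by simp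
    qed (use \<beta>0 in simp)
    also have "\<dots> \<le> \<beta> ^ (j * d) * (2 * real n ^ j * c) ^ d"
    proof (intro mult_left_mono)
      have nj: "1 \<le> real n ^ j" using n by simp
      have N2: "1 \<le> real N" "real N \<le> 2 * real n ^ j" unfolding N_def using nj by simp_all
      have "1 * 1 \<le> real N * c" using N2 c1 by (intro mult_mono) auto
      \<comment> \<open>The base is at least 1, so the number of embeddings may be replaced by the
        degree \<open>d\<close>, matching the exponent from the pigeonhole count.\<close>
      then have "(real N * c) ^ card (embeddings K) \<le> (real N * c) ^ d" using cardE by (intro power_increasing) simp_all
      also have "\<dots> \<le> (2 * real n ^ j * c) ^ d"
        using N2 c1 by (intro power_mono mult_right_mono) auto
      finally show "(real N * c) ^ card (embeddings K) \<le> (2 * real n ^ j * c) ^ d" .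
    qed (use \<beta>0 in simp)
    also have "\<dots> = ((\<beta> * real n) ^ d) ^ j * (2 * c) ^ d"
      by (simp add: power_mult_distrib power_mult[symmetric] mult_ac)
    finally show ?thesis .
  qed
  have "1 \<le> \<beta> * real n"
  proof (rule ccontr)
    assume "\<not> ?thesis"
    moreover have "0 \<le> \<beta> * real n" using \<beta>0 by simp
    ultimately have "(\<beta> * real n) ^ d < 1" using d by (simp add: power_less_one_iff)
    moreover have "0 < 1 / (2 * c) ^ d" using c1 by simp
    ultimately obtain j where "((\<beta> * real n) ^ d) ^ j < 1 / (2 * c) ^ d"
      using real_arch_pow_inv by blast
    then have "((\<beta> * real n) ^ d) ^ j * (2 * c) ^ d < 1" using c1 by (simp add: pos_less_divide_eq)
    then show False using main[of j] by simp
  qed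
  then show ?thesis unfolding \<beta>_def n_def by (simp add: mult.commute)
qed

section \<open>Heights on the toric scheme\<close>

context projective_toric
begin

text \<open>At every reduction \<open>R'\<close> the section has the regular local expression
  \<open>(character m * D R') ^ l\<close>, whose value lies in the localization at the prime. So the
  value of a global section at \<open>x\<close>, times any integer of \<open>K\<close>, belongs to
  the pulled-back module.\<close>

lemma pullback_generator:
  assumes K: "number_field K" and x: "x \<in> points_over X K" and m: "m \<in> lattice_points"
    and z: "z \<in> ring_of_integers K"
  shows "snd x (character m * D (fst x)) ^ l * z \<in> pullback_module X (\<lambda>R. D R ^ l) K x"
proof -
  let ?R = "fst x" and ?ev = "snd x" and ?O = "ring_of_integers K"
  note xd = points_overD[OF x]
  note Kr = number_fieldD(2)[OF K]
  have O: "is_subring ?O" by (rule is_subring_ring_of_integers[OF Kr])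
  have mR: "character m * D ?R \<in> ?R" by (rule lattice_point_section[OF xd(1) m])
  have "?ev (character m * D ?R) ^ l * z * ?ev (D R' ^ l / D ?R ^ l) \<in> localize ?O P"
    if P: "is_prime_ideal ?O P" and R': "is_reduction X K x P R'" for P R'
  proof -
    have R'X: "R' \<in> X" "R' \<subseteq> ?R" "?ev ` R' \<subseteq> localize ?O P"
      using R' unfolding is_reduction_def Let_def by blast+
    have L: "is_subring (localize ?O P)" "z \<in> localize ?O P"
      using is_subring_localize[OF O P] subset_localize[OF O P] z by blast+
    have dR: "D R' / D ?R \<in> ?R" using divisor_quotient_unit[OF xd(1) R'X(1,2)] by blast
    have "?ev ((character m * D ?R) ^ l * (D R' / D ?R) ^ l) = ?ev (character m * D ?R) ^ l * ?ev ((D R' / D ?R) ^ l)"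
      using ring_hom_onD(3)[OF xd(2) subring_power[OF xd(3) mR] subring_power[OF xd(3) dR]]
        ring_hom_on_power[OF xd(2,3) mR] by simp
    moreover have "(character m * D ?R) ^ l * (D R' / D ?R) ^ l = (character m * D R') ^ l"
      using divisor_nonzero[OF xd(1)] by (simp add: power_mult_distrib[symmetric])
    moreover have "(character m * D R') ^ l \<in> R'"
      by (rule subring_power[OF point_subring[OF R'X(1)] lattice_point_section[OF R'X(1) m]])
    ultimately have "?ev (character m * D ?R) ^ l * ?ev ((D R' / D ?R) ^ l) \<in> localize ?O P"
      using R'X(3) by (metis image_subset_iff)
    then have "(?ev (character m * D ?R) ^ l * ?ev ((D R' / D ?R) ^ l)) * z \<in> localize ?O P"
      by (rule subring_mult[OF L(1) _ L(2)])
    then show ?thesis by (simp add: power_divide mult_ac)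
  qed
  moreover have "?ev (character m * D ?R) ^ l * z \<in> K"
    using subring_mult[OF Kr subring_power[OF Kr xd(5)[OF mR]]] z unfolding ring_of_integers_def by blast
  ultimately show ?thesis unfolding pullback_module_def by blast
qed

text \<open>With \<open>c\<close> the value at \<open>x\<close> of a nonvanishing section and
  \<open>b = c / a\<close>, the finite part is at least minus the logarithm of the product of the
  moduli of the conjugates of \<open>b\<close>, by \<open>norm_index_bound\<close>. At each
  embedding the metric term is at most minus the logarithm of the modulus of the conjugate of
  \<open>b\<close>. If the index is infinite, the height is too.\<close>

lemma heights_nonneg_tensor_power: "heights_nonneg X (tensor_power l Dbar)"
  unfolding heights_nonneg_def fst_tensor_power
proof (intro allI impI, elim conjE)
  fix K x a
  assume K: "number_field K" and x: "x \<in> points_over X K"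
    and a: "a \<in> pullback_module X (\<lambda>R. D R ^ l) K x - {0}"
  let ?R = "fst x" and ?ev = "snd x" and ?O = "ring_of_integers K" and ?E = "embeddings K"
  let ?M = "pullback_module X (\<lambda>R. D R ^ l) K x"
  note xd = points_overD[OF x]
  note Kr = number_fieldD(2)[OF K]
  have O: "is_subring ?O" by (rule is_subring_ring_of_integers[OF Kr])
  have aK: "a \<in> K" "a \<noteq> 0" using a unfolding pullback_module_def by auto
  obtain m where m: "m \<in> lattice_points" "character m * D ?R \<in> ?R - max_ideal ?R"
    using exists_generator[OF xd(1)] by blast
  define c1 where "c1 = ?ev (character m * D ?R)"
  have c1: "c1 \<in> K" "c1 \<noteq> 0" unfolding c1_def using xd(4,5) m(2) by auto
  define c where "c = c1 ^ l"
  have c: "c \<in> K" "c \<noteq> 0" unfolding c_def using c1 subring_power[OF Kr] by auto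
  have cM: "c * z \<in> ?M" if "z \<in> ?O" for z
    unfolding c_def c1_def by (rule pullback_generator[OF K x m(1) that])
  define b where "b = c / a"
  have b: "b \<in> K" "b \<noteq> 0"
    unfolding b_def divide_inverse using c aK subring_mult[OF Kr] is_subfieldD(2)[OF number_fieldD(1)[OF K]] by auto
  define Cl where "Cl = (\<lambda>c. (+) c ` ((*) a ` ?O)) ` ?M"
  define s where "s = (\<Sum>\<tau>\<in>?E. ln (cmod (\<tau> a) * snd (tensor_power l Dbar) (?R, \<lambda>r. \<tau> (?ev r))))"
  have "ereal s \<le> log_card Cl"
  proof (cases "finite Cl")
    case True
    \<comment> \<open>The class of \<open>c z\<close> modulo \<open>a\<close> times the ring of
      integers. If \<open>z\<close> and \<open>w\<close> have the same class, then
      \<open>c (z - w)\<close> is \<open>a\<close> times an integer, that is,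
      \<open>b (z - w)\<close> is integral.\<close>
    define f where "f z = (+) (c * z) ` ((*) a ` ?O)" for z
    have fC: "f ` ?O \<subseteq> Cl" unfolding f_def Cl_def using cM by blast
    have fd: "b * (z - w) \<in> ?O" if zw: "z \<in> ?O" "w \<in> ?O" "f z = f w" for z w
    proof -
      have "c * z \<in> f z" unfolding f_def using subring_zero[OF O] by force
      then obtain v where "v \<in> ?O" "c * z = c * w + a * v" using zw(3) unfolding f_def by auto
      moreover from this have "b * (z - w) = v" unfolding b_def using aK(2) by (simp add: field_simps)
      ultimately show ?thesis by simp
    qed
    have one: "1 \<le> real (card Cl) * (\<Prod>\<tau>\<in>?E. cmod (\<tau> b))"
      by (rule norm_index_bound[OF K b True fC fd])
    have hom: "ring_hom_on K \<tau>" if "\<tau> \<in> ?E" for \<tau> using that unfolding embeddings_def by blast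
    have pos: "0 < cmod (\<tau> a)" "0 < cmod (\<tau> b)" "0 < cmod (\<tau> c1)" if "\<tau> \<in> ?E" for \<tau>
      using embedding_nonzero[OF K that] aK b c1 by simp_all
    have "s \<le> (\<Sum>\<tau>\<in>?E. - ln (cmod (\<tau> b)))"
      unfolding s_def
    proof (rule sum_mono)
      fix \<tau> assume \<tau>: "\<tau> \<in> ?E"
      let ?x = "(?R, \<lambda>r. \<tau> (?ev r))"
      \<comment> \<open>The section used is one of the coordinates over which the canonical metric
        takes the maximum; this is what gives the metric term its sign.\<close>
      have "cmod (\<tau> c1) \<le> coord_max ?x" using coord_max_ge[OF m(1), of ?x] unfolding c1_def by simp
      then have cm: "cmod (\<tau> c1) ^ l \<le> coord_max ?x ^ l" by (rule power_mono) simp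
      have "\<tau> (b * a) = \<tau> b * \<tau> a" using ring_hom_onD(3)[OF hom[OF \<tau>] b(1) aK(1)] .
      moreover have "b * a = c1 ^ l" unfolding b_def c_def using aK(2) by simp
      ultimately have "\<tau> b * \<tau> a = \<tau> c1 ^ l" using ring_hom_on_power[OF hom[OF \<tau>] Kr c1(1)] by simp
      then have ba: "cmod (\<tau> b) * cmod (\<tau> a) = cmod (\<tau> c1) ^ l" by (metis norm_mult norm_power)
      have p: "0 < cmod (\<tau> c1) ^ l" using pos(3)[OF \<tau>] by simp
      have "cmod (\<tau> a) * snd (tensor_power l Dbar) ?x = cmod (\<tau> a) / coord_max ?x ^ l"
        by (simp add: snd_tensor_power power_divide)
      also have "\<dots> \<le> cmod (\<tau> a) / cmod (\<tau> c1) ^ l"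
        using cm p by (intro divide_left_mono mult_pos_pos) auto
      also have "\<dots> = 1 / cmod (\<tau> b)"
        unfolding ba[symmetric] using pos[OF \<tau>] by simp
      finally have le: "cmod (\<tau> a) * snd (tensor_power l Dbar) ?x \<le> 1 / cmod (\<tau> b)" .
      have "0 < cmod (\<tau> a) * snd (tensor_power l Dbar) ?x"
        using pos(1)[OF \<tau>] order.strict_trans2[OF p cm] by (simp add: snd_tensor_power power_divide)
      then have "ln (cmod (\<tau> a) * snd (tensor_power l Dbar) ?x) \<le> ln (1 / cmod (\<tau> b))"
        using le pos(2)[OF \<tau>] by (subst ln_le_cancel_iff) auto
      then show "ln (cmod (\<tau> a) * snd (tensor_power l Dbar) ?x) \<le> - ln (cmod (\<tau> b))"
        using pos(2)[OF \<tau>] by (simp add: ln_div)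
    qed
    also have "\<dots> = - ln (\<Prod>\<tau>\<in>?E. cmod (\<tau> b))"
      using pos(2) by (subst ln_prod[OF finite_embeddings[OF K]]) (auto simp: sum_negf)
    also have "\<dots> \<le> ln (real (card Cl))"
    proof -
      have bp: "0 < (\<Prod>\<tau>\<in>?E. cmod (\<tau> b))" using pos(2) by (intro prod_pos)
      then have "0 < real (card Cl)" using one by (cases "card Cl = 0") auto
      then have "ln (real (card Cl) * (\<Prod>\<tau>\<in>?E. cmod (\<tau> b))) = ln (real (card Cl)) + ln (\<Prod>\<tau>\<in>?E. cmod (\<tau> b))"
        using bp by (rule ln_mult_pos)
      moreover have "0 \<le> ln (real (card Cl) * (\<Prod>\<tau>\<in>?E. cmod (\<tau> b)))" using one by (rule ln_ge_zero)
      ultimately show ?thesis by linarith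
    qed
    finally show ?thesis unfolding log_card_def using True by simp
  qed (simp add: log_card_def)
  then have "0 \<le> log_card Cl - ereal s" by (simp add: ereal_diff_positive)
  then show "0 \<le> height_via X (tensor_power l Dbar) K x a"
    unfolding height_via_def fst_tensor_power Cl_def s_def
    by (intro ereal_0_le_mult) simp_all
qed

lemma nef_tensor_power: "nef X (tensor_power l Dbar)"
  unfolding nef_def fst_tensor_power
  using relatively_nef_tensor_power chern_semipositive_tensor_power heights_nonneg_tensor_power by blast

end

theorem proposition0p1:
  fixes \<Sigma> :: "(real^'n::{finite,linorder}) set set"
    and \<psi> :: "real^'n::{finite,linorder} \<Rightarrow> real"
    and l :: nat
  defines "X \<equiv> toric_scheme \<Sigma>"
    and "Dbar \<equiv> canonical_metrized_divisor \<Sigma> \<psi>"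
  assumes "fan \<Sigma>"
    and "smooth_over_Z CARD('n) X"
    and "projective_over_Z X"
    and "support_function \<Sigma> \<psi>"
    and "globally_generated X (toric_divisor \<Sigma> \<psi>)"
    and "l \<ge> 1"
  shows "small_sections X (tensor_power l Dbar) =
           {character m | m. lattice_vec m \<in> (*\<^sub>R) (real l) ` polytope_of \<psi>} \<union>
           {- character m | m. lattice_vec m \<in> (*\<^sub>R) (real l) ` polytope_of \<psi>} \<union> {0}
         \<and> nef X (tensor_power l Dbar)
         \<and> \<not> big X (tensor_power l Dbar)"
proof -
  interpret projective_toric \<Sigma> \<psi>
    by unfold_locales (use assms in \<open>simp_all add: X_def\<close>)
  show ?thesis
    unfolding X_def Dbar_def using small_sections_eq[OF \<open>l \<ge> 1\<close>] nef_tensor_power not_big by blast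
qed

end
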